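(* For all positive coprime integers $k$ and $l$, the data $(\mathbb C[\mathbb{WP}_{k,l,q}],\pi_h\oplus\pi_h,\mathcal H'\oplus\mathcal H',D',\omega)$ define a $2$-summable even spectral triple over $\mathbb C[\mathbb{WP}_{k,l,q}]$.
   Context: Fix $q\in(0,1)$, $[n]_q=\frac{q^n-q^{-n}}{q-q^{-1}}$, $\mathbb N_0=\{0,1,2,\dots\}$. $U_q(\mathfrak{su}_2)$ is the unital complex algebra generated by $e,f,K,K^{-1}$ (the Cartan generator is denoted $K$ to distinguish it from the integer $k$) with $Ke=qeK$, $Kf=q^{-1}fK$, $[e,f]=\frac{K^2-K^{-2}}{q-q^{-1}}$, $KK^{-1}=K^{-1}K=1$. It is a Hopf $*$-algebra with $\triangle(K)=K\otimes K$, $\triangle(e)=e\otimes K+K^{-1}\otimes e$, $\triangle(f)=f\otimes K+K^{-1}\otimes f$, $S(K)=K^{-1}$, $S(e)=-qe$, $S(f)=-q^{-1}f$, $\epsilon(K)=1$, $\epsilon(e)=\epsilon(f)=0$, $e^*=f$, $K^*=K$. For $\lambda\in\frac12\mathbb N_0$, $M_\lambda$ is the irreducible module with basis $u_{\lambda m}$, $m\in\{-\lambda,-\lambda+1,\dots,\lambda\}$, and representation $\varrho_\lambda(e)u_{\lambda m}=\sqrt{[\lambda-m]_q[\lambda+m+1]_q}\,u_{\lambda,m+1}$, $\varrho_\lambda(f)u_{\lambda m}=\sqrt{[\lambda-m+1]_q[\lambda+m]_q}\,u_{\lambda,m-1}$, $\varrho_\lambda(K)u_{\lambda m}=q^mu_{\lambda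 m}$; $u^*_{\lambda m}$ is the dual basis. $\mathbb C[SU_{2,q}]=\bigoplus_{\lambda\in\frac12\mathbb N_0}M_\lambda^*\otimes M_\lambda$ has linear basis $t^\lambda_{mn}=u^*_{\lambda m}\otimes u_{\lambda n}$; its elements are functionals on $U_q(\mathfrak{su}_2)$ via $t^\lambda_{mn}(x)=u^*_{\lambda m}(\varrho_\lambda(x)u_{\lambda n})$. It is a unital $*$-algebra with $(tt')(x)=t(x')t'(x'')$ where $\triangle(x)=x'\otimes x''$ (Sweedler), unit $t^0_{00}$, and $t^*(x)=\overline{t(S(x)^* )}$. As a $*$-algebra it is generated by $\alpha=t^{1/2}_{\frac12,\frac12}$ and $\beta=t^{1/2}_{\frac12,-\frac12}$. Coaction: $B=\mathbb C[u,u^{-1}]$ with $u$ grouplike and unitary; for positive coprime integers $k,l$, $\theta:\mathbb C[SU_{2,q}]\to\mathbb C[SU_{2,q}]\otimes B$ is the $*$-homomorphism with $\alpha\mapsto\alpha\otimes u^{-k}$, $\beta\mapsto\beta\otimes u^l$, and $\mathbb C[\mathbb{WP}_{k,l,q}]=\mathbb C[SU_{2,q}]^{(0)}=\{t:\theta(t)=t\otimes1\}$. It is linearly spanned by the vectors $t^\lambda_{p(l+k),p(l-k)}$ with $\lambda\in\frac12\mathbb N_0$ and $p\in\frac12\mathbb Z$ such that the indices lie in $\{-\lambda,-\lambda+1,\dots,\lambda\}$. The Haar state $h$ is the linear functional on $\mathbb C[SU_{2,q}]$ with $h(1)=1$ and $h(t^\lambda_{mn})=0$ for $\lambda>0$.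 $\mathcal H'$ is the Hilbert space completion of $\mathbb C[SU_{2,q}]^{(0)}$ in the inner product $\langle a,b\rangle=h(a^*b)$, and $\pi_h$ is the representation of $\mathbb C[\mathbb{WP}_{k,l,q}]$ on $\mathcal H'$ by left multiplication. Write $t^{\lambda,\uparrow}_{p(l+k),p(l-k)}$ and $t^{\lambda,\downarrow}_{p(l+k),p(l-k)}$ for the basis vectors $t^\lambda_{p(l+k),p(l-k)}$ of $\mathbb C[SU_{2,q}]^{(0)}$ (with $\lambda\in\frac12\mathbb N_0$ and $p\in\frac12\mathbb Z$ such that $p(l+k)$ and $p(l-k)$ lie in $\{-\lambda,-\lambda+1,\dots,\lambda\}$) regarded as elements of the first and second summand of $\mathcal H'\oplus\mathcal H'$, respectively. $D'$ is the densely defined self-adjoint operator with $$D't^{\lambda,\uparrow}_{p(l+k),p(l-k)}=(\lambda+1)t^{\lambda,\downarrow}_{p(l+k),p(l-k)},\qquad D't^{\lambda,\downarrow}_{p(l+k),p(l-k)}=(\lambda+1)t^{\lambda,\uparrow}_{p(l+k),p(l-k)},$$ and $\omega$ is the chirality operator with $\omega t^{\lambda,\uparrow}_{p(l+k),p(l-k)}=t^{\lambda,\uparrow}_{p(l+k),p(l-k)}$, $\omega t^{\lambda,\downarrow}_{p(l+k),p(l-k)}=-t^{\lambda,\downarrow}_{p(l+k),p(l-k)}$. A spectral triple $(\mathcal A,\pi,H,D)$ consists of a unital $*$-algebra $\mathcal A$ with a faithful $*$-representation $\pi$ by bounded operators on a Hilbert space $H$ and a densely defined self-adjoint operator $D$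 on $H$ with compact resolvent such that $[D,\pi(a)]$ extends to a bounded operator for all $a\in\mathcal A$. It is even, with chirality operator $\omega$, if $\omega=\omega^*$, $\omega^2=1$, $\omega D+D\omega=0$ and $[\omega,\pi(a)]=0$ for all $a\in\mathcal A$. For an invertible such $D$, $2$-summable means that the sum of the eigenvalues of $D^{-2}$ (with multiplicity) over the eigenspaces of $D$ with $|\text{eigenvalue}|\le\Lambda$ diverges logarithmically, i.e. grows at the order of $\log\Lambda$, as $\Lambda\to\infty$. *)

theory Defs
  imports
    "HOL-Analysis.Analysis"
    "HOL-Library.Poly_Mapping"
    "HOL-Library.Landau_Symbols"
    "HOL-Library.FuncSet"
    "HOL-Algebra.Module"
begin

section \<open>Unital star-algebras over the complex numbers\<close>

definition complex_ring :: "complex ring" where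
  "complex_ring = \<lparr>carrier = UNIV, monoid.mult = (*), one = 1, zero = 0, add = (+)\<rparr>"

record 'a star_algebra = "(complex, 'a) module" +
  star :: "'a \<Rightarrow> 'a"

locale unital_star_algebra = ring A + module complex_ring A
  for A :: "('a, 'm) star_algebra_scheme" (structure) +
  assumes smult_mult_left:
      "\<lbrakk>x \<in> carrier A; y \<in> carrier A\<rbrakk> \<Longrightarrow> (c \<odot> x) \<otimes> y = c \<odot> (x \<otimes> y)"
    and smult_mult_right:
      "\<lbrakk>x \<in> carrier A; y \<in> carrier A\<rbrakk> \<Longrightarrow> x \<otimes> (c \<odot> y) = c \<odot> (x \<otimes> y)"
    and star_closed: "x \<in> carrier A \<Longrightarrow> star A x \<in> carrier A"
    and star_star: "x \<in> carrier A \<Longrightarrow> star A (star A x) = x"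
    and star_add:
      "\<lbrakk>x \<in> carrier A; y \<in> carrier A\<rbrakk> \<Longrightarrow> star A (x \<oplus> y) = star A x \<oplus> star A y"
    and star_smult: "x \<in> carrier A \<Longrightarrow> star A (c \<odot> x) = cnj c \<odot> star A x"
    and star_mult:
      "\<lbrakk>x \<in> carrier A; y \<in> carrier A\<rbrakk> \<Longrightarrow> star A (x \<otimes> y) = star A y \<otimes> star A x"

definition star_hom ::
    "('a, 'm) star_algebra_scheme \<Rightarrow> ('b, 'n) star_algebra_scheme \<Rightarrow> ('a \<Rightarrow> 'b) set" where
  "star_hom A B = {f \<in> ring_hom A B. \<forall>x\<in>carrier A.
      (\<forall>c. f (c \<odot>\<^bsub>A\<^esub> x) = c \<odot>\<^bsub>B\<^esub> f x) \<and> f (star A x) = star B (f x)}"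

text \<open>The star-algebra \<open>A \<otimes> \<complex>[u, u\<^sup>-\<^sup>1]\<close> with \<open>u\<close> unitary: the finitely supported family \<open>p\<close>
  stands for the sum of the elements \<open>p i \<otimes> u\<^sup>i\<close>.\<close>

definition laurent :: "('a, 'm) star_algebra_scheme \<Rightarrow> (int \<Rightarrow> 'a) star_algebra" where
  "laurent A = \<lparr>
     carrier = {p. (\<forall>i. p i \<in> carrier A) \<and> finite {i. p i \<noteq> \<zero>\<^bsub>A\<^esub>}},
     monoid.mult = (\<lambda>p r n. \<Oplus>\<^bsub>A\<^esub>i\<in>{i. p i \<noteq> \<zero>\<^bsub>A\<^esub>}. p i \<otimes>\<^bsub>A\<^esub> r (n - i)),
     one = (\<lambda>n. if n = 0 then \<one>\<^bsub>A\<^esub> else \<zero>\<^bsub>A\<^esub>),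
     zero = (\<lambda>n. \<zero>\<^bsub>A\<^esub>),
     add = (\<lambda>p r n. p n \<oplus>\<^bsub>A\<^esub> r n),
     smult = (\<lambda>c p n. c \<odot>\<^bsub>A\<^esub> p n),
     star = (\<lambda>p n. star A (p (- n)))\<rparr>"

definition laurent_monom :: "('a, 'm) star_algebra_scheme \<Rightarrow> 'a \<Rightarrow> int \<Rightarrow> (int \<Rightarrow> 'a)" where
  "laurent_monom A a i = (\<lambda>n. if n = i then a else \<zero>\<^bsub>A\<^esub>)"


section \<open>The Hopf star-algebra \<open>U\<^sub>q(su\<^sub>2)\<close> and its dual\<close>

text \<open>\<open>U\<^sub>q(su\<^sub>2)\<close> is the quotient of the free algebra on four generators by the ideal
  \<open>Uq_ideal q\<close>. Linear functionals on \<open>U\<^sub>q(su\<^sub>2)\<close> are encoded as linear functionals on the free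
  algebra that vanish on this ideal. The structure maps are given on representatives in the free
  algebra; since the pairs of words index a basis of the tensor square of the free algebra,
  the latter is the monoid algebra of \<open>gen_word \<times> gen_word\<close>.\<close>

datatype generator = GE | GF | GK | GKinv

datatype gen_word = Word (letters: "generator list")

instantiation gen_word :: monoid_add
begin
definition "0 = Word []"
definition "v + w = Word (letters v @ letters w)"
instance
  by standard (simp_all add: zero_gen_word_def plus_gen_word_def)
end

type_synonym free_alg = "gen_word \<Rightarrow>\<^sub>0 complex"
type_synonym free_alg2 = "(gen_word \<times> gen_word) \<Rightarrow>\<^sub>0 complex"
type_synonym functional = "free_alg \<Rightarrow> complex"

abbreviation const :: "complex \<Rightarrow> 'w::monoid_add \<Rightarrow>\<^sub>0 complex" where
  "const c \<equiv> Poly_Mapping.single 0 c"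

definition gen :: "generator \<Rightarrow> free_alg" where
  "gen g = Poly_Mapping.single (Word [g]) 1"

definition Uq_relations :: "real \<Rightarrow> free_alg set" where
  "Uq_relations q =
     {gen GK * gen GE - const (of_real q) * gen GE * gen GK,
      gen GK * gen GF - const (of_real (1 / q)) * gen GF * gen GK,
      gen GE * gen GF - gen GF * gen GE
        - const (of_real (1 / (q - 1 / q))) * (gen GK ^ 2 - gen GKinv ^ 2),
      gen GK * gen GKinv - 1,
      gen GKinv * gen GK - 1}"

inductive_set Uq_ideal :: "real \<Rightarrow> free_alg set" for q :: real where
  zero: "0 \<in> Uq_ideal q"
| generate: "r \<in> Uq_relations q \<Longrightarrow> x * r * y \<in> Uq_ideal q"
| add: "\<lbrakk>x \<in> Uq_ideal q; y \<in> Uq_ideal q\<rbrakk> \<Longrightarrow> x + y \<in> Uq_ideal q"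

definition Uq_dual :: "real \<Rightarrow> functional set" where
  "Uq_dual q = {\<phi>. (\<forall>x y. \<phi> (x + y) = \<phi> x + \<phi> y) \<and> (\<forall>c x. \<phi> (const c * x) = c * \<phi> x) \<and>
     (\<forall>x\<in>Uq_ideal q. \<phi> x = 0)}"

fun coproduct_gen :: "generator \<Rightarrow> free_alg2" where
  "coproduct_gen GE = Poly_Mapping.single (Word [GE], Word [GK]) 1
     + Poly_Mapping.single (Word [GKinv], Word [GE]) 1"
| "coproduct_gen GF = Poly_Mapping.single (Word [GF], Word [GK]) 1
     + Poly_Mapping.single (Word [GKinv], Word [GF]) 1"
| "coproduct_gen GK = Poly_Mapping.single (Word [GK], Word [GK]) 1"
| "coproduct_gen GKinv = Poly_Mapping.single (Word [GKinv], Word [GKinv]) 1"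

definition coproduct :: "free_alg \<Rightarrow> free_alg2" where
  "coproduct x = (\<Sum>w\<in>Poly_Mapping.keys x.
     const (Poly_Mapping.lookup x w) * prod_list (map coproduct_gen (letters w)))"

fun antipode_gen :: "real \<Rightarrow> generator \<Rightarrow> free_alg" where
  "antipode_gen q GE = const (of_real (- q)) * gen GE"
| "antipode_gen q GF = const (of_real (- (1 / q))) * gen GF"
| "antipode_gen q GK = gen GKinv"
| "antipode_gen q GKinv = gen GK"

definition antipode :: "real \<Rightarrow> free_alg \<Rightarrow> free_alg" where
  "antipode q x = (\<Sum>w\<in>Poly_Mapping.keys x.
     const (Poly_Mapping.lookup x w) * prod_list (map (antipode_gen q) (rev (letters w))))"

fun star_gen :: "generator \<Rightarrow> generator" where
  "star_gen GE = GF"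
| "star_gen GF = GE"
| "star_gen GK = GK"
| "star_gen GKinv = GKinv"

definition Uq_star :: "free_alg \<Rightarrow> free_alg" where
  "Uq_star x = (\<Sum>w\<in>Poly_Mapping.keys x.
     const (cnj (Poly_Mapping.lookup x w)) * prod_list (map (\<lambda>g. gen (star_gen g)) (rev (letters w))))"


section \<open>The irreducible modules and their matrix coefficients\<close>

definition half_nats :: "real set" where
  "half_nats = {real n / 2 |n. True}"

definition half_ints :: "real set" where
  "half_ints = {real_of_int n / 2 |n. True}"

definition weights :: "real \<Rightarrow> real set" where
  "weights L = {m. m \<le> L \<and> (\<exists>i::nat. m = - L + real i)}"

definition qnum :: "real \<Rightarrow> real \<Rightarrow> real" where
  "qnum q x = (q powr x - q powr (- x)) / (q - 1 / q)"

text \<open>\<open>rep_gen q L g m n\<close> is the coefficient of the basis vector \<open>u\<^sub>L\<^sub>m\<close> in the image of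
  \<open>u\<^sub>L\<^sub>n\<close> under the generator \<open>g\<close>.\<close>

fun rep_gen :: "real \<Rightarrow> real \<Rightarrow> generator \<Rightarrow> real \<Rightarrow> real \<Rightarrow> complex" where
  "rep_gen q L GE m n =
     (if m = n + 1 then of_real (sqrt (qnum q (L - n) * qnum q (L + n + 1))) else 0)"
| "rep_gen q L GF m n =
     (if m = n - 1 then of_real (sqrt (qnum q (L - n + 1) * qnum q (L + n))) else 0)"
| "rep_gen q L GK m n = (if m = n then of_real (q powr n) else 0)"
| "rep_gen q L GKinv m n = (if m = n then of_real (q powr (- n)) else 0)"

primrec rep_word :: "real \<Rightarrow> real \<Rightarrow> generator list \<Rightarrow> real \<Rightarrow> real \<Rightarrow> complex" where
  "rep_word q L [] m n = (if m = n then 1 else 0)"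
| "rep_word q L (g # w) m n = (\<Sum>i\<in>weights L. rep_gen q L g m i * rep_word q L w i n)"

definition tmat :: "real \<Rightarrow> real \<Rightarrow> real \<Rightarrow> real \<Rightarrow> functional" where
  "tmat q L m n x = (\<Sum>w\<in>Poly_Mapping.keys x.
     Poly_Mapping.lookup x w * rep_word q L (letters w) m n)"

definition cspan :: "functional set \<Rightarrow> functional set" where
  "cspan S = {\<lambda>x. \<Sum>t\<in>T. c t * t x |T c. finite T \<and> T \<subseteq> S}"

text \<open>In \<open>conv \<phi> \<psi> x\<close> the functional \<open>\<phi> \<otimes> \<psi>\<close> is evaluated on the coproduct of \<open>x\<close>.\<close>

definition conv :: "functional \<Rightarrow> functional \<Rightarrow> functional" where
  "conv \<phi> \<psi> x = (\<Sum>(v, w)\<in>Poly_Mapping.keys (coproduct x).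
     Poly_Mapping.lookup (coproduct x) (v, w) *
       (\<phi> (Poly_Mapping.single v 1) * \<psi> (Poly_Mapping.single w 1)))"

definition SUq :: "real \<Rightarrow> functional star_algebra" where
  "SUq q = \<lparr>
     carrier = cspan {tmat q L m n |L m n. L \<in> half_nats \<and> m \<in> weights L \<and> n \<in> weights L},
     monoid.mult = conv,
     one = tmat q 0 0 0,
     zero = (\<lambda>x. 0),
     add = (\<lambda>\<phi> \<psi> x. \<phi> x + \<psi> x),
     smult = (\<lambda>c \<phi> x. c * \<phi> x),
     star = (\<lambda>\<phi> x. cnj (\<phi> (Uq_star (antipode q x))))\<rparr>"


text \<open>Elements of \<open>SUq q\<close> are functionals on \<open>U\<^sub>q(su\<^sub>2)\<close>, that is, they vanish on the
  defining ideal.\<close>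

lemma finite_weights: "finite (weights L)"
proof (rule finite_subset)
  show "weights L \<subseteq> (\<lambda>i. - L + real i) ` {..nat \<lceil>2 * L\<rceil>}"
  proof
    fix m assume "m \<in> weights L"
    then obtain i :: nat where i: "m = - L + real i" "m \<le> L" by (auto simp: weights_def)
    then have "real i \<le> 2 * L" by simp
    then have "i \<le> nat \<lceil>2 * L\<rceil>" by linarith
    with i show "m \<in> (\<lambda>i. - L + real i) ` {..nat \<lceil>2 * L\<rceil>}" by auto
  qed
qed auto

lemma rep_word_append:
  assumes "m \<in> weights L"
  shows "rep_word q L (v @ w) m n = (\<Sum>i\<in>weights L. rep_word q L v m i * rep_word q L w i n)"
  using assms
proof (induction v arbitrary: m)
  case Nil
  then show ?case by (simp add: finite_weights if_distrib[of "\<lambda>x. x * _"] cong: if_cong)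
next
  case (Cons g v)
  have "rep_word q L ((g # v) @ w) m n =
      (\<Sum>j\<in>weights L. rep_gen q L g m j * (\<Sum>i\<in>weights L. rep_word q L v j i * rep_word q L w i n))"
    using Cons.IH by simp
  also have "\<dots> = (\<Sum>i\<in>weights L. \<Sum>j\<in>weights L. rep_gen q L g m j * rep_word q L v j i * rep_word q L w i n)"
    by (subst sum.swap) (simp add: sum_distrib_left mult.assoc)
  finally show ?case by (simp add: sum_distrib_right)
qed

lemma tmat_superset:
  assumes "finite S" "Poly_Mapping.keys x \<subseteq> S"
  shows "tmat q L m n x = (\<Sum>w\<in>S. Poly_Mapping.lookup x w * rep_word q L (letters w) m n)"
  unfolding tmat_def using assms by (intro sum.mono_neutral_left) (auto simp: in_keys_iff)

lemma tmat_add: "tmat q L m n (x + y) = tmat q L m n x + tmat q L m n y"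
proof -
  define S where "S = Poly_Mapping.keys x \<union> Poly_Mapping.keys y"
  have "finite S" "Poly_Mapping.keys x \<subseteq> S" "Poly_Mapping.keys y \<subseteq> S" "Poly_Mapping.keys (x + y) \<subseteq> S"
    using Poly_Mapping.keys_add[of x y] by (auto simp: S_def)
  then show ?thesis
    by (simp add: tmat_superset[of S] lookup_add algebra_simps sum.distrib)
qed

lemma tmat_single: "tmat q L m n (Poly_Mapping.single w c) = c * rep_word q L (letters w) m n"
  by (subst tmat_superset[of "{w}"]) (auto simp: lookup_single)

lemma tmat_zero: "tmat q L m n 0 = 0"
  by (simp add: tmat_def)

lemma tmat_diff: "tmat q L m n (x - y) = tmat q L m n x - tmat q L m n y"
  using tmat_add[of q L m n "x - y" y] by simp

lemma free_alg_induct [case_names single add]: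
  fixes x :: "'w \<Rightarrow>\<^sub>0 complex"
  assumes "\<And>w c. P (Poly_Mapping.single w c)" and "\<And>x y. P x \<Longrightarrow> P y \<Longrightarrow> P (x + y)"
  shows "P x"
proof (induction x rule: update_induct)
  case const
  show ?case using assms(1)[of undefined 0] by simp
next
  case (update f a b)
  then have "Poly_Mapping.update a b f = f + Poly_Mapping.single a b"
    by (intro poly_mapping_eqI) (auto simp: lookup_update lookup_add lookup_single in_keys_iff when_def)
  then show ?case using assms(2)[OF update(3) assms(1)] by simp
qed

lemma tmat_mult:
  assumes m: "m \<in> weights L"
  shows "tmat q L m n (x * y) = (\<Sum>i\<in>weights L. tmat q L m i x * tmat q L i n y)"
proof (induction x rule: free_alg_induct)
  case (single v c)
  show ?case
  proof (induction y rule: free_alg_induct)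
    case (single w d)
    show ?case
      by (simp add: mult_single tmat_single plus_gen_word_def rep_word_append[OF m]
          sum_distrib_left algebra_simps)
  next
    case (add f g)
    then show ?case by (simp add: distrib_left tmat_add sum.distrib)
  qed
next
  case (add f g)
  then show ?case by (simp add: distrib_right tmat_add sum.distrib)
qed

lemma tmat_gen: "m \<in> weights L \<Longrightarrow> n \<in> weights L \<Longrightarrow> tmat q L m n (gen g) = rep_gen q L g m n"
  by (simp add: gen_def tmat_single finite_weights if_distrib[of "\<lambda>x. _ * x"] cong: if_cong)

lemma tmat_const_mult: "tmat q L m n (const c * x) = c * tmat q L m n x"
proof (induction x rule: free_alg_induct)
  case (single w d)
  then show ?case by (simp add: mult_single tmat_single)
next
  case (add x y)
  then show ?case by (simp add: distrib_left tmat_add)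
qed

lemma qnum_denominator:
  fixes q :: real
  assumes "0 < q" "q < 1"
  shows "q - 1 / q < 0"
proof -
  have "q * q < 1" using mult_strict_mono[of q 1 q 1] assms by simp
  then show ?thesis using assms by (simp add: pos_less_divide_eq)
qed

lemma qnum_nonneg:
  assumes "0 < q" "q < 1" "0 \<le> x"
  shows "0 \<le> qnum q x"
proof -
  have "q powr x \<le> q powr (- x)" using assms by (intro powr_mono') auto
  then show ?thesis
    unfolding qnum_def using qnum_denominator[OF assms(1,2)] by (intro divide_nonpos_nonpos) auto
qed

lemma qnum_commutator:
  assumes "0 < q" "q < 1"
  shows "qnum q (L - m + 1) * qnum q (L + m) - qnum q (L - m) * qnum q (L + m + 1) =
    ((q powr m)\<^sup>2 - (q powr (- m))\<^sup>2) / (q - 1 / q)"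
proof -
  define a a' b b' q' where
    "a = q powr L" and "a' = q powr (- L)" and "b = q powr m" and "b' = q powr (- m)"
    and "q' = 1 / q"
  have inv: "a * a' = 1" "b * b' = 1"
    using assms by (simp_all add: a_def a'_def b_def b'_def powr_minus)
  have e: "q powr (L - m + 1) = a * b' * q" "q powr (- (L - m + 1)) = a' * b * q'"
    "q powr (L + m) = a * b" "q powr (- (L + m)) = a' * b'"
    "q powr (L - m) = a * b'" "q powr (- (L - m)) = a' * b"
    "q powr (L + m + 1) = a * b * q" "q powr (- (L + m + 1)) = a' * b' * q'"
    using assms
    by (simp_all add: a_def a'_def b_def b'_def q'_def powr_add powr_diff powr_minus divide_simps)
  have num: "(a * b' * q - a' * b * q') * (a * b - a' * b') -
      (a * b' - a' * b) * (a * b * q - a' * b' * q') = (b\<^sup>2 - b'\<^sup>2) * (q - q')"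
  proof -
    have "(a * b' * q - a' * b * q') * (a * b - a' * b') -
      (a * b' - a' * b) * (a * b * q - a' * b' * q') = (a * a') * ((b\<^sup>2 - b'\<^sup>2) * (q - q'))"
      by (simp add: algebra_simps power2_eq_square)
    with inv show ?thesis by simp
  qed
  have "qnum q (L - m + 1) * qnum q (L + m) - qnum q (L - m) * qnum q (L + m + 1) =
     ((b\<^sup>2 - b'\<^sup>2) * (q - q')) / ((q - q') * (q - q'))"
    unfolding qnum_def e times_divide_times_eq diff_divide_distrib[symmetric] q'_def[symmetric] num ..
  then show ?thesis using qnum_denominator[OF assms] by (simp add: b_def b'_def q'_def)
qed

lemma weights_lower: "n \<in> weights L \<Longrightarrow> n - 1 \<notin> weights L \<Longrightarrow> L + n = 0"
proof -
  assume n: "n \<in> weights L" and n1: "n - 1 \<notin> weights L"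
  then obtain i :: nat where i: "n = - L + real i" "n \<le> L" by (auto simp: weights_def)
  show ?thesis
  proof (cases i)
    case (Suc j)
    with i have "n - 1 = - L + real j" "n - 1 \<le> L" by simp_all
    with n1 show ?thesis by (auto simp: weights_def)
  qed (use i in simp)
qed

lemma weights_upper:
  assumes L: "L \<in> half_nats" and n: "n \<in> weights L" and n1: "n + 1 \<notin> weights L"
  shows "L - n = 0"
proof -
  obtain i :: nat where i: "n = - L + real i" "n \<le> L" using n by (auto simp: weights_def)
  obtain j :: nat where j: "L = real j / 2" using L by (auto simp: half_nats_def)
  have "n + 1 = - L + real (Suc i)" using i by simp
  with n1 have "\<not> n + 1 \<le> L" unfolding weights_def by blast
  with i j have "real i \<le> real j" "real j < real i + 1" by (auto simp: field_simps)
  then have "i = j" by linarith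
  with i j show ?thesis by simp
qed

lemma weights_bounds: "n \<in> weights L \<Longrightarrow> 0 \<le> L + n" "n \<in> weights L \<Longrightarrow> 0 \<le> L - n"
  by (auto simp: weights_def)

lemma qnum_0 [simp]: "qnum q 0 = 0"
  by (cases "q = 0") (simp_all add: qnum_def)

lemma tmat_relation:
  assumes q: "0 < q" "q < 1" and L: "L \<in> half_nats" and m: "m \<in> weights L" and n: "n \<in> weights L"
    and r: "r \<in> Uq_relations q"
  shows "tmat q L m n r = 0"
proof -
  have prod: "tmat q L m n (gen g * gen h) =
      (\<Sum>i\<in>weights L. rep_gen q L g m i * rep_gen q L h i n)" for g h
    using m n by (simp add: tmat_mult tmat_gen)
  have pick: "(\<Sum>i\<in>weights L. f i * (if i = j then c else 0)) = (if j \<in> weights L then f j * c else 0)"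
    for j c and f :: "real \<Rightarrow> complex"
    using finite_weights[of L] by (simp add: if_distrib[of "\<lambda>x. _ * x"] cong: if_cong)
  have one: "tmat q L m n 1 = (if m = n then 1 else 0)"
  proof -
    have "(1 :: free_alg) = Poly_Mapping.single (Word []) 1"
      by (simp flip: zero_gen_word_def)
    then show ?thesis unfolding \<open>1 = Poly_Mapping.single (Word []) 1\<close> tmat_single by simp
  qed
  have shift: "q powr (n + 1) = q * q powr n" "q powr (n - 1) = q powr n / q"
    using q by (simp_all add: powr_add powr_diff)
  have KE: "tmat q L m n (gen GK * gen GE) = of_real q * tmat q L m n (gen GE * gen GK)"
    unfolding prod using n m by (auto simp: pick shift)
  have KF: "tmat q L m n (gen GK * gen GF) = of_real (1 / q) * tmat q L m n (gen GF * gen GK)"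
    unfolding prod using n m by (auto simp: pick shift)
  have KK: "tmat q L m n (gen GK * gen GK) = (if m = n then of_real ((q powr n)\<^sup>2) else 0)"
    "tmat q L m n (gen GKinv * gen GKinv) = (if m = n then of_real ((q powr (- n))\<^sup>2) else 0)"
    "tmat q L m n (gen GK * gen GKinv) = (if m = n then 1 else 0)"
    "tmat q L m n (gen GKinv * gen GK) = (if m = n then 1 else 0)"
    unfolding prod using n q
    by (simp_all add: pick power2_eq_square flip: of_real_mult powr_add)
  have EF: "tmat q L m n (gen GE * gen GF) =
      (if m = n then of_real (qnum q (L - n + 1) * qnum q (L + n)) else 0)"
  proof -
    have "0 \<le> qnum q (L - n + 1) * qnum q (L + n)"
      using weights_bounds[OF n] by (intro mult_nonneg_nonneg qnum_nonneg q) auto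
    then have "sqrt (qnum q (L - n + 1) * qnum q (L + n)) * sqrt (qnum q (L - n + 1) * qnum q (L + n)) =
        qnum q (L - n + 1) * qnum q (L + n)"
      by (rule real_sqrt_mult_self[THEN trans, OF abs_of_nonneg])
    moreover have "n - 1 \<notin> weights L \<Longrightarrow> qnum q (L + n) = 0"
      using weights_lower[OF n] by simp
    moreover have arg: "L - (n - 1) = L - n + 1" "L + (n - 1) + 1 = L + n" by simp_all
    ultimately show ?thesis
      unfolding prod rep_gen.simps pick arg by (auto simp flip: of_real_mult)
  qed
  have FE: "tmat q L m n (gen GF * gen GE) =
      (if m = n then of_real (qnum q (L - n) * qnum q (L + n + 1)) else 0)"
  proof -
    have "0 \<le> qnum q (L - n) * qnum q (L + n + 1)"
      using weights_bounds[OF n] by (intro mult_nonneg_nonneg qnum_nonneg q) auto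
    then have "sqrt (qnum q (L - n) * qnum q (L + n + 1)) * sqrt (qnum q (L - n) * qnum q (L + n + 1)) =
        qnum q (L - n) * qnum q (L + n + 1)"
      by (rule real_sqrt_mult_self[THEN trans, OF abs_of_nonneg])
    moreover have "n + 1 \<notin> weights L \<Longrightarrow> qnum q (L - n) = 0"
      using weights_upper[OF L n] by simp
    moreover have arg: "L - (n + 1) + 1 = L - n" "L + (n + 1) = L + n + 1" by simp_all
    ultimately show ?thesis
      unfolding prod rep_gen.simps pick arg by (auto simp flip: of_real_mult)
  qed
  have comm: "complex_of_real (qnum q (L - n + 1) * qnum q (L + n)) -
      of_real (qnum q (L - n) * qnum q (L + n + 1)) =
      of_real (1 / (q - 1 / q)) * (of_real ((q powr n)\<^sup>2) - of_real ((q powr (- n))\<^sup>2))"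
    unfolding of_real_diff[symmetric] of_real_mult[symmetric] qnum_commutator[OF q]
    by simp
  show ?thesis
    using r unfolding Uq_relations_def power2_eq_square
    by (elim insertE; (simp only: tmat_diff tmat_const_mult mult.assoc KE KF KK EF FE one empty_iff)?;
        use comm in simp)
qed

lemma tmat_in_Uq_dual:
  assumes "0 < q" "q < 1" "L \<in> half_nats" "m \<in> weights L" "n \<in> weights L"
  shows "tmat q L m n \<in> Uq_dual q"
proof -
  have "tmat q L m n x = 0" if "x \<in> Uq_ideal q" for x
    using that
  proof induction
    case (generate r x y)
    then show ?case using assms by (simp add: tmat_mult tmat_relation)
  qed (simp_all add: tmat_add tmat_zero)
  then show ?thesis by (simp add: Uq_dual_def tmat_add tmat_const_mult)
qed

lemma SUq_subset_Uq_dual: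
  assumes "0 < q" "q < 1"
  shows "carrier (SUq q) \<subseteq> Uq_dual q"
proof
  fix \<phi> assume "\<phi> \<in> carrier (SUq q)"
  then obtain T c where \<phi>: "\<phi> = (\<lambda>x. \<Sum>t\<in>T. c t * t x)" and
    T: "T \<subseteq> {tmat q L m n |L m n. L \<in> half_nats \<and> m \<in> weights L \<and> n \<in> weights L}"
    unfolding SUq_def cspan_def by auto
  have "\<phi> (x + y) = \<phi> x + \<phi> y" for x y
    unfolding \<phi> sum.distrib[symmetric] using T
    by (intro sum.cong) (auto simp: tmat_add distrib_left)
  moreover have "\<phi> (const a * x) = a * \<phi> x" for a x
    unfolding \<phi> sum_distrib_left using T
    by (intro sum.cong) (auto simp: tmat_const_mult)
  moreover have "\<phi> x = 0" if "x \<in> Uq_ideal q" for x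
    unfolding \<phi> using T that tmat_in_Uq_dual[OF assms]
    by (intro sum.neutral) (auto simp: Uq_dual_def)
  ultimately show "\<phi> \<in> Uq_dual q" by (simp add: Uq_dual_def)
qed


section \<open>Quantum weighted projective spaces and the Haar state\<close>

definition SUq_alpha :: "real \<Rightarrow> functional" where
  "SUq_alpha q = tmat q (1 / 2) (1 / 2) (1 / 2)"

definition SUq_beta :: "real \<Rightarrow> functional" where
  "SUq_beta q = tmat q (1 / 2) (1 / 2) (- 1 / 2)"

definition coaction :: "real \<Rightarrow> nat \<Rightarrow> nat \<Rightarrow> functional \<Rightarrow> (int \<Rightarrow> functional)" where
  "coaction q k l = (THE \<theta>.
     \<theta> \<in> extensional (carrier (SUq q)) \<and>
     \<theta> \<in> star_hom (SUq q) (laurent (SUq q)) \<and>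
     \<theta> (SUq_alpha q) = laurent_monom (SUq q) (SUq_alpha q) (- int k) \<and>
     \<theta> (SUq_beta q) = laurent_monom (SUq q) (SUq_beta q) (int l))"

definition WPq :: "real \<Rightarrow> nat \<Rightarrow> nat \<Rightarrow> functional star_algebra" where
  "WPq q k l = (SUq q)\<lparr>carrier :=
     {t \<in> carrier (SUq q). coaction q k l t = laurent_monom (SUq q) t 0}\<rparr>"

definition haar :: "real \<Rightarrow> functional \<Rightarrow> complex" where
  "haar q = (THE h.
     h \<in> extensional (carrier (SUq q)) \<and>
     (\<forall>x\<in>carrier (SUq q). \<forall>y\<in>carrier (SUq q). h (x \<oplus>\<^bsub>SUq q\<^esub> y) = h x + h y) \<and>
     (\<forall>c. \<forall>x\<in>carrier (SUq q). h (c \<odot>\<^bsub>SUq q\<^esub> x) = c * h x) \<and>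
     h \<one>\<^bsub>SUq q\<^esub> = 1 \<and>
     (\<forall>L\<in>half_nats. \<forall>m\<in>weights L. \<forall>n\<in>weights L. L > 0 \<longrightarrow> h (tmat q L m n) = 0))"

definition haar_ip :: "real \<Rightarrow> functional \<Rightarrow> functional \<Rightarrow> complex" where
  "haar_ip q a b = haar q (star (SUq q) a \<otimes>\<^bsub>SUq q\<^esub> b)"


section \<open>Complex Hilbert spaces\<close>

class complex_inner = real_inner +
  fixes scaleC :: "complex \<Rightarrow> 'a \<Rightarrow> 'a"  (infixr \<open>*\<^sub>C\<close> 75)
    and cinner :: "'a \<Rightarrow> 'a \<Rightarrow> complex"
  assumes scaleC_add_right: "c *\<^sub>C (x + y) = c *\<^sub>C x + c *\<^sub>C y"
    and scaleC_add_left: "(c + d) *\<^sub>C x = c *\<^sub>C x + d *\<^sub>C x"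
    and scaleC_scaleC: "c *\<^sub>C (d *\<^sub>C x) = (c * d) *\<^sub>C x"
    and scaleC_of_real: "complex_of_real r *\<^sub>C x = r *\<^sub>R x"
    and cinner_commute: "cinner x y = cnj (cinner y x)"
    and cinner_add_right: "cinner x (y + z) = cinner x y + cinner x z"
    and cinner_scaleC_right: "cinner x (c *\<^sub>C y) = c * cinner x y"
    and Re_cinner: "Re (cinner x y) = inner x y"

class complex_hilbert = complex_inner + complete_space

lemma scaleC_one: "1 *\<^sub>C x = (x :: 'a :: complex_inner)"
  using scaleC_of_real[of 1 x] by simp

global_interpretation complex_vector: vector_space "scaleC :: complex \<Rightarrow> 'a \<Rightarrow> 'a :: complex_inner"
  by standard (simp_all add: scaleC_add_right scaleC_add_left scaleC_scaleC scaleC_one)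

instantiation complex :: complex_inner
begin
definition "scaleC c (x :: complex) = c * x"
definition "cinner (x :: complex) y = cnj x * y"
instance
  by standard (simp_all add: scaleC_complex_def cinner_complex_def algebra_simps inner_complex_def
      scaleR_conv_of_real)
end

instance complex :: complex_hilbert ..

instantiation prod :: (complex_inner, complex_inner) complex_inner
begin
definition "scaleC c (x :: 'a \<times> 'b) = (c *\<^sub>C fst x, c *\<^sub>C snd x)"
definition "cinner (x :: 'a \<times> 'b) y = cinner (fst x) (fst y) + cinner (snd x) (snd y)"
instance
proof
  fix x y z :: "'a \<times> 'b" and c d :: complex and r :: real
  show "cinner x y = cnj (cinner y x)"
    using cinner_commute[of "fst x" "fst y"] cinner_commute[of "snd x" "snd y"]
    by (simp add: cinner_prod_def)
qed (simp_all add: scaleC_prod_def cinner_prod_def scaleC_add_right scaleC_add_left scaleC_scaleC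
      scaleC_of_real cinner_add_right cinner_scaleC_right Re_cinner inner_prod_def algebra_simps
      scaleR_prod_def)
end

instance prod :: (complex_hilbert, complex_hilbert) complex_hilbert ..

definition bounded_clinear :: "('a::complex_inner \<Rightarrow> 'b::complex_inner) \<Rightarrow> bool" where
  "bounded_clinear T \<longleftrightarrow> bounded_linear T \<and> (\<forall>c x. T (c *\<^sub>C x) = c *\<^sub>C T x)"

definition compact_operator :: "('a::complex_inner \<Rightarrow> 'b::complex_inner) \<Rightarrow> bool" where
  "compact_operator T \<longleftrightarrow> bounded_clinear T \<and> compact (closure (T ` cball 0 1))"


section \<open>Unbounded operators, represented by their graphs\<close>

definition linear_operator :: "('h::complex_inner \<times> 'h) set \<Rightarrow> bool" where
  "linear_operator D \<longleftrightarrow> complex_vector.subspace D \<and> single_valued D"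

definition densely_defined :: "('h::complex_inner \<times> 'h) set \<Rightarrow> bool" where
  "densely_defined D \<longleftrightarrow> closure (Domain D) = UNIV"

definition adjoint_op :: "('h::complex_inner \<times> 'h) set \<Rightarrow> ('h \<times> 'h) set" where
  "adjoint_op D = {(y, z). \<forall>(x, w)\<in>D. cinner y w = cinner z x}"

definition self_adjoint :: "('h::complex_inner \<times> 'h) set \<Rightarrow> bool" where
  "self_adjoint D \<longleftrightarrow> linear_operator D \<and> densely_defined D \<and> adjoint_op D = D"

text \<open>\<open>R\<close> is a bounded everywhere defined inverse of \<open>D - z\<close>.\<close>

definition is_resolvent ::
    "('h::complex_inner \<times> 'h) set \<Rightarrow> complex \<Rightarrow> ('h \<Rightarrow> 'h) \<Rightarrow> bool" where
  "is_resolvent D z R \<longleftrightarrow> bounded_clinear R \<and> (\<forall>y. (R y, y + z *\<^sub>C R y) \<in> D) \<and>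
     (\<forall>(x, y)\<in>D. R (y - z *\<^sub>C x) = x)"

definition compact_resolvent :: "('h::complex_inner \<times> 'h) set \<Rightarrow> bool" where
  "compact_resolvent D \<longleftrightarrow> (\<exists>z R. is_resolvent D z R) \<and>
     (\<forall>z R. is_resolvent D z R \<longrightarrow> compact_operator R)"

text \<open>\<open>T\<close> maps the domain of \<open>D\<close> into itself, and \<open>D T - T D\<close> agrees there with a bounded
  operator \<open>B\<close>.\<close>

definition bounded_commutator ::
    "('h::complex_inner \<times> 'h) set \<Rightarrow> ('h \<Rightarrow> 'h) \<Rightarrow> bool" where
  "bounded_commutator D T \<longleftrightarrow> (\<exists>B. bounded_clinear B \<and> (\<forall>(x, y)\<in>D. (T x, T y + B x) \<in> D))"


section \<open>Spectral triples\<close>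

definition faithful_star_rep ::
    "('a, 'm) star_algebra_scheme \<Rightarrow> ('a \<Rightarrow> 'h \<Rightarrow> 'h::complex_inner) \<Rightarrow> bool" where
  "faithful_star_rep A \<pi> \<longleftrightarrow>
     (\<forall>a\<in>carrier A. bounded_clinear (\<pi> a)) \<and>
     \<pi> \<one>\<^bsub>A\<^esub> = id \<and>
     (\<forall>a\<in>carrier A. \<forall>b\<in>carrier A. \<forall>x. \<pi> (a \<oplus>\<^bsub>A\<^esub> b) x = \<pi> a x + \<pi> b x) \<and>
     (\<forall>c. \<forall>a\<in>carrier A. \<forall>x. \<pi> (c \<odot>\<^bsub>A\<^esub> a) x = c *\<^sub>C \<pi> a x) \<and>
     (\<forall>a\<in>carrier A. \<forall>b\<in>carrier A. \<pi> (a \<otimes>\<^bsub>A\<^esub> b) = \<pi> a \<circ> \<pi> b) \<and>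
     (\<forall>a\<in>carrier A. \<forall>x y. cinner (\<pi> (star A a) x) y = cinner x (\<pi> a y)) \<and>
     inj_on \<pi> (carrier A)"

definition spectral_triple ::
    "('a, 'm) star_algebra_scheme \<Rightarrow> ('a \<Rightarrow> 'h \<Rightarrow> 'h::complex_hilbert) \<Rightarrow> ('h \<times> 'h) set \<Rightarrow> bool" where
  "spectral_triple A \<pi> D \<longleftrightarrow>
     unital_star_algebra A \<and> faithful_star_rep A \<pi> \<and>
     self_adjoint D \<and> compact_resolvent D \<and>
     (\<forall>a\<in>carrier A. bounded_commutator D (\<pi> a))"

text \<open>Since \<open>\<omega>\<close> is an involution, the inclusion \<open>\<omega> D \<subseteq> - D \<omega>\<close> below is an equality.\<close>

definition even_spectral_triple ::
    "('a, 'm) star_algebra_scheme \<Rightarrow> ('a \<Rightarrow> 'h \<Rightarrow> 'h::complex_hilbert) \<Rightarrow> ('h \<times> 'h) set \<Rightarrow>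
     ('h \<Rightarrow> 'h) \<Rightarrow> bool" where
  "even_spectral_triple A \<pi> D \<omega> \<longleftrightarrow>
     spectral_triple A \<pi> D \<and> bounded_clinear \<omega> \<and>
     (\<forall>x y. cinner (\<omega> x) y = cinner x (\<omega> y)) \<and>
     \<omega> \<circ> \<omega> = id \<and>
     (\<forall>(x, y)\<in>D. (\<omega> x, - \<omega> y) \<in> D) \<and>
     (\<forall>a\<in>carrier A. \<omega> \<circ> \<pi> a = \<pi> a \<circ> \<omega>)"

definition eigenspace :: "('h::complex_inner \<times> 'h) set \<Rightarrow> real \<Rightarrow> 'h set" where
  "eigenspace D \<mu> = {x. (x, complex_of_real \<mu> *\<^sub>C x) \<in> D}"

text \<open>The eigenvalues of a self-adjoint operator are real, and for compact resolvent the index set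
  and the multiplicities below are finite.\<close>

definition truncated_trace :: "('h::complex_inner \<times> 'h) set \<Rightarrow> real \<Rightarrow> real" where
  "truncated_trace D \<Lambda> = (\<Sum>\<mu>\<in>{\<mu>. \<bar>\<mu>\<bar> \<le> \<Lambda> \<and> eigenspace D \<mu> \<noteq> {0}}.
     real (complex_vector.dim (eigenspace D \<mu>)) / \<mu>\<^sup>2)"

definition two_summable :: "('h::complex_inner \<times> 'h) set \<Rightarrow> bool" where
  "two_summable D \<longleftrightarrow> (\<exists>R. is_resolvent D 0 R) \<and> truncated_trace D \<in> \<Theta>[at_top](\<lambda>\<Lambda>. ln \<Lambda>)"


section \<open>The spectral data on the completion\<close>

definition inner_product_on ::
    "('a, 'm) star_algebra_scheme \<Rightarrow> ('a \<Rightarrow> 'a \<Rightarrow> complex) \<Rightarrow> bool" where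
  "inner_product_on A ip \<longleftrightarrow>
     (\<forall>a\<in>carrier A. \<forall>b\<in>carrier A. \<forall>c\<in>carrier A. ip a (b \<oplus>\<^bsub>A\<^esub> c) = ip a b + ip a c) \<and>
     (\<forall>a\<in>carrier A. \<forall>b\<in>carrier A. \<forall>z. ip a (z \<odot>\<^bsub>A\<^esub> b) = z * ip a b) \<and>
     (\<forall>a\<in>carrier A. \<forall>b\<in>carrier A. ip b a = cnj (ip a b)) \<and>
     (\<forall>a\<in>carrier A. a \<noteq> \<zero>\<^bsub>A\<^esub> \<longrightarrow> Re (ip a a) > 0)"

text \<open>The Hilbert space completion is determined up to a unique unitary, so it is treated as an
  arbitrary Hilbert space with a linear isometry \<open>\<iota>\<close> of dense range.\<close>

definition is_completion ::
    "('a, 'm) star_algebra_scheme \<Rightarrow> ('a \<Rightarrow> 'a \<Rightarrow> complex) \<Rightarrow> ('a \<Rightarrow> 'h::complex_hilbert) \<Rightarrow> bool" where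
  "is_completion A ip \<iota> \<longleftrightarrow>
     (\<forall>a\<in>carrier A. \<forall>b\<in>carrier A. \<iota> (a \<oplus>\<^bsub>A\<^esub> b) = \<iota> a + \<iota> b) \<and>
     (\<forall>c. \<forall>a\<in>carrier A. \<iota> (c \<odot>\<^bsub>A\<^esub> a) = c *\<^sub>C \<iota> a) \<and>
     (\<forall>a\<in>carrier A. \<forall>b\<in>carrier A. cinner (\<iota> a) (\<iota> b) = ip a b) \<and>
     closure (\<iota> ` carrier A) = UNIV"

definition left_mult_rep ::
    "('a, 'm) star_algebra_scheme \<Rightarrow> ('a \<Rightarrow> 'h::complex_hilbert) \<Rightarrow> 'a \<Rightarrow> 'h \<Rightarrow> 'h" where
  "left_mult_rep A \<iota> a = (THE T. bounded_clinear T \<and> (\<forall>b\<in>carrier A. T (\<iota> b) = \<iota> (a \<otimes>\<^bsub>A\<^esub> b)))"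

definition rep_sum :: "('a \<Rightarrow> 'h \<Rightarrow> 'h) \<Rightarrow> 'a \<Rightarrow> 'h \<times> 'h \<Rightarrow> 'h \<times> 'h" where
  "rep_sum \<pi> a x = (\<pi> a (fst x), \<pi> a (snd x))"

definition WPq_index :: "nat \<Rightarrow> nat \<Rightarrow> (real \<times> real) set" where
  "WPq_index k l = {(L, p). L \<in> half_nats \<and> p \<in> half_ints \<and>
     p * (real l + real k) \<in> weights L \<and> p * (real l - real k) \<in> weights L}"

definition WPq_basis :: "real \<Rightarrow> nat \<Rightarrow> nat \<Rightarrow> real \<Rightarrow> real \<Rightarrow> functional" where
  "WPq_basis q k l L p = tmat q L (p * (real l + real k)) (p * (real l - real k))"

text \<open>The prescribed action on the orthogonal basis vectors determines a unique self-adjoint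
  operator.\<close>

definition WPq_dirac ::
    "real \<Rightarrow> nat \<Rightarrow> nat \<Rightarrow> (functional \<Rightarrow> 'h::complex_hilbert) \<Rightarrow> (('h \<times> 'h) \<times> ('h \<times> 'h)) set" where
  "WPq_dirac q k l \<iota> = (THE D. self_adjoint D \<and> (\<forall>(L, p)\<in>WPq_index k l.
     ((\<iota> (WPq_basis q k l L p), 0), (0, (L + 1) *\<^sub>R \<iota> (WPq_basis q k l L p))) \<in> D \<and>
     ((0, \<iota> (WPq_basis q k l L p)), ((L + 1) *\<^sub>R \<iota> (WPq_basis q k l L p), 0)) \<in> D))"

definition chirality :: "'h::complex_hilbert \<times> 'h \<Rightarrow> 'h \<times> 'h" where
  "chirality x = (fst x, - snd x)"

end

theory Submission
  imports Defs
begin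

text \<open>The proof reduces every analytic claim to algebra in the Peter-Weyl basis \<open>t\<^sup>\<lambda>\<^sub>m\<^sub>n\<close>.

  \<^emph>\<open>Products with spin one half.\<close> The tensor product of the modules of spin \<open>1/2\<close> and \<open>\<lambda>\<close> is the
  orthogonal sum of those of spin \<open>\<lambda> + 1/2\<close> and \<open>\<lambda> - 1/2\<close>. With explicit intertwiners this becomes a
  formula for \<open>t\<^sup>1\<^sup>/\<^sup>2\<^sub>a\<^sub>b t\<^sup>\<lambda>\<^sub>m\<^sub>n\<close> (\<open>T_half_mult\<close>) in which the coefficient of the spin
  \<open>\<lambda> + 1/2\<close> does not vanish for a suitable choice of the four indices. Induction on the spin then
  shows that the coefficients span an algebra, that \<open>\<alpha>\<close>, \<open>\<beta>\<close> and their adjoints generate it, and that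
  the two weights \<open>m\<close> and \<open>n\<close> grade it. The coefficients are linearly independent, because
  translations by elements of \<open>U\<^sub>q(su\<^sub>2)\<close> have them as joint eigenvectors with distinct eigenvalues.
  Hence the coaction exists, is unique, and its fixed points are the elements of degree zero.

  \<^emph>\<open>The Haar state.\<close> Invariance under translations forces distinct basis vectors to be orthogonal and
  makes the norms in one column of the matrix \<open>t\<^sup>\<lambda>\<close> positive multiples of each other. Unitarity
  of this matrix (\<open>T_column_unitary\<close>) then normalises them, so the inner product is positive definite,
  and the same identity shows that left multiplication by \<open>t\<^sup>\<lambda>\<^sub>m\<^sub>n\<close> is a contraction.

  \<^emph>\<open>Commutators.\<close> Let \<open>N\<close> multiply \<open>t\<^sup>\<lambda>\<^sub>m\<^sub>n\<close> by \<open>\<lambda> + 1\<close>. A coefficient \<open>a\<close> of spin \<open>1/2\<close> is a sum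
  \<open>a\<^sub>+ + a\<^sub>-\<close> of operators that raise and lower the spin by \<open>1/2\<close>, so \<open>[N, a] = (a\<^sub>+ - a\<^sub>-) / 2\<close>. If \<open>U\<close>
  multiplies \<open>t\<^sup>\<lambda>\<^sub>m\<^sub>n\<close> by the phase \<open>\<i>\<close> to the power \<open>2\<lambda>\<close>, this equals \<open>U a U\<^sup>-\<^sup>1 / (2\<i>)\<close>, which is as bounded
  as \<open>a\<close> (\<open>comm_deg_half\<close>). The Leibniz rule extends boundedness to all polynomials.

  \<^emph>\<open>The operator \<open>D'\<close>.\<close> The inverse \<open>R\<close> of \<open>D'\<close> interchanges the two summands and divides basis vectors
  by \<open>\<lambda> + 1\<close>. It is a norm limit of operators of finite rank, hence compact. The graph of the inverse of
  a bounded symmetric operator with dense range is self-adjoint, and it is the only self-adjoint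
  operator with the prescribed action on basis vectors. A resolvent \<open>S\<close> at \<open>z\<close> satisfies
  \<open>S = R (1 + z S)\<close> and is therefore compact.

  \<^emph>\<open>Summability.\<close> The eigenvalues are \<open>\<plusminus>(\<lambda> + 1)\<close>, with multiplicity the number of \<open>p\<close> belonging to \<open>\<lambda>\<close>.
  This number is at most of order \<open>\<lambda>\<close>, and for integral \<open>\<lambda>\<close> at least of order \<open>\<lambda>\<close>, so the truncated
  trace of the inverse square lies between two multiples of a harmonic sum.\<close>



section \<open>The convolution algebra of functions on generator words\<close>

text \<open>Each summand of the coproduct of a generator is a tensor product of two single generators, so the
  coproduct of a word involves only pairs of words of the same length. A functional on the free algebra
  is therefore the same as a function on words, and convolution of functionals is a recursion on words.
  Working with these functions in place of functionals makes the product that of a ring type.\<close>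

datatype word_dual = WD (wval: "generator list \<Rightarrow> complex")

fun word_conv :: "(generator list \<Rightarrow> complex) \<Rightarrow> (generator list \<Rightarrow> complex) \<Rightarrow> generator list \<Rightarrow> complex" where
  "word_conv f g [] = f [] * g []"
| "word_conv f g (GE # w) = word_conv (\<lambda>v. f (GE # v)) (\<lambda>v. g (GK # v)) w
     + word_conv (\<lambda>v. f (GKinv # v)) (\<lambda>v. g (GE # v)) w"
| "word_conv f g (GF # w) = word_conv (\<lambda>v. f (GF # v)) (\<lambda>v. g (GK # v)) w
     + word_conv (\<lambda>v. f (GKinv # v)) (\<lambda>v. g (GF # v)) w"
| "word_conv f g (GK # w) = word_conv (\<lambda>v. f (GK # v)) (\<lambda>v. g (GK # v)) w"
| "word_conv f g (GKinv # w) = word_conv (\<lambda>v. f (GKinv # v)) (\<lambda>v. g (GKinv # v)) w"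

fun counit_gen :: "generator \<Rightarrow> complex" where
  "counit_gen GE = 0"
| "counit_gen GF = 0"
| "counit_gen GK = 1"
| "counit_gen GKinv = 1"

lemma word_conv_add_left: "word_conv (\<lambda>v. f v + f' v) g w = word_conv f g w + word_conv f' g w"
proof (induction w arbitrary: f f' g)
  case (Cons a w)
  then show ?case by (cases a) (simp_all add: algebra_simps)
qed (simp add: algebra_simps)

lemma word_conv_add_right: "word_conv f (\<lambda>v. g v + g' v) w = word_conv f g w + word_conv f g' w"
proof (induction w arbitrary: f g g')
  case (Cons a w)
  then show ?case by (cases a) (simp_all add: algebra_simps)
qed (simp add: algebra_simps)

lemma word_conv_scale_left: "word_conv (\<lambda>v. c * f v) g w = c * word_conv f g w"
proof (induction w arbitrary: f g)
  case (Cons a w)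
  then show ?case by (cases a) (simp_all add: algebra_simps)
qed simp

lemma word_conv_scale_right: "word_conv f (\<lambda>v. c * g v) w = c * word_conv f g w"
proof (induction w arbitrary: f g)
  case (Cons a w)
  then show ?case by (cases a) (simp_all add: algebra_simps)
qed simp

text \<open>Coassociativity of the coproduct, seen one letter at a time.\<close>

lemma word_conv_assoc:
  "word_conv (word_conv f g) h w = word_conv f (word_conv g h) w"
proof (induction w arbitrary: f g h)
  case (Cons a w)
  then show ?case
    by (cases a) (simp_all add: word_conv_add_left word_conv_add_right add.assoc)
qed simp

lemma word_conv_counit_left:
  "word_conv (\<lambda>v. c * prod_list (map counit_gen v)) g w = c * g w"
proof (induction w arbitrary: g c)
  case (Cons a w)
  have z: "word_conv (\<lambda>v. 0) g w = 0" for g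
    using word_conv_scale_left[of 0 "\<lambda>v. 0"] by simp
  show ?case using Cons by (cases a) (simp_all add: z)
qed simp

lemma word_conv_counit_right:
  "word_conv f (\<lambda>v. c * prod_list (map counit_gen v)) w = c * f w"
proof (induction w arbitrary: f c)
  case (Cons a w)
  have z: "word_conv f (\<lambda>v. 0) w = 0" for f
    using word_conv_scale_right[of f 0 "\<lambda>v. 0"] by simp
  show ?case using Cons by (cases a) (simp_all add: z)
qed simp

instantiation word_dual :: ring_1
begin
definition "0 = WD (\<lambda>w. 0)"
definition "1 = WD (\<lambda>w. prod_list (map counit_gen w))"
definition "\<phi> + \<psi> = WD (\<lambda>w. wval \<phi> w + wval \<psi> w)"
definition "\<phi> - \<psi> = WD (\<lambda>w. wval \<phi> w - wval \<psi> w)"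
definition "- \<phi> = WD (\<lambda>w. - wval \<phi> w)"
definition "\<phi> * \<psi> = WD (word_conv (wval \<phi>) (wval \<psi>))"
instance
proof
  fix a b c :: word_dual
  show "a * b * c = a * (b * c)"
    by (simp add: times_word_dual_def fun_eq_iff word_conv_assoc)
  show "1 * a = a"
    using word_conv_counit_left[of 1] by (cases a) (simp add: times_word_dual_def one_word_dual_def fun_eq_iff)
  show "a * 1 = a"
    using word_conv_counit_right[of _ 1] by (cases a) (simp add: times_word_dual_def one_word_dual_def fun_eq_iff)
  show "(a + b) * c = a * c + b * c"
    by (simp add: times_word_dual_def plus_word_dual_def fun_eq_iff word_conv_add_left)
  show "a * (b + c) = a * b + a * c"
    by (simp add: times_word_dual_def plus_word_dual_def fun_eq_iff word_conv_add_right)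
  show "(0::word_dual) \<noteq> 1"
    by (auto simp: zero_word_dual_def one_word_dual_def dest: fun_cong[of _ _ "[]"])
qed (auto simp: plus_word_dual_def minus_word_dual_def uminus_word_dual_def zero_word_dual_def algebra_simps)
end

lemma word_dual_eqI: "(\<And>w. wval \<phi> w = wval \<psi> w) \<Longrightarrow> \<phi> = \<psi>"
  by (cases \<phi>; cases \<psi>) auto

lemma wval_simps [simp]:
  "wval 0 w = 0" "wval 1 w = prod_list (map counit_gen w)"
  "wval (\<phi> + \<psi>) w = wval \<phi> w + wval \<psi> w" "wval (\<phi> - \<psi>) w = wval \<phi> w - wval \<psi> w"
  "wval (- \<phi>) w = - wval \<phi> w" "wval (\<phi> * \<psi>) w = word_conv (wval \<phi>) (wval \<psi>) w"
  by (simp_all add: zero_word_dual_def one_word_dual_def plus_word_dual_def minus_word_dual_def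
      uminus_word_dual_def times_word_dual_def)

lemma wval_sum [simp]: "wval (sum f A) w = (\<Sum>x\<in>A. wval (f x) w)"
  by (induction A rule: infinite_finite_induct) auto

definition wscale :: "complex \<Rightarrow> word_dual \<Rightarrow> word_dual" where
  "wscale c \<phi> = WD (\<lambda>w. c * wval \<phi> w)"

lemma wval_wscale [simp]: "wval (wscale c \<phi>) w = c * wval \<phi> w"
  by (simp add: wscale_def)

global_interpretation wd: vector_space wscale
  by standard (auto intro!: word_dual_eqI simp: algebra_simps)

global_interpretation wd: vector_space_pair wscale wscale ..

lemma wscale_mult_left [simp]: "wscale c \<phi> * \<psi> = wscale c (\<phi> * \<psi>)"
  by (rule word_dual_eqI) (simp add: word_conv_scale_left wscale_def)

lemma wscale_mult_right [simp]: "\<phi> * wscale c \<psi> = wscale c (\<phi> * \<psi>)"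
  by (rule word_dual_eqI) (simp add: word_conv_scale_right wscale_def)

abbreviation wlinear :: "(word_dual \<Rightarrow> word_dual) \<Rightarrow> bool" where
  "wlinear \<equiv> Vector_Spaces.linear wscale wscale"

lemma wlinearI:
  "(\<And>a b. f (a + b) = f a + f b) \<Longrightarrow> (\<And>c a. f (wscale c a) = wscale c (f a)) \<Longrightarrow> wlinear f"
  by unfold_locales auto

lemma wlinear_mult_left: "wlinear (\<lambda>b. a * b)"
  by (rule wlinearI) (simp_all add: distrib_left)

lemma wlinear_mult_right: "wlinear (\<lambda>b. b * a)"
  by (rule wlinearI) (simp_all add: distrib_right)


section \<open>Translations by generators and the involution\<close>

text \<open>The left and right translates of a functional by a generator: \<open>x \<mapsto> \<phi> (g x)\<close> and \<open>x \<mapsto> \<phi> (x g)\<close>.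
  They turn the defining relations of the modules into statements about functionals, and an identity of
  functionals into finitely many identities that are checked on generators.\<close>

definition lshift :: "generator \<Rightarrow> word_dual \<Rightarrow> word_dual" where
  "lshift g \<phi> = WD (\<lambda>w. wval \<phi> (g # w))"

definition rshift :: "generator \<Rightarrow> word_dual \<Rightarrow> word_dual" where
  "rshift g \<phi> = WD (\<lambda>w. wval \<phi> (w @ [g]))"

lemma wval_shift [simp]:
  "wval (lshift g \<phi>) w = wval \<phi> (g # w)" "wval (rshift g \<phi>) w = wval \<phi> (w @ [g])"
  by (simp_all add: lshift_def rshift_def)

lemma wlinear_shift: "wlinear (lshift g)" "wlinear (rshift g)"
  by (rule wlinearI; rule word_dual_eqI; simp)+

lemmas shift_linear_simps [simp] =
  wd.linear_add[OF wlinear_shift(1)] wd.linear_add[OF wlinear_shift(2)]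
  wd.linear_scale[OF wlinear_shift(1)] wd.linear_scale[OF wlinear_shift(2)]
  wd.linear_0[OF wlinear_shift(1)] wd.linear_0[OF wlinear_shift(2)]
  wd.linear_sum[OF wlinear_shift(1)] wd.linear_sum[OF wlinear_shift(2)]

text \<open>Translation by a generator acts on products through the coproduct.\<close>

lemma lshift_mult:
  "lshift GE (\<phi> * \<psi>) = lshift GE \<phi> * lshift GK \<psi> + lshift GKinv \<phi> * lshift GE \<psi>"
  "lshift GF (\<phi> * \<psi>) = lshift GF \<phi> * lshift GK \<psi> + lshift GKinv \<phi> * lshift GF \<psi>"
  "lshift GK (\<phi> * \<psi>) = lshift GK \<phi> * lshift GK \<psi>"
  "lshift GKinv (\<phi> * \<psi>) = lshift GKinv \<phi> * lshift GKinv \<psi>"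
  by (rule word_dual_eqI; simp add: lshift_def)+

text \<open>The recursion for convolution consumes words from the left. Since the coproduct is
  multiplicative, it may equally consume them from the right.\<close>

lemma word_conv_snoc:
  "word_conv f g (w @ [GE]) = word_conv (\<lambda>v. f (v @ [GE])) (\<lambda>v. g (v @ [GK])) w
     + word_conv (\<lambda>v. f (v @ [GKinv])) (\<lambda>v. g (v @ [GE])) w"
  "word_conv f g (w @ [GF]) = word_conv (\<lambda>v. f (v @ [GF])) (\<lambda>v. g (v @ [GK])) w
     + word_conv (\<lambda>v. f (v @ [GKinv])) (\<lambda>v. g (v @ [GF])) w"
  "word_conv f g (w @ [GK]) = word_conv (\<lambda>v. f (v @ [GK])) (\<lambda>v. g (v @ [GK])) w"
  "word_conv f g (w @ [GKinv]) = word_conv (\<lambda>v. f (v @ [GKinv])) (\<lambda>v. g (v @ [GKinv])) w"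
proof (induction w arbitrary: f g)
  case (Cons a w)
  { case 1 show ?case using Cons by (cases a) simp_all }
  { case 2 show ?case using Cons by (cases a) simp_all }
  { case 3 show ?case using Cons by (cases a) simp_all }
  { case 4 show ?case using Cons by (cases a) simp_all }
qed simp_all

lemma rshift_mult:
  "rshift GE (\<phi> * \<psi>) = rshift GE \<phi> * rshift GK \<psi> + rshift GKinv \<phi> * rshift GE \<psi>"
  "rshift GF (\<phi> * \<psi>) = rshift GF \<phi> * rshift GK \<psi> + rshift GKinv \<phi> * rshift GF \<psi>"
  "rshift GK (\<phi> * \<psi>) = rshift GK \<phi> * rshift GK \<psi>"
  "rshift GKinv (\<phi> * \<psi>) = rshift GKinv \<phi> * rshift GKinv \<psi>"
  by (rule word_dual_eqI; simp add: rshift_def word_conv_snoc)+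

lemma lshift_one: "lshift g 1 = wscale (counit_gen g) 1"
  by (rule word_dual_eqI) simp

text \<open>A left invariant functional is a multiple of the counit, the unit of the convolution algebra.\<close>

lemma lshift_invariant_imp_scalar:
  assumes "\<And>g. lshift g \<phi> = wscale (counit_gen g) \<phi>"
  shows "\<phi> = wscale (wval \<phi> []) 1"
proof (rule word_dual_eqI)
  fix w show "wval \<phi> w = wval (wscale (wval \<phi> []) 1) w"
  proof (induction w)
    case (Cons g w)
    then show ?case using arg_cong[OF assms[of g], of "\<lambda>\<phi>. wval \<phi> w"] by simp
  qed simp
qed

text \<open>The map \<open>x \<mapsto> S(x)\<^sup>*\<close> reverses words twice, so it is antilinear and multiplicative: it acts on words
  letter by letter, up to a scalar factor for each letter.\<close>

fun star_antipode_letter :: "generator \<Rightarrow> generator" where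
  "star_antipode_letter GE = GF"
| "star_antipode_letter GF = GE"
| "star_antipode_letter GK = GKinv"
| "star_antipode_letter GKinv = GK"

fun star_antipode_factor :: "real \<Rightarrow> generator \<Rightarrow> complex" where
  "star_antipode_factor q GE = - of_real q"
| "star_antipode_factor q GF = - of_real (1 / q)"
| "star_antipode_factor q GK = 1"
| "star_antipode_factor q GKinv = 1"

definition wstar :: "real \<Rightarrow> word_dual \<Rightarrow> word_dual" where
  "wstar q \<phi> = WD (\<lambda>w. prod_list (map (star_antipode_factor q) w)
     * cnj (wval \<phi> (map star_antipode_letter w)))"

lemma wval_wstar [simp]: "wval (wstar q \<phi>) w = prod_list (map (star_antipode_factor q) w)
     * cnj (wval \<phi> (map star_antipode_letter w))"
  by (simp add: wstar_def)

lemma wstar_add: "wstar q (\<phi> + \<psi>) = wstar q \<phi> + wstar q \<psi>"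
  by (rule word_dual_eqI) (simp add: algebra_simps)

lemma wstar_scale: "wstar q (wscale c \<phi>) = wscale (cnj c) (wstar q \<phi>)"
  by (rule word_dual_eqI) (simp add: algebra_simps)

lemma wstar_zero [simp]: "wstar q 0 = 0"
  by (rule word_dual_eqI) simp

lemma wstar_sum: "wstar q (sum f A) = (\<Sum>x\<in>A. wstar q (f x))"
  by (induction A rule: infinite_finite_induct) (auto simp: wstar_add)

lemma wstar_wstar:
  assumes "q \<noteq> 0"
  shows "wstar q (wstar q \<phi>) = \<phi>"
proof (rule word_dual_eqI)
  have id: "map (star_antipode_letter \<circ> star_antipode_letter) w = w" for w
  proof (induction w)
    case (Cons a w) then show ?case by (cases a) simp_all
  qed simp
  have c: "prod_list (map (star_antipode_factor q) w) *
      cnj (prod_list (map (star_antipode_factor q \<circ> star_antipode_letter) w)) = 1" for w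
  proof (induction w)
    case (Cons a w) then show ?case using assms by (cases a) (simp_all add: field_simps)
  qed simp
  fix w
  show "wval (wstar q (wstar q \<phi>)) w = wval \<phi> w"
    using c[of w] by (simp add: id mult.assoc[symmetric])
qed

lemma lshift_wstar:
  "lshift g (wstar q \<phi>) = wscale (star_antipode_factor q g) (wstar q (lshift (star_antipode_letter g) \<phi>))"
  by (rule word_dual_eqI) simp

lemma wval_wstar_mult:
  "wval (wstar q (\<phi> * \<psi>)) w = wval (wstar q \<psi> * wstar q \<phi>) w"
proof (induction w arbitrary: \<phi> \<psi>)
  case (Cons g w)
  have "wval (wstar q (\<phi> * \<psi>)) (g # w) = wval (lshift g (wstar q (\<phi> * \<psi>))) w"
    by simp
  also have "\<dots> = wval (lshift g (wstar q \<psi> * wstar q \<phi>)) w"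
    unfolding lshift_wstar using Cons[of]
    by (cases g) (simp_all add: lshift_mult lshift_wstar wstar_add del: wval_wstar wval_shift wval_simps(6), auto simp: algebra_simps add_divide_distrib)
  also have "\<dots> = wval (wstar q \<psi> * wstar q \<phi>) (g # w)"
    by (simp del: wval_simps)
  finally show ?case .
qed simp

lemma wstar_mult: "wstar q (\<phi> * \<psi>) = wstar q \<psi> * wstar q \<phi>"
  by (rule word_dual_eqI, rule wval_wstar_mult)

section \<open>Matrix coefficients\<close>

lemma weights_iff: "m \<in> weights L \<longleftrightarrow> m \<le> L \<and> L + m \<in> \<nat>"
proof -
  have "(\<exists>i::nat. m = - L + real i) \<longleftrightarrow> L + m \<in> \<nat>"
    by (auto simp: Nats_def image_def algebra_simps)
  then show ?thesis by (simp add: weights_def)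
qed

lemma half_ints_step [simp]:
  "L \<in> half_ints \<Longrightarrow> L + 1 / 2 \<in> half_ints" "L \<in> half_ints \<Longrightarrow> L - 1 / 2 \<in> half_ints"
proof -
  assume "L \<in> half_ints"
  then obtain z where z: "L = of_int z / 2" by (auto simp: half_ints_def)
  then have "L + 1 / 2 = of_int (z + 1) / 2" "L - 1 / 2 = of_int (z - 1) / 2" by simp_all
  then show "L + 1 / 2 \<in> half_ints" "L - 1 / 2 \<in> half_ints"
    unfolding half_ints_def by blast+
qed

lemma half_nats_iff: "L \<in> half_nats \<longleftrightarrow> L \<in> half_ints \<and> 0 \<le> L"
proof
  assume "L \<in> half_ints \<and> 0 \<le> L"
  then obtain z where "L = of_int z / 2" "0 \<le> z" by (auto simp: half_ints_def)
  then have "L = real (nat z) / 2" by simp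
  then show "L \<in> half_nats" unfolding half_nats_def by blast
qed (auto simp: half_nats_def half_ints_def intro: exI[of _ "int _"])

lemma weights_upper_half_ints:
  assumes "L \<in> half_ints" "n \<in> weights L" "n + 1 \<notin> weights L"
  shows "L - n = 0"
proof -
  have "0 \<le> L" using weights_bounds[OF assms(2)] by linarith
  with assms show ?thesis using weights_upper half_nats_iff by blast
qed

locale q_parameter =
  fixes q :: real
  assumes q_pos: "0 < q" and q_less_1: "q < 1"
begin

text \<open>The matrix entry of \<open>e\<close> between the weights \<open>n\<close> and \<open>n + 1\<close>, which is also the entry of \<open>f\<close> in the
  opposite direction.\<close>

definition ladder :: "real \<Rightarrow> real \<Rightarrow> real" where
  "ladder L n = sqrt (qnum q (L - n) * qnum q (L + n + 1))"

text \<open>The matrix coefficients \<open>t\<^sup>L\<^sub>m\<^sub>n\<close>, extended by zero to all real indices. The ladder entries vanish at the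
  ends of the range of weights, so with this convention the translation rules below hold without
  conditions on the weights.\<close>

definition T :: "real \<Rightarrow> real \<Rightarrow> real \<Rightarrow> word_dual" where
  "T L m n = (if m \<in> weights L \<and> n \<in> weights L then WD (\<lambda>w. rep_word q L w m n) else 0)"

lemma rep_gen_ladder:
  "rep_gen q L GE m n = (if m = n + 1 then of_real (ladder L n) else 0)"
  "rep_gen q L GF m n = (if m = n - 1 then of_real (ladder L m) else 0)"
  by (auto simp: ladder_def algebra_simps)

lemma wval_T_Nil: "wval (T L m n) [] = (if m = n \<and> m \<in> weights L then 1 else 0)"
  by (simp add: T_def)

lemma T_outside [simp]: "m \<notin> weights L \<or> n \<notin> weights L \<Longrightarrow> T L m n = 0"
  by (auto simp: T_def)

lemma ladder_top: "L \<in> half_ints \<Longrightarrow> n \<in> weights L \<Longrightarrow> n + 1 \<notin> weights L \<Longrightarrow> ladder L n = 0"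
  using weights_upper_half_ints[of L n] by (simp add: ladder_def)

lemma ladder_bottom: "n + 1 \<in> weights L \<Longrightarrow> n \<notin> weights L \<Longrightarrow> ladder L n = 0"
  using weights_lower[of "n + 1" L] by (simp add: ladder_def add.assoc)

text \<open>The rules hold for half-integers \<open>L\<close> and not only for nonnegative ones: the product formula for
  spin \<open>0\<close> refers to spin \<open>- 1/2\<close>, where all coefficients are zero.\<close>

lemma lshift_T:
  assumes "L \<in> half_ints"
  shows "lshift GE (T L m n) = wscale (of_real (ladder L (m - 1))) (T L (m - 1) n)" (is ?E)
    and "lshift GF (T L m n) = wscale (of_real (ladder L m)) (T L (m + 1) n)" (is ?F)
    and "lshift GK (T L m n) = wscale (of_real (q powr m)) (T L m n)" (is ?K)
    and "lshift GKinv (T L m n) = wscale (of_real (q powr (- m))) (T L m n)" (is ?K')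
proof -
  have pick: "(\<Sum>i\<in>weights L. (if i = j then c else 0) * f i) = (if j \<in> weights L then c * f j else 0)"
    for j c and f :: "real \<Rightarrow> complex"
    using finite_weights[of L] by (simp add: if_distrib[of "\<lambda>x. x * _"] cong: if_cong)
  have lad: "(if m = i + 1 then complex_of_real (ladder L i) else 0) = (if i = m - 1 then of_real (ladder L (m - 1)) else 0)" for i
    by auto
  show ?E
  proof (cases "m \<in> weights L \<or> m - 1 \<notin> weights L")
    case True
    then show ?thesis
      by (intro word_dual_eqI) (auto simp: T_def rep_gen_ladder lad pick simp del: rep_gen.simps)
  next
    case False
    then have "ladder L (m - 1) = 0" using ladder_top[OF assms, of "m - 1"] by simp
    with False show ?thesis by simp
  qed
  have lad': "(if m = i - 1 then complex_of_real (ladder L m) else 0) = (if i = m + 1 then of_real (ladder L m) else 0)" for i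
    by auto
  show ?F
  proof (cases "m \<in> weights L \<or> m + 1 \<notin> weights L")
    case True
    then show ?thesis
      by (intro word_dual_eqI) (auto simp: T_def rep_gen_ladder lad' pick simp del: rep_gen.simps)
  next
    case False
    then have "ladder L m = 0" using ladder_bottom[of m L] by simp
    with False show ?thesis by simp
  qed
  have lad'': "(if m = i then complex_of_real (q powr i) else 0) = (if i = m then of_real (q powr m) else 0)"
    "(if m = i then complex_of_real (q powr (- i)) else 0) = (if i = m then of_real (q powr (- m)) else 0)" for i
    by auto
  show ?K by (intro word_dual_eqI) (auto simp: T_def lad'' pick)
  show ?K' by (intro word_dual_eqI) (auto simp: T_def lad'' pick)
qed

lemma rshift_T:
  assumes "L \<in> half_ints"
  shows "rshift GE (T L m n) = wscale (of_real (ladder L n)) (T L m (n + 1))" (is ?E)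
    and "rshift GF (T L m n) = wscale (of_real (ladder L (n - 1))) (T L m (n - 1))" (is ?F)
    and "rshift GK (T L m n) = wscale (of_real (q powr n)) (T L m n)" (is ?K)
    and "rshift GKinv (T L m n) = wscale (of_real (q powr (- n))) (T L m n)" (is ?K')
proof -
  have pick: "(\<Sum>i\<in>weights L. f i * (if i = j then c else 0)) = (if j \<in> weights L then c * f j else 0)"
    for j c and f :: "real \<Rightarrow> complex"
    using finite_weights[of L] by (simp add: if_distrib[of "\<lambda>x. _ * x"] cong: if_cong)
  have word: "rep_word q L (w @ [g]) m n = (\<Sum>i\<in>weights L. rep_word q L w m i * rep_gen q L g i n)"
    if "m \<in> weights L" "n \<in> weights L" for w g
    using that finite_weights[of L]
    by (simp add: rep_word_append if_distrib[of "\<lambda>x. _ * x"] del: rep_gen.simps cong: if_cong)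
  show ?E
  proof (cases "n \<in> weights L \<or> n + 1 \<notin> weights L")
    case True
    then show ?thesis
      by (intro word_dual_eqI) (auto simp: T_def word rep_gen_ladder pick simp del: rep_gen.simps)
  next
    case False
    then have "ladder L n = 0" using ladder_bottom[of n L] by simp
    with False show ?thesis by simp
  qed
  have lad: "(if i = n - 1 then complex_of_real (ladder L i) else 0) = (if i = n - 1 then of_real (ladder L (n - 1)) else 0)" for i
    by auto
  show ?F
  proof (cases "n \<in> weights L \<or> n - 1 \<notin> weights L")
    case True
    then show ?thesis
      by (intro word_dual_eqI) (auto simp: T_def word rep_gen_ladder lad pick simp del: rep_gen.simps)
  next
    case False
    then have "ladder L (n - 1) = 0" using ladder_top[OF assms, of "n - 1"] by simp
    with False show ?thesis by simp
  qed
  show ?K by (intro word_dual_eqI) (auto simp: T_def word pick)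
  show ?K' by (intro word_dual_eqI) (auto simp: T_def word pick)
qed

lemma T_0: "T 0 0 0 = 1"
proof -
  have w: "weights 0 = {0}" by (auto simp: weights_iff elim!: Nats_cases)
  show ?thesis
  proof (rule word_dual_eqI)
    fix v
    have "rep_word q 0 v 0 0 = prod_list (map counit_gen v)"
    proof (induction v)
      case (Cons g v)
      then show ?case using q_pos by (cases g) (simp_all add: w)
    qed simp
    then show "wval (T 0 0 0) v = wval 1 v" by (simp add: T_def w)
  qed
qed


section \<open>The decomposition of the tensor product with the spin one half module\<close>

abbreviation rq :: "real \<Rightarrow> real" where "rq x \<equiv> sqrt (qnum q x)"

lemma qnum_pos: "0 < x \<Longrightarrow> 0 < qnum q x"
proof -
  assume "0 < x"
  then have "q powr x < q powr (- x)" using q_pos q_less_1 by (intro powr_less_mono') auto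
  then show ?thesis unfolding qnum_def using qnum_denominator[OF q_pos q_less_1]
    by (simp add: divide_neg_neg)
qed

lemma qnum_nonneg': "0 \<le> x \<Longrightarrow> 0 \<le> qnum q x"
  by (rule qnum_nonneg[OF q_pos q_less_1])

lemma rq_square: "0 \<le> x \<Longrightarrow> rq x * rq x = qnum q x"
  using qnum_nonneg' by simp

lemma qnum_step:
  "qnum q (x + 1) = q powr x + qnum q x / q"
  "qnum q (x + 1) = q powr (- x) + q * qnum q x"
proof -
  define y where "y = q powr x"
  have y: "y > 0" using q_pos by (simp add: y_def)
  have qq: "q - 1 / q \<noteq> 0" using qnum_denominator[OF q_pos q_less_1] by simp
  have p: "q powr (x + 1) = y * q" "q powr (- (x + 1)) = 1 / (y * q)" "q powr (- x) = 1 / y"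
    using q_pos by (simp_all add: y_def powr_add powr_minus powr_diff field_simps)
  define d where "d = q - 1 / q"
  have e1: "y * q - 1 / (y * q) = y * d + (y - 1 / y) / q"
    using y q_pos by (simp add: field_simps d_def)
  have e2: "y * q - 1 / (y * q) = 1 / y * d + q * (y - 1 / y)"
    using y q_pos by (simp add: field_simps d_def)
  show "qnum q (x + 1) = q powr x + qnum q x / q"
    unfolding qnum_def p y_def[symmetric] d_def[symmetric] e1 using qq
    by (simp add: add_divide_distrib d_def[symmetric])
  show "qnum q (x + 1) = q powr (- x) + q * qnum q x"
    unfolding qnum_def p y_def[symmetric] d_def[symmetric] e2 using qq
    by (simp add: add_divide_distrib d_def[symmetric])
qed

text \<open>Clebsch-Gordan coefficients. The vector \<open>u\<^sub>a \<otimes> u\<^sub>m\<close> of the tensor product of the modules of spin \<open>1/2\<close> and \<open>L\<close>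
  has the component \<open>cg_up L a m\<close> in the summand of spin \<open>L + 1/2\<close> and \<open>cg_down L a m\<close> in that of spin
  \<open>L - 1/2\<close>, at weight \<open>a + m\<close>. Only \<open>a = 1/2\<close> and \<open>a = - 1/2\<close> are meant.\<close>

definition cg_up :: "real \<Rightarrow> real \<Rightarrow> real \<Rightarrow> real" where
  "cg_up L a m = (if a > 0 then q powr (- (L - m) / 2) * rq (L + m + 1)
     else q powr ((L + m) / 2) * rq (L - m + 1)) / rq (2 * L + 1)"

definition cg_down :: "real \<Rightarrow> real \<Rightarrow> real \<Rightarrow> real" where
  "cg_down L a m = (if a > 0 then - (q powr ((L + m + 1) / 2) * rq (L - m))
     else q powr (- (L - m + 1) / 2) * rq (L + m)) / rq (2 * L + 1)"

lemma ladder_rq: "ladder L n = rq (L - n) * rq (L + n + 1)"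
  by (simp add: ladder_def real_sqrt_mult)

text \<open>In the variables \<open>L + m\<close> and \<open>L - m\<close> all quantities in the intertwining relations become products of
  roots of q-numbers and powers of \<open>q\<close>; afterwards the relations are polynomial identities.\<close>

lemma cg_factored:
  fixes L m :: real
  defines "u \<equiv> L + m" and "v \<equiv> L - m" and "x \<equiv> q powr ((L + m) / 2)" and "y \<equiv> q powr ((L - m) / 2)"
    and "r \<equiv> q powr (1 / 2)" and "S \<equiv> rq (2 * L + 1)"
  shows "cg_up L (1 / 2) m = rq (u + 1) / y / S" "cg_up L (- 1 / 2) m = x * rq (v + 1) / S"
    "cg_down L (1 / 2) m = - (x * r * rq v) / S" "cg_down L (- 1 / 2) m = rq u / (y * r) / S"
    "cg_up L (1 / 2) (m - 1) = rq u / (y * r) / S" "cg_up L (- 1 / 2) (m - 1) = x / r * rq (v + 2) / S"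
    "cg_down L (1 / 2) (m - 1) = - (x * rq (v + 1)) / S" "cg_down L (- 1 / 2) (m - 1) = rq (u - 1) / (y * r * r) / S"
    "cg_up L (1 / 2) (m + 1) = rq (u + 2) * r / y / S" "cg_up L (- 1 / 2) (m + 1) = x * r * rq v / S"
    "cg_down L (1 / 2) (m + 1) = - (x * r * r * rq (v - 1)) / S" "cg_down L (- 1 / 2) (m + 1) = rq (u + 1) / y / S"
    "ladder L m = rq v * rq (u + 1)" "ladder L (m - 1) = rq (v + 1) * rq u"
    "ladder (L + 1 / 2) (m - 1 / 2) = rq (v + 1) * rq (u + 1)"
    "ladder (L + 1 / 2) (m + 1 / 2) = rq v * rq (u + 2)"
    "ladder (L + 1 / 2) (m - 3 / 2) = rq (v + 2) * rq u"
    "ladder (L - 1 / 2) (m - 1 / 2) = rq v * rq u"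
    "ladder (L - 1 / 2) (m + 1 / 2) = rq (v - 1) * rq (u + 1)"
    "ladder (L - 1 / 2) (m - 3 / 2) = rq (v + 1) * rq (u - 1)"
    "q powr m = x / y"
proof -
  have p: "q powr (- (L - m) / 2) = 1 / y" "q powr ((L + m + 1) / 2) = x * r"
    "q powr (- (L - m + 1) / 2) = 1 / (y * r)" "q powr (- (L - (m - 1)) / 2) = 1 / (y * r)"
    "q powr ((L + (m - 1)) / 2) = x / r" "q powr ((L + (m - 1) + 1) / 2) = x"
    "q powr (- (L - (m - 1) + 1) / 2) = 1 / (y * r * r)"
    "q powr (- (L - (m + 1)) / 2) = r / y" "q powr ((L + (m + 1)) / 2) = x * r"
    "q powr ((L + (m + 1) + 1) / 2) = x * r * r" "q powr (- (L - (m + 1) + 1) / 2) = 1 / y"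
    "q powr (- (1 / 2)) = 1 / r" "q powr m = x / y"
    unfolding x_def y_def r_def
    unfolding powr_add[symmetric] powr_diff[symmetric] powr_minus_divide[symmetric]
    by (rule arg_cong[where f = "(powr) q"], simp add: field_simps)+
  have ar: "L + (m - 1) + 1 = u" "L - (m - 1) + 1 = v + 2" "L - (m - 1) = v + 1" "L + (m - 1) = u - 1"
    "L + (m + 1) + 1 = u + 2" "L - (m + 1) + 1 = v" "L - (m + 1) = v - 1" "L + (m + 1) = u + 1"
    by (simp_all add: u_def v_def)
  show "cg_up L (1 / 2) m = rq (u + 1) / y / S" "cg_up L (- 1 / 2) m = x * rq (v + 1) / S"
    "cg_down L (1 / 2) m = - (x * r * rq v) / S" "cg_down L (- 1 / 2) m = rq u / (y * r) / S"
    "cg_up L (1 / 2) (m - 1) = rq u / (y * r) / S" "cg_up L (- 1 / 2) (m - 1) = x / r * rq (v + 2) / S"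
    "cg_down L (1 / 2) (m - 1) = - (x * rq (v + 1)) / S" "cg_down L (- 1 / 2) (m - 1) = rq (u - 1) / (y * r * r) / S"
    "cg_up L (1 / 2) (m + 1) = rq (u + 2) * r / y / S" "cg_up L (- 1 / 2) (m + 1) = x * r * rq v / S"
    "cg_down L (1 / 2) (m + 1) = - (x * r * r * rq (v - 1)) / S" "cg_down L (- 1 / 2) (m + 1) = rq (u + 1) / y / S"
    unfolding cg_up_def cg_down_def p x_def[symmetric] unfolding ar S_def by (simp_all add: u_def v_def ac_simps)
  show "ladder L m = rq v * rq (u + 1)" "ladder L (m - 1) = rq (v + 1) * rq u"
    "ladder (L + 1 / 2) (m - 1 / 2) = rq (v + 1) * rq (u + 1)"
    "ladder (L + 1 / 2) (m + 1 / 2) = rq v * rq (u + 2)"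
    "ladder (L + 1 / 2) (m - 3 / 2) = rq (v + 2) * rq u"
    "ladder (L - 1 / 2) (m - 1 / 2) = rq v * rq u"
    "ladder (L - 1 / 2) (m + 1 / 2) = rq (v - 1) * rq (u + 1)"
    "ladder (L - 1 / 2) (m - 3 / 2) = rq (v + 1) * rq (u - 1)"
    unfolding ladder_rq by (simp_all add: u_def v_def algebra_simps)
  show "q powr m = x / y" by (rule p)
qed

text \<open>The decomposition of the tensor product commutes with \<open>e\<close> (first four relations) and with \<open>f\<close> (last
  four). Apart from cancellation of common factors, the only input is the step rule for q-numbers.\<close>

lemma cg_intertwines:
  assumes "m \<in> weights L"
  shows "cg_up L (1 / 2) m * ladder (L + 1 / 2) (m - 1 / 2) =
      q powr m * cg_up L (- 1 / 2) m + q powr (- (1 / 2)) * ladder L (m - 1) * cg_up L (1 / 2) (m - 1)"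
    and "cg_up L (- 1 / 2) m * ladder (L + 1 / 2) (m - 3 / 2) =
      q powr (1 / 2) * ladder L (m - 1) * cg_up L (- 1 / 2) (m - 1)"
    and "cg_down L (1 / 2) m * ladder (L - 1 / 2) (m - 1 / 2) =
      q powr m * cg_down L (- 1 / 2) m + q powr (- (1 / 2)) * ladder L (m - 1) * cg_down L (1 / 2) (m - 1)"
    and "cg_down L (- 1 / 2) m * ladder (L - 1 / 2) (m - 3 / 2) =
      q powr (1 / 2) * ladder L (m - 1) * cg_down L (- 1 / 2) (m - 1)"
    and "cg_up L (1 / 2) m * ladder (L + 1 / 2) (m + 1 / 2) =
      q powr (- (1 / 2)) * ladder L m * cg_up L (1 / 2) (m + 1)"
    and "cg_up L (- 1 / 2) m * ladder (L + 1 / 2) (m - 1 / 2) =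
      q powr m * cg_up L (1 / 2) m + q powr (1 / 2) * ladder L m * cg_up L (- 1 / 2) (m + 1)"
    and "cg_down L (1 / 2) m * ladder (L - 1 / 2) (m + 1 / 2) =
      q powr (- (1 / 2)) * ladder L m * cg_down L (1 / 2) (m + 1)"
    and "cg_down L (- 1 / 2) m * ladder (L - 1 / 2) (m - 1 / 2) =
      q powr m * cg_down L (1 / 2) m + q powr (1 / 2) * ladder L m * cg_down L (- 1 / 2) (m + 1)"
proof -
  define u v where "u = L + m" and "v = L - m"
  define x y r S where "x = q powr ((L + m) / 2)" and "y = q powr ((L - m) / 2)"
    and "r = q powr (1 / 2)" and "S = rq (2 * L + 1)"
  have hf: "q powr (1 / 2) = r" "q powr (- (1 / 2)) = 1 / r"
    by (simp_all add: r_def powr_minus_divide)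
  have uv: "0 \<le> u" "0 \<le> v" using weights_bounds[OF assms] by (simp_all add: u_def v_def)
  have "S > 0" unfolding S_def using uv by (intro real_sqrt_gt_zero qnum_pos) (simp add: u_def v_def)
  have pos: "x > 0" "y > 0" "r > 0" "S \<noteq> 0" using \<open>S > 0\<close> q_pos by (simp_all add: x_def y_def r_def)
  have qr: "q = r * r" using q_pos unfolding r_def by (simp flip: powr_add)
  have pw: "q powr u = x * x" "q powr (- v) = 1 / (y * y)"
    unfolding x_def y_def u_def v_def using q_pos by (simp_all flip: powr_add powr_minus_divide)
  define um u0 u1 u2 vm v0 v1 v2 where "um = rq (u - 1)" and "u0 = rq u" and "u1 = rq (u + 1)" and "u2 = rq (u + 2)"
    and "vm = rq (v - 1)" and "v0 = rq v" and "v1 = rq (v + 1)" and "v2 = rq (v + 2)"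
  note cg = cg_factored[where L = L and m = m, folded u_def v_def x_def y_def r_def S_def,
      folded um_def u0_def u1_def u2_def vm_def v0_def v1_def v2_def] hf
  have sq: "u1 * u1 = x * x + u0 * u0 / (r * r)" "v1 * v1 = 1 / (y * y) + r * r * (v0 * v0)"
    unfolding u1_def u0_def v1_def v0_def
    using rq_square[of u] rq_square[of v] rq_square[of "u + 1"] rq_square[of "v + 1"] uv
      qnum_step(1)[of u] qnum_step(2)[of v] pw qr by simp_all
  have "u1 / y / S * (v1 * u1) = v1 * (u1 * u1) / y / S" by simp
  also have "\<dots> = x / y * (x * v1 / S) + 1 / r * (v1 * u0) * (u0 / (y * r) / S)"
    unfolding sq using pos by (simp add: field_simps)
  finally show "cg_up L (1 / 2) m * ladder (L + 1 / 2) (m - 1 / 2) =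
      q powr m * cg_up L (- 1 / 2) m + q powr (- (1 / 2)) * ladder L (m - 1) * cg_up L (1 / 2) (m - 1)"
    unfolding cg .
  show "cg_up L (- 1 / 2) m * ladder (L + 1 / 2) (m - 3 / 2) =
      q powr (1 / 2) * ladder L (m - 1) * cg_up L (- 1 / 2) (m - 1)"
    unfolding cg using pos by (simp add: ac_simps)
  have "x / y * (u0 / (y * r) / S) + 1 / r * (v1 * u0) * (- (x * v1) / S)
      = x / y * (u0 / (y * r) / S) - x / r * u0 * (v1 * v1) / S" by simp
  also have "\<dots> = - (x * r * v0) / S * (v0 * u0)"
    unfolding sq using pos by (simp add: field_simps)
  finally show "cg_down L (1 / 2) m * ladder (L - 1 / 2) (m - 1 / 2) =
      q powr m * cg_down L (- 1 / 2) m + q powr (- (1 / 2)) * ladder L (m - 1) * cg_down L (1 / 2) (m - 1)"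
    unfolding cg by simp
  show "cg_down L (- 1 / 2) m * ladder (L - 1 / 2) (m - 3 / 2) =
      q powr (1 / 2) * ladder L (m - 1) * cg_down L (- 1 / 2) (m - 1)"
    unfolding cg using pos by (simp add: ac_simps)
  show "cg_up L (1 / 2) m * ladder (L + 1 / 2) (m + 1 / 2) =
      q powr (- (1 / 2)) * ladder L m * cg_up L (1 / 2) (m + 1)"
    unfolding cg using pos by (simp add: ac_simps)
  have "x * v1 / S * (v1 * u1) = x * u1 * (v1 * v1) / S" by simp
  also have "\<dots> = x / y * (u1 / y / S) + r * (v0 * u1) * (x * r * v0 / S)"
    unfolding sq using pos by (simp add: field_simps)
  finally show "cg_up L (- 1 / 2) m * ladder (L + 1 / 2) (m - 1 / 2) =
      q powr m * cg_up L (1 / 2) m + q powr (1 / 2) * ladder L m * cg_up L (- 1 / 2) (m + 1)"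
    unfolding cg .
  show "cg_down L (1 / 2) m * ladder (L - 1 / 2) (m + 1 / 2) =
      q powr (- (1 / 2)) * ladder L m * cg_down L (1 / 2) (m + 1)"
    unfolding cg using pos by (simp add: ac_simps)
  have "x / y * (- (x * r * v0) / S) + r * (v0 * u1) * (u1 / y / S)
      = x / y * (- (x * r * v0) / S) + r * v0 / y * (u1 * u1) / S" by simp
  also have "\<dots> = u0 / (y * r) / S * (v0 * u0)"
    unfolding sq using pos by (simp add: field_simps)
  finally show "cg_down L (- 1 / 2) m * ladder (L - 1 / 2) (m - 1 / 2) =
      q powr m * cg_down L (1 / 2) m + q powr (1 / 2) * ladder L m * cg_down L (- 1 / 2) (m + 1)"
    unfolding cg by simp
qed


lemma qnum_add: "qnum q (x + y) = q powr (- y) * qnum q x + q powr x * qnum q y"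
proof -
  define a b where "a = q powr x" and "b = q powr y"
  have ab: "a > 0" "b > 0" using q_pos by (simp_all add: a_def b_def)
  have p: "q powr (x + y) = a * b" "q powr (- (x + y)) = 1 / (a * b)" "q powr (- x) = 1 / a" "q powr (- y) = 1 / b"
    using q_pos by (simp_all add: a_def b_def powr_add powr_minus powr_diff field_simps)
  have e: "a * b - 1 / (a * b) = 1 / b * (a - 1 / a) + a * (b - 1 / b)"
    using ab by (simp add: field_simps)
  show ?thesis unfolding qnum_def p a_def[symmetric] b_def[symmetric] e
    by (simp add: add_divide_distrib)
qed

text \<open>The decomposition is orthogonal: the norms are \<open>1\<close> by the addition rule for q-numbers, and the two vectors
  of one weight are perpendicular because their products cancel.\<close>

lemma cg_orthonormal:
  assumes "m \<in> weights L"
  shows "cg_up L (1 / 2) m * cg_up L (1 / 2) m + cg_down L (1 / 2) m * cg_down L (1 / 2) m = 1"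
    and "cg_up L (- 1 / 2) m * cg_up L (- 1 / 2) m + cg_down L (- 1 / 2) m * cg_down L (- 1 / 2) m = 1"
    and "cg_up L (1 / 2) m * cg_up L (- 1 / 2) (m + 1) + cg_down L (1 / 2) m * cg_down L (- 1 / 2) (m + 1) = 0"
proof -
  define u v where "u = L + m" and "v = L - m"
  define x y r S where "x = q powr ((L + m) / 2)" and "y = q powr ((L - m) / 2)"
    and "r = q powr (1 / 2)" and "S = rq (2 * L + 1)"
  note cg = cg_factored[where L = L and m = m, folded u_def v_def x_def y_def r_def S_def]
  have uv: "0 \<le> u" "0 \<le> v" using weights_bounds[OF assms] by (simp_all add: u_def v_def)
  have "S > 0" unfolding S_def using uv by (intro real_sqrt_gt_zero qnum_pos) (simp add: u_def v_def)
  have pos: "x > 0" "y > 0" "r > 0" "S \<noteq> 0" using \<open>S > 0\<close> q_pos by (simp_all add: x_def y_def r_def)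
  have S2: "S * S = qnum q (u + 1 + v)" "S * S = qnum q (u + (v + 1))"
    unfolding S_def u_def v_def using uv rq_square[of "2 * L + 1"] by (simp_all add: u_def v_def algebra_simps)
  have pw: "q powr (- v) = 1 / (y * y)" "q powr (u + 1) = (x * r) * (x * r)" "q powr u = x * x"
    "q powr (- (v + 1)) = 1 / ((y * r) * (y * r))"
    unfolding x_def y_def u_def v_def r_def by (simp_all flip: powr_add powr_minus_divide)
  have sq: "rq (u + 1) * rq (u + 1) = qnum q (u + 1)" "rq v * rq v = qnum q v"
     "rq (v + 1) * rq (v + 1) = qnum q (v + 1)" "rq u * rq u = qnum q u"
    using uv by (simp_all only: rq_square add_nonneg_nonneg zero_le_one)
  have "rq (u + 1) / y / S * (rq (u + 1) / y / S) + - (x * r * rq v) / S * (- (x * r * rq v) / S) =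
    (1 / (y * y) * (rq (u + 1) * rq (u + 1)) + (x * r) * (x * r) * (rq v * rq v)) / (S * S)"
    by (simp add: add_divide_distrib mult.assoc mult.left_commute)
  also have "\<dots> = S * S / (S * S)" unfolding sq S2(1) pw[symmetric] by (subst (3) qnum_add) simp
  finally show "cg_up L (1 / 2) m * cg_up L (1 / 2) m + cg_down L (1 / 2) m * cg_down L (1 / 2) m = 1"
    unfolding cg using pos by simp
  have "x * rq (v + 1) / S * (x * rq (v + 1) / S) + rq u / (y * r) / S * (rq u / (y * r) / S) =
    (1 / ((y * r) * (y * r)) * (rq u * rq u) + x * x * (rq (v + 1) * rq (v + 1))) / (S * S)"
    by (simp add: add_divide_distrib mult.assoc mult.left_commute)
  also have "\<dots> = S * S / (S * S)" unfolding sq S2(2) pw[symmetric] by (subst (3) qnum_add) simp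
  finally show "cg_up L (- 1 / 2) m * cg_up L (- 1 / 2) m + cg_down L (- 1 / 2) m * cg_down L (- 1 / 2) m = 1"
    unfolding cg using pos by simp
  show "cg_up L (1 / 2) m * cg_up L (- 1 / 2) (m + 1) + cg_down L (1 / 2) m * cg_down L (- 1 / 2) (m + 1) = 0"
    unfolding cg using pos by simp
qed

lemma weights_half: "weights (1 / 2) = {1 / 2, - 1 / 2}"
proof -
  have "m = 1 / 2 \<or> m = - 1 / 2" if "m \<le> 1 / 2" "1 / 2 + m = real i" for m i
  proof -
    have "i = 0 \<or> i = 1" using that by linarith
    with that show ?thesis by auto
  qed
  then show ?thesis by (fastforce simp: weights_iff elim!: Nats_cases)
qed

lemma half_in_half_ints [simp]: "1 / 2 \<in> half_ints"
  unfolding half_ints_def by (auto intro: exI[of _ 1])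

lemma ladder_half: "ladder (1 / 2) (- 1 / 2) = 1"
proof -
  have "qnum q 1 = 1" using qnum_denominator[OF q_pos q_less_1] q_pos
    by (simp add: qnum_def powr_minus_divide)
  then show ?thesis by (simp add: ladder_def)
qed

lemma lshift_T_half:
  "lshift GE (T (1 / 2) (1 / 2) b) = T (1 / 2) (- 1 / 2) b" "lshift GE (T (1 / 2) (- 1 / 2) b) = 0"
  "lshift GF (T (1 / 2) (1 / 2) b) = 0" "lshift GF (T (1 / 2) (- 1 / 2) b) = T (1 / 2) (1 / 2) b"
proof -
  have o: "T (1 / 2) (- 3 / 2) b = 0" "T (1 / 2) (3 / 2) b = 0" by (simp_all add: weights_half)
  show "lshift GE (T (1 / 2) (1 / 2) b) = T (1 / 2) (- 1 / 2) b"
    using lshift_T(1)[of "1 / 2" "1 / 2" b] ladder_half by simp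
  show "lshift GE (T (1 / 2) (- 1 / 2) b) = 0"
    using lshift_T(1)[of "1 / 2" "- 1 / 2" b] o by simp
  show "lshift GF (T (1 / 2) (1 / 2) b) = 0"
    using lshift_T(2)[of "1 / 2" "1 / 2" b] o by simp
  show "lshift GF (T (1 / 2) (- 1 / 2) b) = T (1 / 2) (1 / 2) b"
    using lshift_T(2)[of "1 / 2" "- 1 / 2" b] ladder_half by simp
qed

text \<open>Two coefficient identities, one for each summand of the tensor product, give an identity of
  functionals. Its shape is that of a translation rule for the right hand side of the product formula.\<close>

lemma wscale_regroup:
  assumes "U * l = A * U2 + B * U3" "D * l' = A * D2 + B * D3"
  shows "wscale (of_real (U * x)) (wscale (of_real l) X) + wscale (of_real (D * y)) (wscale (of_real l') Y) =
    wscale (of_real A) (wscale (of_real (U2 * x)) X + wscale (of_real (D2 * y)) Y)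
    + wscale (of_real B) (wscale (of_real (U3 * x)) X + wscale (of_real (D3 * y)) Y)"
proof -
  have "U * x * l = A * (U2 * x) + B * (U3 * x)" "D * y * l' = A * (D2 * y) + B * (D3 * y)"
    using arg_cong[OF assms(1), of "\<lambda>t. x * t"] arg_cong[OF assms(2), of "\<lambda>t. y * t"]
    by (simp_all add: algebra_simps)
  then have "complex_of_real (U * x) * of_real l = of_real (A * (U2 * x)) + of_real (B * (U3 * x))"
     "complex_of_real (D * y) * of_real l' = of_real (A * (D2 * y)) + of_real (B * (D3 * y))"
    unfolding of_real_mult[symmetric] of_real_add[symmetric] by simp_all
  then have "wscale (of_real (U * x)) (wscale (of_real l) X) = wscale (of_real (A * (U2 * x)) + of_real (B * (U3 * x))) X"
    "wscale (of_real (D * y)) (wscale (of_real l') Y) = wscale (of_real (A * (D2 * y)) + of_real (B * (D3 * y))) Y"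
    by simp_all
  then show ?thesis
    by (simp add: wd.scale_left_distrib wd.scale_right_distrib)
qed

text \<open>Both sides are families of functionals indexed by the left indices \<open>a\<close> and \<open>m\<close>. Under left translation
  by generators both obey the same linear recursion, the right hand side by \<open>cg_intertwines\<close>, and their
  values on the empty word agree by \<open>cg_orthonormal\<close>. Hence they agree on all words.\<close>

lemma T_half_mult:
  assumes L: "L \<in> half_nats" and a: "a \<in> {1 / 2, - 1 / 2}" and b: "b \<in> {1 / 2, - 1 / 2}"
    and m: "m \<in> weights L" and n: "n \<in> weights L"
  shows "T (1 / 2) a b * T L m n =
    wscale (of_real (cg_up L a m * cg_up L b n)) (T (L + 1 / 2) (a + m) (b + n))
    + wscale (of_real (cg_down L a m * cg_down L b n)) (T (L - 1 / 2) (a + m) (b + n))"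
proof -
  define P where "P a m = T (1 / 2) a b * T L m n" for a m
  define Q where "Q a m = wscale (of_real (cg_up L a m * cg_up L b n)) (T (L + 1 / 2) (a + m) (b + n))
    + wscale (of_real (cg_down L a m * cg_down L b n)) (T (L - 1 / 2) (a + m) (b + n))" for a m
  have Li: "L \<in> half_ints" using L half_nats_iff by blast
  define s where "s = complex_of_real (q powr (1 / 2))"
  define s' where "s' = complex_of_real (q powr (- (1 / 2)))"
  note lT = lshift_T[OF Li] lshift_T(3,4)[OF half_in_half_ints] lshift_T[OF half_ints_step(1)[OF Li]]
    lshift_T[OF half_ints_step(2)[OF Li]]
  have ar: "1 / 2 + m - 1 = m - 1 / 2" "- 1 / 2 + m = m - 1 / 2" "- 1 / 2 + m - 1 = m - 3 / 2"
     "1 / 2 + (m - 1) = m - 1 / 2" "- 1 / 2 + (m - 1) = m - 3 / 2" "1 / 2 + m = m + 1 / 2"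
     "m + 1 / 2 + 1 = m + 3 / 2" "m - 1 / 2 + 1 = m + 1 / 2" "1 / 2 + (m + 1) = m + 3 / 2"
     "- 1 / 2 + (m + 1) = m + 1 / 2" "m + 1 / 2 - 1 = m - 1 / 2" "m - 1 / 2 - 1 = m - 3 / 2"
     "m - 1 + 1 / 2 = m - 1 / 2" "m + 1 + 1 / 2 = m + 3 / 2"
     "m - 1 - 1 / 2 = m - 3 / 2" "m + 1 - 1 / 2 = m + 1 / 2" for m :: real
    by simp_all
  have pGE: "lshift GE (P (1 / 2) m) = wscale (of_real (q powr m)) (P (- 1 / 2) m)
      + wscale (of_real (q powr (- (1 / 2)) * ladder L (m - 1))) (P (1 / 2) (m - 1))"
    "lshift GE (P (- 1 / 2) m) = wscale (of_real 0) (P (1 / 2) m) + wscale (of_real (q powr (1 / 2) * ladder L (m - 1))) (P (- 1 / 2) (m - 1))"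
    "lshift GF (P (1 / 2) m) = wscale (of_real 0) (P (1 / 2) m) + wscale (of_real (q powr (- (1 / 2)) * ladder L m)) (P (1 / 2) (m + 1))"
    "lshift GF (P (- 1 / 2) m) = wscale (of_real (q powr m)) (P (1 / 2) m)
      + wscale (of_real (q powr (1 / 2) * ladder L m)) (P (- 1 / 2) (m + 1))" for m
    unfolding P_def by (simp_all add: lshift_mult lshift_T_half lT mult.commute lshift_T_half[simplified])
  have qGE: "lshift GE (Q (1 / 2) m) = wscale (of_real (q powr m)) (Q (- 1 / 2) m)
      + wscale (of_real (q powr (- (1 / 2)) * ladder L (m - 1))) (Q (1 / 2) (m - 1))"
    "lshift GE (Q (- 1 / 2) m) = wscale (of_real 0) (Q (1 / 2) m) + wscale (of_real (q powr (1 / 2) * ladder L (m - 1))) (Q (- 1 / 2) (m - 1))"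
    "lshift GF (Q (1 / 2) m) = wscale (of_real 0) (Q (1 / 2) m) + wscale (of_real (q powr (- (1 / 2)) * ladder L m)) (Q (1 / 2) (m + 1))"
    "lshift GF (Q (- 1 / 2) m) = wscale (of_real (q powr m)) (Q (1 / 2) m)
      + wscale (of_real (q powr (1 / 2) * ladder L m)) (Q (- 1 / 2) (m + 1))" if m: "m \<in> weights L" for m
  proof -
    note cgi = cg_intertwines[OF m]
    show "lshift GE (Q (1 / 2) m) = wscale (of_real (q powr m)) (Q (- 1 / 2) m)
      + wscale (of_real (q powr (- (1 / 2)) * ladder L (m - 1))) (Q (1 / 2) (m - 1))"
      unfolding Q_def shift_linear_simps lT ar by (rule wscale_regroup[OF cgi(1) cgi(3)])
    have "lshift GE (Q (- 1 / 2) m) = wscale (of_real 0) (Q (- 1 / 2) (m - 1)) + wscale (of_real (q powr (1 / 2) * ladder L (m - 1))) (Q (- 1 / 2) (m - 1))"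
      unfolding Q_def shift_linear_simps lT ar by (rule wscale_regroup) (use cgi(2,4) in simp_all)
    then show "lshift GE (Q (- 1 / 2) m) = wscale (of_real 0) (Q (1 / 2) m) + wscale (of_real (q powr (1 / 2) * ladder L (m - 1))) (Q (- 1 / 2) (m - 1))"
      by simp
    have "lshift GF (Q (1 / 2) m) = wscale (of_real 0) (Q (1 / 2) (m + 1)) + wscale (of_real (q powr (- (1 / 2)) * ladder L m)) (Q (1 / 2) (m + 1))"
      unfolding Q_def shift_linear_simps lT ar by (rule wscale_regroup) (use cgi(5,7) in simp_all)
    then show "lshift GF (Q (1 / 2) m) = wscale (of_real 0) (Q (1 / 2) m) + wscale (of_real (q powr (- (1 / 2)) * ladder L m)) (Q (1 / 2) (m + 1))"
      by simp
    show "lshift GF (Q (- 1 / 2) m) = wscale (of_real (q powr m)) (Q (1 / 2) m)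
      + wscale (of_real (q powr (1 / 2) * ladder L m)) (Q (- 1 / 2) (m + 1))"
      unfolding Q_def shift_linear_simps lT ar by (rule wscale_regroup[OF cgi(6) cgi(8)])
  qed
  have kP: "lshift GK (P a m) = wscale (of_real (q powr (a + m))) (P a m)"
    "lshift GKinv (P a m) = wscale (of_real (q powr (- (a + m)))) (P a m)" for a m
  proof -
    have c: "q powr (a + m) = q powr m * q powr a" "q powr (- (a + m)) = q powr (- m) * q powr (- a)"
      by (simp_all flip: powr_add add: add.commute)
    show "lshift GK (P a m) = wscale (of_real (q powr (a + m))) (P a m)"
      "lshift GKinv (P a m) = wscale (of_real (q powr (- (a + m)))) (P a m)"
      unfolding P_def lshift_mult lT c by (simp_all del: powr_mult_base)
  qed
  have kQ: "lshift GK (Q a m) = wscale (of_real (q powr (a + m))) (Q a m)"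
    "lshift GKinv (Q a m) = wscale (of_real (q powr (- (a + m)))) (Q a m)" for a m
    unfolding Q_def by (simp_all add: lT wd.scale_right_distrib mult.commute)
  have "\<forall>a\<in>{1 / 2, - 1 / 2}. \<forall>m\<in>weights L. wval (P a m) w = wval (Q a m) w" for w
  proof (induction w)
    case Nil
    have ab: "1 / 2 + m = - 1 / 2 + n \<longleftrightarrow> n = m + 1" "- 1 / 2 + m = 1 / 2 + n \<longleftrightarrow> m = n + 1" for m n :: real
      by auto
    have st: "m + 1 / 2 \<in> weights (L + 1 / 2)" "m - 1 / 2 \<in> weights (L + 1 / 2)" if "m \<in> weights L" for m
      using that by (auto simp: weights_iff)
    \<comment> \<open>At the extreme weights only the larger spin occurs: the coefficient of the smaller one vanishes there.\<close>
    have bd: "cg_down L (1 / 2) m = 0" if "m \<in> weights L" "m + 1 / 2 \<notin> weights (L - 1 / 2)" for m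
    proof -
      have "\<not> m + 1 \<le> L" using that by (auto simp: weights_iff)
      then have "m + 1 \<notin> weights L" by (auto simp: weights_iff)
      then show ?thesis using weights_upper[OF L that(1)] by (simp add: cg_down_def)
    qed
    have bd': "cg_down L (- 1 / 2) m = 0" if "m \<in> weights L" "m - 1 / 2 \<notin> weights (L - 1 / 2)" for m
    proof -
      have "m - 1 \<notin> weights L" using that by (auto simp: weights_iff add_diff_eq)
      then show ?thesis using weights_lower[OF that(1)] by (simp add: cg_down_def)
    qed
    have v: "wval (Q a m) [] = of_real ((if a + m = b + n then
        cg_up L a m * cg_up L b n + cg_down L a m * cg_down L b n else 0))"
      if "a \<in> {1 / 2, - 1 / 2}" "m \<in> weights L" for a m
    proof -
      have A: "a + m \<in> weights (L + 1 / 2)"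
        using that(1) st[OF that(2)] by (elim insertE emptyE; hypsubst; unfold ar)
      have B: "cg_down L a m = 0" if "a + m \<notin> weights (L - 1 / 2)"
        using \<open>a \<in> _\<close> that bd[OF \<open>m \<in> _\<close>] bd'[OF \<open>m \<in> _\<close>]
        by (elim insertE emptyE; hypsubst; unfold ar)
      show ?thesis unfolding Q_def wval_simps wval_wscale wval_T_Nil using A B by auto
    qed
    have c: "cg_up L (1 / 2) n * cg_up L (- 1 / 2) (n + 1) + cg_down L (1 / 2) n * cg_down L (- 1 / 2) (n + 1) = 0"
      if "n \<in> weights L" for n using cg_orthonormal(3)[OF that] .
    show ?case
    proof (intro ballI)
      fix a m assume am: "a \<in> {1 / 2, - 1 / 2 :: real}" "m \<in> weights L"
      have "wval (P a m) [] = (if a = b \<and> m = n then 1 else 0)"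
        using am(1) b m n unfolding P_def by (auto simp: wval_T_Nil weights_half am)
      also have "\<dots> = of_real (if a + m = b + n then
        cg_up L a m * cg_up L b n + cg_down L a m * cg_down L b n else 0)"
      proof (cases "a = b")
        case True
        have "cg_up L b n * cg_up L b n + cg_down L b n * cg_down L b n = 1"
          using b cg_orthonormal(1,2)[OF n] by (elim insertE emptyE) (hypsubst, assumption)+
        then show ?thesis using True by (cases "m = n") auto
      next
        case False
        have "cg_up L a m * cg_up L b n + cg_down L a m * cg_down L b n = 0" if "a + m = b + n"
          using am(1) b False that
        proof (elim insertE emptyE)
          assume "a = 1 / 2" "b = - 1 / 2"
          with that have "n = m + 1" by simp
          then show ?thesis unfolding \<open>a = _\<close> \<open>b = _\<close> using c[OF am(2)] by simp
        next
          assume "a = - 1 / 2" "b = 1 / 2"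
          with that have "m = n + 1" by simp
          then show ?thesis unfolding \<open>a = _\<close> \<open>b = _\<close> using c[OF n] by (simp add: mult.commute)
        qed simp_all
        with False show ?thesis by auto
      qed
      also have "\<dots> = wval (Q a m) []" using v[OF am] by simp
      finally show "wval (P a m) [] = wval (Q a m) []" .
    qed
  next
    case (Cons g w)
    have IH: "of_real c * wval (P a m) w = of_real c * wval (Q a m) w"
      if "a \<in> {1 / 2, - 1 / 2}" "m \<in> weights L \<or> c = 0" for a m and c :: real
      using bspec[OF bspec[OF Cons that(1)]] that(2) by (cases "c = 0") simp_all
    have h: "1 / 2 \<in> {1 / 2, - 1 / 2 :: real}" "- 1 / 2 \<in> {1 / 2, - 1 / 2 :: real}" by simp_all
    \<comment> \<open>A translate either has its indices in range, or its ladder factor is zero.\<close>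
    have lo: "m - 1 \<in> weights L \<or> q powr x * ladder L (m - 1) = 0" if "m \<in> weights L" for m x
      using ladder_bottom[of "m - 1" L] that by auto
    have hi: "m + 1 \<in> weights L \<or> q powr x * ladder L m = 0" if "m \<in> weights L" for m x
      using ladder_top[OF Li that] by auto
    show ?case
    proof (intro ballI)
      fix a m assume am: "a \<in> {1 / 2, - 1 / 2 :: real}" "m \<in> weights L"
      have "wval (lshift g (P a m)) w = wval (lshift g (Q a m)) w"
      proof (cases g)
        case GE
        show ?thesis using am(1)
          by (elim insertE emptyE; hypsubst; unfold GE pGE qGE[OF am(2)] wval_simps wval_wscale
            IH[OF h(1) lo[OF am(2)]] IH[OF h(2) lo[OF am(2)]] IH[OF h(1) disjI1[OF am(2)]] IH[OF h(2) disjI1[OF am(2)]]) simp_all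
      next
        case GF
        show ?thesis using am(1)
          by (elim insertE emptyE; hypsubst; unfold GF pGE qGE[OF am(2)] wval_simps wval_wscale
            IH[OF h(1) hi[OF am(2)]] IH[OF h(2) hi[OF am(2)]] IH[OF h(1) disjI1[OF am(2)]] IH[OF h(2) disjI1[OF am(2)]]) simp_all
      next
        case GK
        then show ?thesis using IH[OF am(1) disjI1[OF am(2)]] by (simp add: kP kQ del: wval_shift)
      next
        case GKinv
        then show ?thesis using IH[OF am(1) disjI1[OF am(2)]] by (simp add: kP kQ del: wval_shift)
      qed
      then show "wval (P a m) (g # w) = wval (Q a m) (g # w)" by simp
    qed
  qed
  then have "wval (P a m) w = wval (Q a m) w" for w using a m by blast
  then have "P a m = Q a m" by (rule word_dual_eqI)
  then show ?thesis by (simp only: P_def Q_def)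
qed

end


lemma span_linear_into:
  assumes "wlinear f" "\<And>b. b \<in> B \<Longrightarrow> f b \<in> wd.span C" "x \<in> wd.span B"
  shows "f x \<in> wd.span C"
proof -
  have "f ` wd.span B = wd.span (f ` B)" using wd.linear_span_image[OF assms(1)] by simp
  also have "\<dots> \<subseteq> wd.span C" using assms(2) by (intro wd.span_minimal) auto
  finally show ?thesis using assms(3) by blast
qed

text \<open>Joint eigenvectors with distinct systems of eigenvalues are independent: applying one operator
  minus an eigenvalue to a relation removes a vector from it and keeps all others that the operator separates from it.\<close>

lemma eigenvectors_independent:
  fixes v :: "'i \<Rightarrow> word_dual"
  assumes nz: "\<And>i. i \<in> I \<Longrightarrow> v i \<noteq> 0"
    and sep: "\<And>i j. i \<in> I \<Longrightarrow> j \<in> I \<Longrightarrow> i \<noteq> j \<Longrightarrow>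
      \<exists>f ev. wlinear f \<and> (\<forall>k\<in>I. f (v k) = wscale (ev k) (v k)) \<and> ev i \<noteq> ev j"
    and "finite F" "F \<subseteq> I" "(\<Sum>i\<in>F. wscale (c i) (v i)) = 0" "i \<in> F"
  shows "c i = 0"
  using assms(3-)
proof (induction "card F" arbitrary: F c i rule: less_induct)
  case less
  show ?case
  proof (cases "F = {i}")
    case True
    with less.prems(2,3,4) nz[of i] show ?thesis by auto
  next
    case False
    then obtain j where j: "j \<in> F" "j \<noteq> i" using less.prems(4) by auto
    have ij: "i \<in> I" "j \<in> I" "i \<noteq> j" using less.prems(2,4) j by auto
    obtain f ev where f0: "wlinear f" "\<forall>k\<in>I. f (v k) = wscale (ev k) (v k)" "ev i \<noteq> ev j"
      using sep[OF ij] by (elim exE conjE) (rule that)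
    note f = f0(1) bspec[OF f0(2)] f0(3)
    have "0 = f (\<Sum>k\<in>F. wscale (c k) (v k)) - wscale (ev j) (\<Sum>k\<in>F. wscale (c k) (v k))"
      using less.prems wd.linear_0[OF f(1)] by simp
    also have "\<dots> = (\<Sum>k\<in>F. wscale (c k * (ev k - ev j)) (v k))"
      unfolding wd.linear_sum[OF f(1)] wd.scale_sum_right sum_subtractf[symmetric]
    proof (intro sum.cong refl)
      fix k assume "k \<in> F"
      then have "k \<in> I" using less.prems(2) by blast
      then show "f (wscale (c k) (v k)) - wscale (ev j) (wscale (c k) (v k)) = wscale (c k * (ev k - ev j)) (v k)"
        by (simp add: wd.linear_scale[OF f(1)] f(2) right_diff_distrib wd.scale_left_diff_distrib mult.commute)
    qed
    also have "\<dots> = (\<Sum>k\<in>F - {j}. wscale (c k * (ev k - ev j)) (v k))"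
      using less.prems(1) by (intro sum.mono_neutral_right) auto
    finally have "(\<Sum>k\<in>F - {j}. wscale (c k * (ev k - ev j)) (v k)) = 0" by simp
    moreover have "card (F - {j}) < card F" using j less.prems(1) by (intro psubset_card_mono) auto
    ultimately have "c i * (ev i - ev j) = 0"
      using less.hyps[of "F - {j}" "\<lambda>k. c k * (ev k - ev j)" i] less.prems j by auto
    with f(3) show ?thesis by simp
  qed
qed

lemma half_nats_induct [consumes 1, case_names zero step]:
  assumes "L \<in> half_nats" and "P 0"
    and step: "\<And>L. L \<in> half_nats \<Longrightarrow> P L \<Longrightarrow> (1 / 2 \<le> L \<Longrightarrow> P (L - 1 / 2)) \<Longrightarrow> P (L + 1 / 2)"
  shows "P L"
proof -
  have "P (real n / 2)" for n
  proof (induction n rule: less_induct)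
    case (less n)
    show ?case
    proof (cases n)
      case 0
      then show ?thesis using assms(2) by simp
    next
      case (Suc m)
      have "P (real m / 2 + 1 / 2)"
      proof (rule step)
        show "real m / 2 \<in> half_nats" by (auto simp: half_nats_def)
        show "P (real m / 2)" using less Suc by simp
        assume "1 / 2 \<le> real m / 2"
        then have "real m / 2 - 1 / 2 = real (m - 1) / 2" "m - 1 < n" using Suc by (auto simp: of_nat_diff field_simps)
        then show "P (real m / 2 - 1 / 2)" using less.IH[of "m - 1"] by (simp only:)
      qed
      then show ?thesis using Suc by (simp add: add_divide_distrib add.commute)
    qed
  qed
  moreover obtain n where "L = real n / 2" using assms(1) by (auto simp: half_nats_def)
  ultimately show ?thesis by (simp only:)
qed

context q_parameter
begin

text \<open>The triples \<open>(\<lambda>, m, n)\<close> that index the Peter-Weyl basis.\<close>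

definition idx :: "(real \<times> real \<times> real) set" where
  "idx = {(L, m, n). L \<in> half_nats \<and> m \<in> weights L \<and> n \<in> weights L}"

definition tb :: "real \<times> real \<times> real \<Rightarrow> word_dual" where
  "tb = (\<lambda>(L, m, n). T L m n)"

abbreviation SU :: "word_dual set" where
  "SU \<equiv> wd.span (tb ` idx)"

lemma idx_iff: "(L, m, n) \<in> idx \<longleftrightarrow> L \<in> half_nats \<and> m \<in> weights L \<and> n \<in> weights L"
  by (simp add: idx_def)

lemma tb_simp [simp]: "tb (L, m, n) = T L m n"
  by (simp add: tb_def)

lemma weights_nonneg: "m \<in> weights L \<Longrightarrow> 0 \<le> L"
  using weights_bounds[of m L] by linarith

lemma cg_up_pos: "0 < L + m + 1 \<Longrightarrow> 0 \<le> L \<Longrightarrow> 0 < cg_up L (1 / 2) m"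
    "0 < L - m + 1 \<Longrightarrow> 0 \<le> L \<Longrightarrow> 0 < cg_up L (- 1 / 2) m"
  using q_pos qnum_pos[of "2 * L + 1"] qnum_pos[of "L + m + 1"] qnum_pos[of "L - m + 1"]
  by (simp_all add: cg_up_def)

lemma weights_step_decomp:
  assumes "L \<in> half_nats" "M \<in> weights (L + 1 / 2)"
  shows "\<exists>a\<in>{1 / 2, - 1 / 2}. \<exists>m\<in>weights L. M = a + m \<and> 0 < cg_up L a m"
proof -
  have L: "0 \<le> L" using assms half_nats_iff by blast
  obtain i where i: "L + 1 / 2 + M = real i" "M \<le> L + 1 / 2"
    using assms(2) by (auto simp: weights_iff elim!: Nats_cases)
  show ?thesis
  proof (cases i)
    case 0
    have m: "M + 1 / 2 = - L" using i 0 by simp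
    have "- L \<in> weights L" using L by (simp add: weights_iff)
    moreover have "0 < cg_up L (- 1 / 2) (- L)" using L by (intro cg_up_pos) auto
    ultimately show ?thesis using m by (intro bexI[of _ "- 1 / 2"] bexI[of _ "- L"]) auto
  next
    case (Suc j)
    have "L + (M - 1 / 2) = real j" using i Suc by simp
    then have w: "M - 1 / 2 \<in> weights L" using i by (auto simp: weights_iff)
    moreover have "0 < cg_up L (1 / 2) (M - 1 / 2)" using weights_bounds[OF w] L by (intro cg_up_pos) auto
    ultimately show ?thesis by (intro bexI[of _ "1 / 2"] bexI[of _ "M - 1 / 2"]) auto
  qed
qed

text \<open>Solving the product formula for its component of larger spin. Every weight of spin \<open>L + 1/2\<close> is of the
  form \<open>a + m\<close> with a positive Clebsch-Gordan coefficient.\<close>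

lemma T_step:
  assumes L: "L \<in> half_nats" and M: "M \<in> weights (L + 1 / 2)" and N: "N \<in> weights (L + 1 / 2)"
  obtains a b m n c d where "a \<in> {1 / 2, - 1 / 2}" "b \<in> {1 / 2, - 1 / 2}" "m \<in> weights L" "n \<in> weights L"
    "M = a + m" "N = b + n"
    "T (L + 1 / 2) M N = wscale c (T (1 / 2) a b * T L m n) + wscale d (T (L - 1 / 2) M N)"
proof -
  obtain a m where a: "a \<in> {1 / 2, - 1 / 2}" "m \<in> weights L" "M = a + m" "0 < cg_up L a m"
    using weights_step_decomp[OF L M] by blast
  obtain b n where b: "b \<in> {1 / 2, - 1 / 2}" "n \<in> weights L" "N = b + n" "0 < cg_up L b n"
    using weights_step_decomp[OF L N] by blast
  define u w where "u = complex_of_real (cg_up L a m * cg_up L b n)"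
    and "w = complex_of_real (cg_down L a m * cg_down L b n)"
  have "u \<noteq> 0" using a b by (simp add: u_def)
  have "T (1 / 2) a b * T L m n = wscale u (T (L + 1 / 2) M N) + wscale w (T (L - 1 / 2) M N)"
    unfolding a(3) b(3) u_def w_def by (rule T_half_mult[OF L a(1) b(1) a(2) b(2)])
  then have "T (L + 1 / 2) M N = wscale (1 / u) (T (1 / 2) a b * T L m n) + wscale (- (w / u)) (T (L - 1 / 2) M N)"
    using \<open>u \<noteq> 0\<close> by (simp add: wd.scale_right_distrib)
  with a b show ?thesis using that by blast
qed

lemma tb_in_span: "i \<in> idx \<Longrightarrow> i \<in> S \<Longrightarrow> tb i \<in> wd.span (tb ` (idx \<inter> S))"
  by (intro wd.span_base) auto

lemma T_in_span: "(L, m, n) \<in> S \<Longrightarrow> L \<in> half_nats \<or> L < 0 \<Longrightarrow> T L m n \<in> wd.span (tb ` (idx \<inter> S))"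
  using tb_in_span[of "(L, m, n)" S] wd.span_zero[of "tb ` (idx \<inter> S)"] weights_nonneg[of m L]
  by (cases "m \<in> weights L \<and> n \<in> weights L") (auto simp: idx_iff)

text \<open>The elements of degree \<open>d\<close>, when \<open>t\<^sup>\<lambda>\<^sub>m\<^sub>n\<close> is given the degree \<open>x m + y n\<close>. For \<open>x = y = d = 0\<close> this is the whole
  algebra, so multiplicativity of the grading contains closure under products.\<close>

definition graded :: "real \<Rightarrow> real \<Rightarrow> real \<Rightarrow> word_dual set" where
  "graded x y d = wd.span (tb ` (idx \<inter> {(L, m, n). x * m + y * n = d}))"

lemma half_nats_pred: "L \<in> half_nats \<Longrightarrow> L - 1 / 2 \<in> half_nats \<or> L - 1 / 2 < 0"
  using half_nats_iff half_ints_step by force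

lemma half_nats_suc: "L \<in> half_nats \<Longrightarrow> L + 1 / 2 \<in> half_nats"
  using half_nats_iff half_ints_step by force

lemma half_mult_graded:
  assumes "a \<in> {1 / 2, - 1 / 2}" "b \<in> {1 / 2, - 1 / 2}" "z \<in> graded x y d"
  shows "T (1 / 2) a b * z \<in> graded x y (x * a + y * b + d)"
  unfolding graded_def
proof (rule span_linear_into[OF wlinear_mult_left _ assms(3)[unfolded graded_def]])
  fix v assume "v \<in> tb ` (idx \<inter> {(L, m, n). x * m + y * n = d})"
  then obtain L m n where v: "v = T L m n" "(L, m, n) \<in> idx" "x * m + y * n = d" by auto
  show "T (1 / 2) a b * v \<in> wd.span (tb ` (idx \<inter> {(L, m, n). x * m + y * n = x * a + y * b + d}))"
    unfolding v(1) using v(2,3) half_nats_pred[of L] half_nats_suc[of L]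
    by (subst T_half_mult[OF _ assms(1,2)])
      (auto simp: idx_iff algebra_simps intro!: wd.span_add wd.span_scale T_in_span)
qed

text \<open>Induction on the spin of the left factor by \<open>T_step\<close>; associativity moves the new factor of spin \<open>1/2\<close>
  past the old one.\<close>

lemma T_mult_graded:
  assumes "L \<in> half_nats" "z \<in> graded x y d"
  shows "T L M N * z \<in> graded x y (x * M + y * N + d)"
proof (cases "M \<in> weights L \<and> N \<in> weights L")
  case True
  with assms show ?thesis
  proof (induction L arbitrary: M N z d rule: half_nats_induct)
    case zero
    then have "M = 0" "N = 0" by (auto simp: weights_iff elim!: Nats_cases)
    with zero show ?case by (simp add: T_0)
  next
    case (step L)
    obtain a b m n c e where *: "a \<in> {1 / 2, - 1 / 2}" "b \<in> {1 / 2, - 1 / 2}" "m \<in> weights L" "n \<in> weights L"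
      "M = a + m" "N = b + n"
      "T (L + 1 / 2) M N = wscale c (T (1 / 2) a b * T L m n) + wscale e (T (L - 1 / 2) M N)"
      using T_step[OF step.hyps] step.prems by metis
    have 1: "T (1 / 2) a b * (T L m n * z) \<in> graded x y (x * a + y * b + (x * m + y * n + d))"
      using * step by (intro half_mult_graded) auto
    have 2: "T (L - 1 / 2) M N * z \<in> graded x y (x * M + y * N + d)"
    proof (cases "M \<in> weights (L - 1 / 2) \<and> N \<in> weights (L - 1 / 2)")
      case True
      then have "0 \<le> L - 1 / 2" using weights_nonneg by blast
      with True show ?thesis using step by auto
    qed (auto simp: graded_def wd.span_zero)
    have e: "x * a + y * b + (x * m + y * n + d) = x * M + y * N + d"
      unfolding *(5,6) by (simp add: algebra_simps)
    have "T (L + 1 / 2) M N * z = wscale c (T (1 / 2) a b * (T L m n * z)) + wscale e (T (L - 1 / 2) M N * z)"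
      unfolding *(7) by (simp add: distrib_right mult.assoc)
    then show ?case using 1 2 unfolding e graded_def by (auto intro: wd.span_add wd.span_scale)
  qed
qed (auto simp: graded_def wd.span_zero)

lemma graded_mult:
  assumes "a \<in> graded x y d" "b \<in> graded x y e"
  shows "a * b \<in> graded x y (d + e)"
proof -
  have "a * b \<in> wd.span (tb ` (idx \<inter> {(L, m, n). x * m + y * n = d + e}))"
    using T_mult_graded[OF _ assms(2)]
    by (intro span_linear_into[OF wlinear_mult_right _ assms(1)[unfolded graded_def]])
      (fastforce simp: idx_iff graded_def)
  then show ?thesis by (simp add: graded_def)
qed

lemma graded_trivial: "graded 0 0 0 = SU"
  unfolding graded_def by (rule arg_cong[where f = wd.span]) auto

lemma graded_subset: "graded x y d \<subseteq> SU"
  unfolding graded_def by (intro wd.span_mono) auto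

lemma SU_mult: "a \<in> SU \<Longrightarrow> b \<in> SU \<Longrightarrow> a * b \<in> SU"
  using graded_mult[of a 0 0 0 b 0] by (simp add: graded_trivial)

lemma T_in_SU: "L \<in> half_nats \<Longrightarrow> T L m n \<in> SU"
  using T_in_span[of L m n UNIV] by simp

lemma zero_in_half_nats [simp]: "0 \<in> half_nats"
  unfolding half_nats_def by (auto intro: exI[of _ 0])

lemma half_in_half_nats [simp]: "1 / 2 \<in> half_nats"
  unfolding half_nats_def by (auto intro: exI[of _ 1])

lemma one_in_SU: "1 \<in> SU"
  using T_in_SU[of 0 0 0] by (simp add: T_0)

text \<open>Induction over the algebra generated by the coefficients of spin one half. It is the form in which
  generation by \<open>\<alpha>\<close>, \<open>\<beta>\<close> and their adjoints is used.\<close>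

lemma SU_algebra_induct [consumes 1, case_names one gen add scale mult]:
  assumes "x \<in> SU" and one: "P 1"
    and half: "\<And>a b. a \<in> {1 / 2, - 1 / 2} \<Longrightarrow> b \<in> {1 / 2, - 1 / 2} \<Longrightarrow> P (T (1 / 2) a b)"
    and add: "\<And>x y. x \<in> SU \<Longrightarrow> y \<in> SU \<Longrightarrow> P x \<Longrightarrow> P y \<Longrightarrow> P (x + y)"
    and scale: "\<And>c x. x \<in> SU \<Longrightarrow> P x \<Longrightarrow> P (wscale c x)"
    and mult: "\<And>x y. x \<in> SU \<Longrightarrow> y \<in> SU \<Longrightarrow> P x \<Longrightarrow> P y \<Longrightarrow> P (x * y)"
  shows "P x"
proof -
  have P0: "P 0" using scale[OF one_in_SU one, of 0] by simp
  have PT: "P (T L m n)" if "L \<in> half_nats" for L m n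
    using that
  proof (induction L arbitrary: m n rule: half_nats_induct)
    case zero
    have "m = 0 \<and> n = 0 \<or> T 0 m n = 0"
      by (cases "m \<in> weights 0 \<and> n \<in> weights 0") (auto simp: weights_iff elim!: Nats_cases)
    then show ?case using one P0 by (auto simp: T_0)
  next
    case (step L)
    show ?case
    proof (cases "m \<in> weights (L + 1 / 2) \<and> n \<in> weights (L + 1 / 2)")
      case True
      then obtain a b m' n' c d where *: "a \<in> {1 / 2, - 1 / 2}" "b \<in> {1 / 2, - 1 / 2}"
        "T (L + 1 / 2) m n = wscale c (T (1 / 2) a b * T L m' n') + wscale d (T (L - 1 / 2) m n)"
        using T_step[OF step.hyps, of m n] by metis
      have "P (T (L - 1 / 2) m n) \<and> T (L - 1 / 2) m n \<in> SU"
      proof (cases "m \<in> weights (L - 1 / 2)")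
        case True
        then have "0 \<le> L - 1 / 2" using weights_nonneg by blast
        then show ?thesis using step half_nats_pred[of L] T_in_SU[of "L - 1 / 2"] by auto
      qed (simp add: P0 wd.span_zero)
      moreover have "P (T (1 / 2) a b * T L m' n')" "T (1 / 2) a b * T L m' n' \<in> SU"
        using *(1,2) step by (auto intro!: mult half T_in_SU SU_mult)
      ultimately show ?thesis unfolding *(3) by (intro add scale wd.span_scale) auto
    qed (use P0 in auto)
  qed
  have "x \<in> SU \<and> P x" using assms(1)
  proof (rule wd.span_induct)
    show "wd.subspace {x. x \<in> SU \<and> P x}"
      using P0 by (intro wd.subspaceI) (auto intro: add scale wd.span_add wd.span_scale wd.span_zero)
  next
    fix x assume "x \<in> tb ` idx"
    then show "x \<in> SU \<and> P x" using PT by (auto simp: idx_iff intro: T_in_SU)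
  qed
  then show ?thesis ..
qed

lemma ladder_nonzero:
  assumes "n \<in> weights L" "n + 1 \<in> weights L"
  shows "ladder L n > 0"
  using weights_bounds[OF assms(1)] weights_bounds[OF assms(2)] unfolding ladder_rq
  by (intro mult_pos_pos real_sqrt_gt_zero qnum_pos) auto

text \<open>Translations connect any coefficient of a row to the diagonal one through nonzero ladder factors, and
  the diagonal one has the value \<open>1\<close> on the empty word.\<close>

lemma T_nonzero:
  assumes "L \<in> half_nats" "m \<in> weights L" "n \<in> weights L"
  shows "T L m n \<noteq> 0"
proof
  assume z: "T L m n = 0"
  have Li: "L \<in> half_ints" using assms(1) half_nats_iff by blast
  have up: "T L m (n + 1) = 0" if "T L m n = 0" "n \<in> weights L" for n
  proof (cases "n + 1 \<in> weights L")
    case True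
    then show ?thesis using rshift_T(1)[OF Li, of m n] that ladder_nonzero[OF that(2) True] by simp
  qed simp
  have down: "T L m (n - 1) = 0" if "T L m n = 0" "n \<in> weights L" for n
  proof (cases "n - 1 \<in> weights L")
    case True
    then show ?thesis using rshift_T(2)[OF Li, of m n] that ladder_nonzero[OF True] by simp
  qed simp
  have ups: "T L m (n + real i) = 0" for i
  proof (induction i)
    case (Suc i)
    show ?case
    proof (cases "n + real (Suc i) \<in> weights L")
      case True
      then have "n + real i \<in> weights L" using assms(3)
        by (auto simp: weights_iff add.assoc[symmetric])
      from up[OF Suc this] show ?thesis by (simp add: algebra_simps)
    qed simp
  qed (simp add: z)
  have downs: "T L m (n - real i) = 0" for i
  proof (induction i)
    case (Suc i)
    show ?case
    proof (cases "n - real (Suc i) \<in> weights L")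
      case True
      then have "L + (n - real (Suc i)) + 1 \<in> \<nat>" unfolding weights_iff by (metis Nats_1 Nats_add)
      moreover have "L + (n - real (Suc i)) + 1 = L + (n - real i)" by simp
      ultimately have "n - real i \<in> weights L" using assms(3) by (simp add: weights_iff)
      from down[OF Suc this] show ?thesis by (simp add: algebra_simps)
    qed simp
  qed (simp add: z)
  obtain i j where "L + m = real i" "L + n = real j"
    using assms by (auto simp: weights_iff elim!: Nats_cases)
  then have "m = n + real (i - j) \<or> m = n - real (j - i)"
    by (cases "j \<le> i") (auto simp: of_nat_diff)
  then have "T L m m = 0" using ups downs by metis
  then have "wval (T L m m) [] = 0" by simp
  then show False using assms by (simp add: wval_T_Nil)
qed

text \<open>The product is, up to a positive factor and a term that depends on \<open>n\<close> only, equal to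
  \<open>q\<^sup>x + q\<^sup>-\<^sup>x\<close> at \<open>x = 2 L + 1\<close>, which is the eigenvalue of the Casimir element up to normalisation.\<close>

lemma qnum_product_less:
  assumes "0 \<le> L" "L < L'"
  shows "qnum q (L - n) * qnum q (L + n + 1) < qnum q (L' - n) * qnum q (L' + n + 1)"
proof -
  define D where "D = (q - 1 / q) * (q - 1 / q)"
  have D: "D > 0" using qnum_denominator[OF q_pos q_less_1] by (simp add: D_def mult_neg_neg)
  define b where "b = q powr (2 * n + 1)"
  have prod: "qnum q (L - n) * qnum q (L + n + 1) = (q powr (2 * L + 1) + 1 / q powr (2 * L + 1) - b - 1 / b) / D" for L
  proof -
    have "(q powr (L - n) - q powr (- (L - n))) * (q powr (L + n + 1) - q powr (- (L + n + 1)))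
      = q powr (2 * L + 1) + q powr (- (2 * L + 1)) - q powr (2 * n + 1) - q powr (- (2 * n + 1))"
      by (simp add: algebra_simps flip: powr_add)
    moreover have "q powr (- (2 * L + 1)) = 1 / q powr (2 * L + 1)" "q powr (- (2 * n + 1)) = 1 / q powr (2 * n + 1)"
      by (simp_all only: powr_minus_divide)
    ultimately show ?thesis unfolding qnum_def D_def b_def times_divide_times_eq by (simp only:)
  qed
  define a a' where "a = q powr (2 * L + 1)" and "a' = q powr (2 * L' + 1)"
  have a: "0 < a'" "a' < a" "a < 1"
    unfolding a_def a'_def using q_pos q_less_1 assms powr_less_mono'[of q 0 "2 * L + 1"]
    by (auto intro: powr_less_mono')
  have "a' * a < 1 * 1" using a by (intro mult_strict_mono) auto
  then have "0 < (a - a') * (1 / (a * a') - 1)" using a by (intro mult_pos_pos) (auto simp: field_simps)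
  also have "\<dots> = (a' + 1 / a') - (a + 1 / a)" using a by (simp add: field_simps)
  finally have "a + 1 / a < a' + 1 / a'" by simp
  then show ?thesis unfolding prod a_def[symmetric] a'_def[symmetric] using D
    by (intro divide_strict_right_mono) auto
qed

lemma ladder_square:
  assumes "0 \<le> L - n" "0 \<le> L + n + 1"
  shows "ladder L n * ladder L n = qnum q (L - n) * qnum q (L + n + 1)"
  using assms unfolding ladder_def
  by (intro real_sqrt_mult_self[THEN trans, OF abs_of_nonneg] mult_nonneg_nonneg qnum_nonneg') auto

lemma powr_q_inj: "q powr x = q powr y \<longleftrightarrow> x = y"
  using q_pos q_less_1 powr_inj[of q x y] by auto

text \<open>Left and right translation by \<open>K\<close> separate the weights, and translation by \<open>f e\<close> separates the spins
  with given weights.\<close>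

lemma tb_independent:
  assumes "finite F" "F \<subseteq> idx" "(\<Sum>i\<in>F. wscale (c i) (tb i)) = 0" "i \<in> F"
  shows "c i = 0"
proof (rule eigenvectors_independent[OF _ _ assms])
  fix i assume "i \<in> idx"
  then show "tb i \<noteq> 0" using T_nonzero by (cases i) (simp add: idx_iff)
next
  fix i j assume ij: "i \<in> idx" "j \<in> idx" "i \<noteq> j"
  obtain L m n L' m' n' where i: "i = (L, m, n)" and j: "j = (L', m', n')" by (cases i; cases j)
  let ?goal = "\<exists>f ev. wlinear f \<and> (\<forall>k\<in>idx. f (tb k) = wscale (ev k) (tb k)) \<and> ev i \<noteq> ev j"
  have I: "L \<in> half_ints" if "(L, m, n) \<in> idx" for L m n
    using that half_nats_iff by (simp add: idx_iff)
  have m: ?goal if "m \<noteq> m'"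
  proof (intro exI conjI ballI)
    show "wlinear (lshift GK)" by (rule wlinear_shift)
    show "lshift GK (tb k) = wscale (of_real (q powr (fst (snd k)))) (tb k)" if "k \<in> idx" for k
      using that I by (cases k) (simp add: lshift_T)
    show "complex_of_real (q powr (fst (snd i))) \<noteq> of_real (q powr (fst (snd j)))"
      using that by (simp only: of_real_eq_iff powr_q_inj i j fst_conv snd_conv not_False_eq_True)
  qed
  have n: ?goal if "n \<noteq> n'"
  proof (intro exI conjI ballI)
    show "wlinear (rshift GK)" by (rule wlinear_shift)
    show "rshift GK (tb k) = wscale (of_real (q powr (snd (snd k)))) (tb k)" if "k \<in> idx" for k
      using that I by (cases k) (simp add: rshift_T)
    show "complex_of_real (q powr (snd (snd i))) \<noteq> of_real (q powr (snd (snd j)))"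
      using that by (simp only: of_real_eq_iff powr_q_inj i j fst_conv snd_conv not_False_eq_True)
  qed
  show ?goal
  proof (cases "m = m' \<and> n = n'")
    case True
    then have L: "L \<noteq> L'" using i j ij by auto
    have w: "L \<ge> 0" "L' \<ge> 0" "n \<in> weights L" "n \<in> weights L'"
      using ij i j True half_nats_iff by (auto simp: idx_iff)
    have b: "0 \<le> L - n" "0 \<le> L + n + 1" "0 \<le> L' - n" "0 \<le> L' + n + 1"
      using weights_bounds[OF w(3)] weights_bounds[OF w(4)] by simp_all
    have neq: "ladder L n * ladder L n \<noteq> ladder L' n * ladder L' n"
      unfolding ladder_square[OF b(1,2)] ladder_square[OF b(3,4)]
      using L w qnum_product_less[of L L' n] qnum_product_less[of L' L n] by (cases "L < L'") auto
    show ?goal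
    proof (intro exI conjI ballI)
      show "wlinear (\<lambda>x. rshift GF (rshift GE x))" by (rule wlinearI) simp_all
      show "rshift GF (rshift GE (tb k)) = wscale (of_real (ladder (fst k) (snd (snd k)) * ladder (fst k) (snd (snd k)))) (tb k)"
        if "k \<in> idx" for k
        using that I by (cases k) (simp add: rshift_T)
      show "complex_of_real (ladder (fst i) (snd (snd i)) * ladder (fst i) (snd (snd i)))
          \<noteq> of_real (ladder (fst j) (snd (snd j)) * ladder (fst j) (snd (snd j)))"
        using neq True by (simp only: of_real_eq_iff i j fst_conv snd_conv not_False_eq_True)
    qed
  qed (use m n in blast)
qed

lemma tb_inj: "inj_on tb idx"
proof (rule inj_onI, rule ccontr)
  fix i j assume ij: "i \<in> idx" "j \<in> idx" "tb i = tb j" "i \<noteq> j"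
  have "(\<Sum>k\<in>{i, j}. wscale (if k = i then 1 else - 1) (tb k)) = 0" using ij by simp
  from tb_independent[OF _ _ this, of i] ij show False by simp
qed

lemma wd_independent_tb: "wd.independent (tb ` idx)"
  unfolding wd.independent_explicit_module
proof (intro allI impI)
  fix t u v assume *: "finite t" "t \<subseteq> tb ` idx" "(\<Sum>v\<in>t. wscale (u v) v) = 0" "v \<in> t"
  obtain F where F: "F \<subseteq> idx" "t = tb ` F" using *(2) by (auto simp: subset_image_iff)
  have inj: "inj_on tb F" using tb_inj F(1) inj_on_subset by blast
  have "finite F" using *(1) F(2) inj finite_image_iff by blast
  moreover have "(\<Sum>i\<in>F. wscale (u (tb i)) (tb i)) = 0" using *(3) inj by (simp add: F sum.reindex)
  ultimately have "u (tb i) = 0" if "i \<in> F" for i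
    using tb_independent[of F "\<lambda>i. u (tb i)"] F(1) that by blast
  then show "u v = 0" using F(2) *(4) by blast
qed

section \<open>Multipliers\<close>

text \<open>Diagonal operators in the Peter-Weyl basis. The Haar state, the homogeneous components, the Dirac
  operator and the phase operator \<open>U\<close> are all of this form.\<close>

definition multiplier :: "(real \<times> real \<times> real \<Rightarrow> complex) \<Rightarrow> word_dual \<Rightarrow> word_dual" where
  "multiplier f = (SOME g. wlinear g \<and> (\<forall>i\<in>idx. g (tb i) = wscale (f i) (tb i)))"

lemma multiplier: "wlinear (multiplier f)" "i \<in> idx \<Longrightarrow> multiplier f (tb i) = wscale (f i) (tb i)"
proof -
  obtain g where g: "wlinear g" "\<forall>x\<in>tb ` idx. g x = wscale (f (inv_into idx tb x)) x"
    using wd.linear_independent_extend[OF wd_independent_tb, of "\<lambda>x. wscale (f (inv_into idx tb x)) x"] by blast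
  have "g (tb i) = wscale (f i) (tb i)" if "i \<in> idx" for i
    using g(2) that inv_into_f_f[OF tb_inj that] by (simp only: ball_simps image_eqI)
  then have "\<exists>g. wlinear g \<and> (\<forall>i\<in>idx. g (tb i) = wscale (f i) (tb i))"
    using g(1) by blast
  from someI_ex[OF this] show "wlinear (multiplier f)" "i \<in> idx \<Longrightarrow> multiplier f (tb i) = wscale (f i) (tb i)"
    unfolding multiplier_def by blast+
qed

lemmas multiplier_simps [simp] = wd.linear_add[OF multiplier(1)] wd.linear_scale[OF multiplier(1)] wd.linear_0[OF multiplier(1)]
  wd.linear_sum[OF multiplier(1)] wd.linear_diff[OF multiplier(1)]

lemma SU_linear_eq:
  assumes "wlinear f" "wlinear g" "\<And>i. i \<in> idx \<Longrightarrow> f (tb i) = g (tb i)" "x \<in> SU"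
  shows "f x = g x"
proof (rule wd.linear_eq_on_span[OF assms(1,2) _ assms(4)])
  fix y assume "y \<in> tb ` idx"
  then show "f y = g y" using assms(3) by (elim imageE) (simp only:)
qed

lemma SU_repr:
  assumes "x \<in> wd.span (tb ` (idx \<inter> S))"
  obtains F c where "finite F" "F \<subseteq> idx \<inter> S" "x = (\<Sum>i\<in>F. wscale (c i) (tb i))"
proof -
  obtain t r where *: "finite t" "t \<subseteq> tb ` (idx \<inter> S)" "x = (\<Sum>a\<in>t. wscale (r a) a)"
    using assms unfolding wd.span_explicit by blast
  obtain F where F: "F \<subseteq> idx \<inter> S" "t = tb ` F" using *(2) by (auto simp: subset_image_iff)
  have inj: "inj_on tb F" using tb_inj F(1) inj_on_subset by blast
  have "finite F" using *(1) F(2) inj finite_image_iff by blast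
  moreover have "x = (\<Sum>i\<in>F. wscale (r (tb i)) (tb i))"
    unfolding *(3) F(2) by (subst sum.reindex[OF inj]) (simp only: comp_def)
  ultimately show ?thesis using that[OF _ F(1)] by simp
qed

lemma multiplier_multiplier:
  assumes "x \<in> SU"
  shows "multiplier f (multiplier g x) = multiplier (\<lambda>i. g i * f i) x"
proof (rule SU_linear_eq[of "\<lambda>x. multiplier f (multiplier g x)", OF _ multiplier(1) _ assms])
  show "wlinear (\<lambda>x. multiplier f (multiplier g x))" by (rule wlinearI) simp_all
  show "multiplier f (multiplier g (tb i)) = multiplier (\<lambda>i. g i * f i) (tb i)" if "i \<in> idx" for i
    using multiplier(2)[OF that] by simp
qed

lemma multiplier_cong: "x \<in> SU \<Longrightarrow> (\<And>i. i \<in> idx \<Longrightarrow> f i = g i) \<Longrightarrow> multiplier f x = multiplier g x"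
  by (rule SU_linear_eq[OF multiplier(1) multiplier(1)]) (simp_all only: multiplier(2))

lemma multiplier_const: "x \<in> SU \<Longrightarrow> multiplier (\<lambda>i. c) x = wscale c x"
  by (rule SU_linear_eq[OF multiplier(1) wd.linear_scale_self]) (simp_all only: multiplier(2))

lemma multiplier_in_span:
  assumes "x \<in> wd.span (tb ` (idx \<inter> S))"
  shows "multiplier f x \<in> wd.span (tb ` (idx \<inter> S))"
proof (rule span_linear_into[OF multiplier(1) _ assms])
  fix b assume "b \<in> tb ` (idx \<inter> S)"
  then obtain i where "i \<in> idx" "b = tb i" by blast
  then show "multiplier f b \<in> wd.span (tb ` (idx \<inter> S))"
    using \<open>b \<in> _\<close> by (simp only: multiplier(2) wd.span_scale wd.span_base)
qed

lemma multiplier_SU: "x \<in> SU \<Longrightarrow> multiplier f x \<in> SU"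
  using multiplier_in_span[of x UNIV] by simp


section \<open>The involution on matrix coefficients\<close>

text \<open>The factor \<open>(-q)\<^sup>x\<close> for integral \<open>x\<close>, written for a real argument since weights are real numbers.\<close>

definition star_sign :: "real \<Rightarrow> complex" where
  "star_sign x = (- of_real q) powi \<lfloor>x\<rfloor>"

lemma star_sign_0 [simp]: "star_sign 0 = 1"
  by (simp add: star_sign_def)

lemma star_sign_step: "star_sign (x + 1) = - of_real q * star_sign x" "star_sign (x - 1) = - (1 / of_real q) * star_sign x"
proof -
  have s: "star_sign (y + 1) = - of_real q * star_sign y" for y
    using q_pos by (simp add: star_sign_def power_int_add_1)
  show "star_sign (x + 1) = - of_real q * star_sign x" by (rule s)
  show "star_sign (x - 1) = - (1 / of_real q) * star_sign x" using s[of "x - 1"] q_pos by simp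
qed

lemma weights_uminus:
  assumes "L \<in> half_nats" "m \<in> weights L"
  shows "- m \<in> weights L"
proof -
  obtain i where i: "L + m = real i" "m \<le> L"
    using assms(2) by (auto simp: weights_iff elim!: Nats_cases)
  obtain j where "L = real j / 2" using assms(1) by (auto simp: half_nats_def)
  with i have "L - m = real (j - i)" "- m \<le> L" by (auto simp: of_nat_diff)
  then show ?thesis by (simp add: weights_iff)
qed

lemma weights_uminus_iff: "L \<in> half_nats \<Longrightarrow> - m \<in> weights L \<longleftrightarrow> m \<in> weights L"
  using weights_uminus[of L m] weights_uminus[of L "- m"] by auto

lemma ladder_reflect: "ladder L (- n - 1) = ladder L n" "ladder L (- n) = ladder L (n - 1)"
  by (simp_all add: ladder_def mult.commute algebra_simps)

text \<open>The module of spin \<open>L\<close> is isomorphic to its conjugate by \<open>u\<^sub>m \<mapsto> (-q)\<^sup>m u\<^sub>-\<^sub>m\<close>, so adjoints of coefficients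
  are coefficients up to a factor.\<close>

lemma wstar_T:
  assumes L: "L \<in> half_nats"
  shows "wstar q (T L m n) = wscale (star_sign (n - m)) (T L (- m) (- n))"
proof (rule word_dual_eqI)
  have Li: "L \<in> half_ints" using L half_nats_iff by blast
  fix w show "wval (wstar q (T L m n)) w = wval (wscale (star_sign (n - m)) (T L (- m) (- n))) w"
  proof (induction w arbitrary: m)
    case Nil
    then show ?case using weights_uminus_iff[OF L] by (auto simp: wval_T_Nil)
  next
    case (Cons g w)
    have s: "star_sign (n - (m + 1)) = - (1 / of_real q) * star_sign (n - m)" "star_sign (n - (m - 1)) = - of_real q * star_sign (n - m)"
      using star_sign_step[of "n - m"] by (simp_all add: algebra_simps)
    have "wval (lshift g (wstar q (T L m n))) w = wval (wscale (star_sign (n - m)) (lshift g (T L (- m) (- n)))) w"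
      unfolding lshift_wstar using q_pos
      by (cases g) (simp_all add: lshift_T[OF Li] wstar_scale Cons ladder_reflect s del: wval_wstar wval_shift)
    then show ?case by simp
  qed
qed

lemma wstar_SU: "x \<in> SU \<Longrightarrow> wstar q x \<in> SU"
proof (induction rule: wd.span_induct_alt)
  case (step c x y)
  then obtain i where i: "i \<in> idx" "x = tb i" by blast
  obtain L m n where "i = (L, m, n)" by (cases i)
  with i have "wstar q x \<in> SU" by (simp add: idx_iff wstar_T wd.span_scale T_in_SU)
  with step show ?case by (simp add: wstar_add wstar_scale wd.span_add wd.span_scale)
qed (simp add: wd.span_zero)


section \<open>The Haar state\<close>

definition haar_part :: "word_dual \<Rightarrow> word_dual" where
  "haar_part = multiplier (\<lambda>i. if i = (0, 0, 0) then 1 else 0)"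

definition haar_val :: "word_dual \<Rightarrow> complex" where
  "haar_val x = wval (haar_part x) []"

lemma haar_val_linear [simp]: "haar_val (x + y) = haar_val x + haar_val y" "haar_val (wscale c x) = c * haar_val x" "haar_val 0 = 0"
  "haar_val (x - y) = haar_val x - haar_val y"
  by (simp_all add: haar_val_def haar_part_def)

lemma haar_val_sum [simp]: "haar_val (sum f A) = (\<Sum>x\<in>A. haar_val (f x))"
  by (simp add: haar_val_def haar_part_def)

lemma multiplier_T: "L \<in> half_ints \<Longrightarrow> multiplier f (T L m n) = wscale (f (L, m, n)) (T L m n)"
  using multiplier(2)[of "(L, m, n)" f] weights_nonneg[of m L] half_nats_iff[of L]
  by (cases "m \<in> weights L \<and> n \<in> weights L") (auto simp: idx_iff)

lemma haar_part_T: "L \<in> half_ints \<Longrightarrow> L \<noteq> 0 \<Longrightarrow> haar_part (T L m n) = 0"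
  by (simp add: haar_part_def multiplier_T)

lemma haar_part_1: "haar_part 1 = 1"
  using multiplier_T[of 0 _ 0 0] half_nats_iff[of 0] by (simp add: haar_part_def T_0)

lemma haar_val_1 [simp]: "haar_val 1 = 1"
  by (simp add: haar_val_def haar_part_1)

lemma haar_val_T: "L \<in> half_ints \<Longrightarrow> L \<noteq> 0 \<Longrightarrow> haar_val (T L m n) = 0"
  by (simp add: haar_val_def haar_part_T)

lemma rshift_one: "rshift g 1 = wscale (counit_gen g) 1"
  by (rule word_dual_eqI) simp

text \<open>Translations preserve the spin and act on spin \<open>0\<close> by the counit.\<close>

lemma haar_invariant:
  assumes "x \<in> SU"
  shows "haar_val (lshift g x) = counit_gen g * haar_val x" "haar_val (rshift g x) = counit_gen g * haar_val x"
proof -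
  have e: "haar_part (lshift g (tb i)) = wscale (counit_gen g) (haar_part (tb i))"
    "haar_part (rshift g (tb i)) = wscale (counit_gen g) (haar_part (tb i))" if i: "i \<in> idx" for i
  proof -
    obtain L m n where i': "i = (L, m, n)" by (cases i)
    have L: "L \<in> half_ints" "m \<in> weights L" "n \<in> weights L" using i half_nats_iff by (simp_all add: i' idx_iff)
    have sc: "haar_part (wscale c y) = wscale c (haar_part y)" for c y by (simp add: haar_part_def)
    have "haar_part (lshift g (T L m n)) = wscale (counit_gen g) (haar_part (T L m n)) \<and>
      haar_part (rshift g (T L m n)) = wscale (counit_gen g) (haar_part (T L m n))"
    proof (cases "L = 0")
      case True
      then have "m = 0" "n = 0" using L by (auto simp: weights_iff elim!: Nats_cases)
      then show ?thesis using True by (simp add: T_0 lshift_one rshift_one sc)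
    next
      case False
      then show ?thesis using L(1)
        by (cases g) (simp_all add: lshift_T rshift_T sc haar_part_T)
    qed
    then show "haar_part (lshift g (tb i)) = wscale (counit_gen g) (haar_part (tb i))"
      "haar_part (rshift g (tb i)) = wscale (counit_gen g) (haar_part (tb i))" by (simp_all add: i')
  qed
  have "haar_part (lshift g x) = wscale (counit_gen g) (haar_part x)"
    by (rule SU_linear_eq[where f = "\<lambda>x. haar_part (lshift g x)" and g = "\<lambda>x. wscale (counit_gen g) (haar_part x)"])
      (use e(1) assms in \<open>auto intro!: wlinearI simp: haar_part_def wd.scale_right_distrib mult.commute simp del: tb_simp\<close>)
  then show "haar_val (lshift g x) = counit_gen g * haar_val x" by (simp add: haar_val_def)
  have "haar_part (rshift g x) = wscale (counit_gen g) (haar_part x)"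
    by (rule SU_linear_eq[where f = "\<lambda>x. haar_part (rshift g x)" and g = "\<lambda>x. wscale (counit_gen g) (haar_part x)"])
      (use e(2) assms in \<open>auto intro!: wlinearI simp: haar_part_def wd.scale_right_distrib mult.commute simp del: tb_simp\<close>)
  then show "haar_val (rshift g x) = counit_gen g * haar_val x" by (simp add: haar_val_def)
qed

lemma haar_product_invariant:
  assumes "x \<in> SU" "y \<in> SU"
  shows "haar_val (lshift GE x * lshift GK y) + haar_val (lshift GKinv x * lshift GE y) = 0"
    "haar_val (lshift GK x * lshift GK y) = haar_val (x * y)"
    "haar_val (rshift GE x * rshift GK y) + haar_val (rshift GKinv x * rshift GE y) = 0"
    "haar_val (rshift GF x * rshift GK y) + haar_val (rshift GKinv x * rshift GF y) = 0"
    "haar_val (rshift GK x * rshift GK y) = haar_val (x * y)"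
  using haar_invariant(1)[OF SU_mult[OF assms], of GE] haar_invariant(1)[OF SU_mult[OF assms], of GK]
    haar_invariant(2)[OF SU_mult[OF assms], of GE] haar_invariant(2)[OF SU_mult[OF assms], of GK]
    haar_invariant(2)[OF SU_mult[OF assms], of GF]
  by (simp_all add: lshift_mult rshift_mult)

text \<open>Invariance under \<open>K\<close> multiplies the value by a power of \<open>q\<close> that differs from \<open>1\<close>.\<close>

lemma haar_weight_zero:
  assumes "L \<in> half_nats" "L' \<in> half_nats" "m + m' \<noteq> 0 \<or> n + n' \<noteq> 0"
  shows "haar_val (T L m n * T L' m' n') = 0"
proof -
  have Li: "L \<in> half_ints" "L' \<in> half_ints" using assms half_nats_iff by blast+
  note inv = haar_product_invariant[OF T_in_SU[OF assms(1)] T_in_SU[OF assms(2)]]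
  let ?h = "haar_val (T L m n * T L' m' n')"
  have 1: "of_real (q powr (m + m')) * ?h = ?h" "of_real (q powr (n + n')) * ?h = ?h"
    using inv(2)[of m n m' n'] inv(5)[of m n m' n']
    by (simp_all add: lshift_T[OF Li(1)] lshift_T[OF Li(2)] rshift_T[OF Li(1)] rshift_T[OF Li(2)] powr_add ac_simps)
  have "q powr x \<noteq> 1" if "x \<noteq> 0" for x using powr_q_inj[of x 0] that q_pos by simp
  then have "complex_of_real (q powr (m + m')) \<noteq> 1 \<or> complex_of_real (q powr (n + n')) \<noteq> 1"
    using assms(3) by (metis of_real_eq_1_iff)
  with 1 show ?thesis by (metis mult_cancel_right1)
qed

text \<open>Invariance under \<open>e\<close> and under \<open>f\<close> gives two linear relations between the values \<open>X\<close> and \<open>Y\<close> at neighbouring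
  weights. Their determinant is the difference of the squared ladder entries, which is nonzero for
  different spins.\<close>

lemma haar_spin_orthogonal:
  assumes L: "L \<in> half_nats" "L' \<in> half_nats" "L \<noteq> L'" and n: "n \<in> weights L" "n \<in> weights L'"
  shows "haar_val (T L (- m) (- n) * T L' m n) = 0"
proof -
  have Li: "L \<in> half_ints" "L' \<in> half_ints" using L half_nats_iff by blast+
  define X Y where "X = haar_val (T L (- m) (- n) * T L' m n)" and "Y = haar_val (T L (- m) (1 - n) * T L' m (n - 1))"
  define a b where "a = ladder L (n - 1)" and "b = ladder L' (n - 1)"
  have pw: "q powr (n - 1) = q powr n / q" "q powr (- (1 - n)) = q powr n / q"
    using q_pos by (simp_all add: powr_diff)
  have qn: "complex_of_real (q powr n) \<noteq> 0" "complex_of_real q \<noteq> 0" using q_pos by auto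
  note inv = haar_product_invariant[OF T_in_SU[OF L(1)] T_in_SU[OF L(2)]]
  have "of_real a * of_real (q powr (n - 1)) * Y + of_real (q powr n) * of_real b * X = 0"
    using inv(3)[of "- m" "- n" m "n - 1"]
    by (simp add: rshift_T[OF Li(1)] rshift_T[OF Li(2)] ladder_reflect X_def Y_def a_def b_def ac_simps)
  then have "of_real (q powr n) * (of_real a * Y + of_real q * of_real b * X) = 0"
    unfolding pw using qn by (simp add: field_simps)
  then have 1: "of_real a * Y + of_real q * of_real b * X = 0" using qn by simp
  have "of_real a * of_real (q powr n) * X + of_real (q powr (- (1 - n))) * of_real b * Y = 0"
    using inv(4)[of "- m" "1 - n" m n]
    by (simp add: rshift_T[OF Li(1)] rshift_T[OF Li(2)] ladder_reflect X_def Y_def a_def b_def ac_simps)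
  then have "of_real (q powr n) * (of_real q * of_real a * X + of_real b * Y) = 0"
    unfolding pw using qn by (simp add: field_simps)
  then have 2: "of_real q * of_real a * X + of_real b * Y = 0" using qn by simp
  have "of_real q * (of_real (a * a) - of_real (b * b)) * X =
      of_real a * (of_real q * of_real a * X + of_real b * Y) - of_real b * (of_real a * Y + of_real q * of_real b * X)"
    by (simp add: algebra_simps)
  then have "of_real q * (of_real (a * a) - of_real (b * b)) * X = 0" using 1 2 by simp
  moreover have "a * a \<noteq> b * b"
  proof -
    have "a * a = qnum q (L - (n - 1)) * qnum q (L + (n - 1) + 1)" "b * b = qnum q (L' - (n - 1)) * qnum q (L' + (n - 1) + 1)"
      unfolding a_def b_def using weights_bounds[OF n(1)] weights_bounds[OF n(2)] by (simp_all add: ladder_square)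
    then show ?thesis
      using qnum_product_less[of L L' "n - 1"] qnum_product_less[of L' L "n - 1"] L half_nats_iff
      by (cases "L < L'") force+
  qed
  then have "complex_of_real (a * a) - of_real (b * b) \<noteq> 0" by (simp only: right_minus_eq of_real_eq_iff not_False_eq_True)
  ultimately show ?thesis using qn unfolding X_def by (simp only: mult_eq_0_iff) blast
qed

definition ip :: "word_dual \<Rightarrow> word_dual \<Rightarrow> complex" where
  "ip x y = haar_val (wstar q x * y)"

lemma ip_orthogonal:
  assumes "i \<in> idx" "j \<in> idx" "i \<noteq> j"
  shows "ip (tb i) (tb j) = 0"
proof -
  obtain L m n L' m' n' where ij: "i = (L, m, n)" "j = (L', m', n')" by (cases i; cases j)
  have L: "L \<in> half_nats" "L' \<in> half_nats" "n \<in> weights L" "n' \<in> weights L'"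
    using assms by (simp_all add: ij idx_iff)
  have "haar_val (T L (- m) (- n) * T L' m' n') = 0"
  proof (cases "m = m' \<and> n = n'")
    case True
    then have "L \<noteq> L'" using assms ij by simp
    with True haar_spin_orthogonal[OF L(1,2)] L show ?thesis by simp
  next
    case False
    then show ?thesis using haar_weight_zero[OF L(1,2), of "- m" m' "- n" n'] by auto
  qed
  then show ?thesis using L by (simp add: ip_def ij wstar_T)
qed

text \<open>Summation by shift over the weights, for terms that vanish at both ends.\<close>

lemma sum_weights_shift:
  fixes g :: "real \<Rightarrow> 'b::comm_monoid_add"
  assumes "\<And>j. j \<notin> weights L \<Longrightarrow> g j = 0" "\<And>j. j + 1 \<notin> weights L \<Longrightarrow> g j = 0"
  shows "(\<Sum>k\<in>weights L. g (k - 1)) = (\<Sum>k\<in>weights L. g k)"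
proof -
  have "(\<Sum>k\<in>weights L. g (k - 1)) = (\<Sum>j\<in>(\<lambda>k. k - 1) ` weights L. g j)"
    by (subst sum.reindex) (auto intro!: inj_onI)
  also have "\<dots> = (\<Sum>j\<in>(\<lambda>k. k - 1) ` weights L \<union> weights L. g j)"
  proof (rule sum.mono_neutral_left)
    show "\<forall>j\<in>(\<lambda>k. k - 1) ` weights L \<union> weights L - (\<lambda>k. k - 1) ` weights L. g j = 0"
    proof
      fix j assume j: "j \<in> (\<lambda>k. k - 1) ` weights L \<union> weights L - (\<lambda>k. k - 1) ` weights L"
      have "j + 1 \<notin> weights L"
      proof
        assume "j + 1 \<in> weights L"
        then have "j + 1 - 1 \<in> (\<lambda>k. k - 1) ` weights L" by (rule imageI)
        with j show False by simp
      qed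
      then show "g j = 0" by (rule assms(2))
    qed
  qed (auto simp: finite_weights)
  also have "\<dots> = (\<Sum>k\<in>weights L. g k)"
    using assms(1) by (intro sum.mono_neutral_right) (auto simp: finite_weights)
  finally show ?thesis .
qed

text \<open>The sum is left invariant: under translation by \<open>e\<close> and \<open>f\<close> its terms cancel in a telescoping way. So it
  is a multiple of the unit, and its value on the empty word is \<open>1\<close>.\<close>

lemma T_column_unitary:
  assumes L: "L \<in> half_nats" and n: "n \<in> weights L"
  shows "(\<Sum>k\<in>weights L. wstar q (T L k n) * T L k n) = 1"
proof -
  have Li: "L \<in> half_ints" using L half_nats_iff by blast
  define F where "F = (\<Sum>k\<in>weights L. wscale (star_sign (n - k)) (T L (- k) (- n) * T L k n))"
  have F: "(\<Sum>k\<in>weights L. wstar q (T L k n) * T L k n) = F"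
    by (simp add: F_def wstar_T[OF L])
  have s: "star_sign (n - (k + 1)) = - (1 / of_real q) * star_sign (n - k)" "star_sign (n - (k - 1)) = - of_real q * star_sign (n - k)" for k
    using star_sign_step[of "n - k"] by (simp_all add: algebra_simps)
  have p: "q powr (k - 1) = q powr k / q" "q powr (k + 1) = q * q powr k" for k
    using q_pos by (simp_all add: powr_diff powr_add)
  have pp: "q powr (- k) * q powr k = 1" for k using q_pos by (simp flip: powr_add)
  have "lshift GE F = 0"
  proof -
    define g where "g k = wscale (star_sign (n - k) * of_real (q powr k * ladder L k)) (T L (- k - 1) (- n) * T L k n)" for k
    have "lshift GE F = (\<Sum>k\<in>weights L. g k - g (k - 1))"
      unfolding F_def shift_linear_simps g_def s p
      using q_pos by (intro sum.cong refl)
        (simp add: lshift_mult lshift_T[OF Li] ladder_reflect wd.scale_right_distrib ac_simps)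
    also have "\<dots> = 0"
    proof -
      have "(\<Sum>k\<in>weights L. g (k - 1)) = (\<Sum>k\<in>weights L. g k)"
      proof (rule sum_weights_shift)
        fix j assume "j + 1 \<notin> weights L"
        then have "ladder L j = 0 \<or> T L j n = 0" using ladder_top[OF Li] by (cases "j \<in> weights L") auto
        then show "g j = 0" by (auto simp: g_def)
      qed (simp add: g_def)
      then show ?thesis by (simp add: sum_subtractf)
    qed
    finally show ?thesis .
  qed
  moreover have "lshift GF F = 0"
  proof -
    define g where "g k = wscale (star_sign (n - k) * of_real (q powr k * ladder L k)) (T L (- k) (- n) * T L (k + 1) n)" for k
    have "lshift GF F = (\<Sum>k\<in>weights L. g k - g (k - 1))"
      unfolding F_def shift_linear_simps g_def s p
      using q_pos by (intro sum.cong refl)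
        (simp add: lshift_mult lshift_T[OF Li] ladder_reflect wd.scale_right_distrib ac_simps)
    also have "\<dots> = 0"
    proof -
      have "(\<Sum>k\<in>weights L. g (k - 1)) = (\<Sum>k\<in>weights L. g k)"
      proof (rule sum_weights_shift)
        fix j assume "j \<notin> weights L"
        then show "g j = 0" using weights_uminus_iff[OF L] by (simp add: g_def)
      qed (simp add: g_def)
      then show ?thesis by (simp add: sum_subtractf)
    qed
    finally show ?thesis .
  qed
  moreover have "lshift GK F = F" "lshift GKinv F = F"
    unfolding F_def shift_linear_simps using q_pos
    by (auto intro!: sum.cong simp: lshift_mult lshift_T[OF Li] powr_minus)
  ultimately have "lshift g F = wscale (counit_gen g) F" for g by (cases g) simp_all
  then have "F = wscale (wval F []) 1" by (rule lshift_invariant_imp_scalar)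
  moreover have "wval F [] = 1"
  proof -
    have "wval F [] = (\<Sum>k\<in>weights L. if k = n then 1 else 0)"
      unfolding F_def using n weights_uminus_iff[OF L]
      by (auto intro!: sum.cong simp: wval_T_Nil)
    then show ?thesis using n finite_weights by simp
  qed
  ultimately show ?thesis using F by simp
qed

text \<open>Invariance under left translation by \<open>e\<close>, applied to coefficients of neighbouring rows.\<close>

lemma ip_T_step:
  assumes L: "L \<in> half_nats" and k: "k \<in> weights L" "k + 1 \<in> weights L"
  shows "ip (T L (k + 1) n) (T L (k + 1) n) = ip (T L k n) (T L k n) / of_real (q * q)"
proof -
  have Li: "L \<in> half_ints" using L half_nats_iff by blast
  define X Y where "X = haar_val (T L (- k) (- n) * T L k n)" and "Y = haar_val (T L (- k - 1) (- n) * T L (k + 1) n)"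
  have l: "ladder L k \<noteq> 0" using ladder_nonzero[OF k] by simp
  have qn: "complex_of_real (q powr k) \<noteq> 0" "complex_of_real q \<noteq> 0" using q_pos by auto
  have p: "q powr (k + 1) = q * q powr k" using q_pos by (simp add: powr_add)
  have "of_real (ladder L k) * of_real (q powr (k + 1)) * Y + of_real (q powr k) * of_real (ladder L k) * X = 0"
    using haar_product_invariant(1)[OF T_in_SU[OF L] T_in_SU[OF L], of "- k" "- n" "k + 1" n]
    by (simp add: lshift_T[OF Li] ladder_reflect X_def Y_def ac_simps)
  then have "of_real (ladder L k) * of_real (q powr k) * (of_real q * Y + X) = 0"
    unfolding p by (simp add: algebra_simps)
  then have "of_real q * Y + X = 0" using l qn by simp
  then have XY: "Y = - X / of_real q" using qn by (simp add: field_simps add_eq_0_iff)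
  have s: "star_sign (n - (k + 1)) = - (1 / of_real q) * star_sign (n - k)"
    using star_sign_step[of "n - k"] by (simp add: algebra_simps)
  have "ip (T L (k + 1) n) (T L (k + 1) n) = star_sign (n - (k + 1)) * Y"
    unfolding ip_def wstar_T[OF L] Y_def by simp
  also have "\<dots> = star_sign (n - k) * X / of_real (q * q)" unfolding s XY by simp
  also have "star_sign (n - k) * X = ip (T L k n) (T L k n)" by (simp add: ip_def wstar_T[OF L] X_def)
  finally show ?thesis .
qed

text \<open>By \<open>ip_T_step\<close> the squared norms in a column are positive multiples of each other, and by unitarity they
  add up to \<open>1\<close>. Hence all of them are positive.\<close>

lemma ip_T_positive:
  assumes L: "L \<in> half_nats" and m: "m \<in> weights L" and n: "n \<in> weights L"
  shows "\<exists>r>0. ip (T L m n) (T L m n) = of_real r"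
proof -
  define G where "G k = ip (T L k n) (T L k n)" for k
  have up: "- L + real i \<in> weights L \<Longrightarrow> G (- L + real i) = G (- L) * of_real (1 / (q * q) ^ i)" for i
  proof (induction i)
    case (Suc i)
    have w: "- L + real i \<in> weights L" using Suc.prems by (auto simp: weights_iff)
    have "G (- L + real i + 1) = G (- L + real i) / of_real (q * q)"
      unfolding G_def using Suc.prems by (intro ip_T_step[OF L w]) (simp add: ac_simps)
    then show ?case using Suc.IH[OF w] by (simp add: ac_simps)
  qed simp
  define r where "r k = 1 / (q * q) ^ nat \<lfloor>L + k\<rfloor>" for k
  have rpos: "r k > 0" for k using q_pos by (simp add: r_def)
  have Gr: "G k = G (- L) * of_real (r k)" if "k \<in> weights L" for k
  proof -
    have "L + k \<in> \<nat>" using that by (simp add: weights_iff)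
    then obtain i where "L + k = real i" by (rule Nats_cases)
    then have "k = - L + real i" "nat \<lfloor>L + k\<rfloor> = i" by simp_all
    then show ?thesis using up[of i] that by (simp add: r_def)
  qed
  \<comment> \<open>Unitarity fixes the one remaining constant.\<close>
  have "1 = (\<Sum>k\<in>weights L. G k)"
    using arg_cong[OF T_column_unitary[OF L n], of haar_val] by (simp add: G_def ip_def)
  also have "\<dots> = G (- L) * of_real (\<Sum>k\<in>weights L. r k)"
    using Gr by (simp add: sum_distrib_left)
  finally have 1: "G (- L) * of_real (\<Sum>k\<in>weights L. r k) = 1" by simp
  define R where "R = (\<Sum>k\<in>weights L. r k)"
  have R: "R > 0" unfolding R_def using rpos m finite_weights by (intro sum_pos) auto
  then have "G (- L) = of_real (1 / R)" using 1 unfolding R_def[symmetric] by (simp add: field_simps)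
  then have "G m = of_real (r m / R)" using Gr[OF m] by simp
  then show ?thesis using rpos R unfolding G_def by (intro exI[of _ "r m / R"]) simp
qed


section \<open>The inner product\<close>

definition coeff_norm_sq :: "real \<times> real \<times> real \<Rightarrow> real" where
  "coeff_norm_sq i = Re (ip (tb i) (tb i))"

lemma coeff_norm_sq_pos: "i \<in> idx \<Longrightarrow> coeff_norm_sq i > 0" and ip_tb_self: "i \<in> idx \<Longrightarrow> ip (tb i) (tb i) = of_real (coeff_norm_sq i)"
  using ip_T_positive by (cases i; force simp: coeff_norm_sq_def idx_iff)+

lemma ip_linear [simp]:
  "ip (x + y) z = ip x z + ip y z" "ip x (y + z) = ip x y + ip x z"
  "ip (wscale c x) y = cnj c * ip x y" "ip x (wscale c y) = c * ip x y"
  "ip 0 x = 0" "ip x 0 = 0" "ip x (y - z) = ip x y - ip x z"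
  by (simp_all add: ip_def wstar_add wstar_scale distrib_right distrib_left right_diff_distrib)

lemma ip_diff_left [simp]: "ip (x - y) z = ip x z - ip y z"
  using ip_linear(1)[of "x - y" y z] by simp

lemma ip_sum: "ip (sum f A) z = (\<Sum>x\<in>A. ip (f x) z)" "ip z (sum f A) = (\<Sum>x\<in>A. ip z (f x))"
  by (simp_all add: ip_def wstar_sum sum_distrib_left sum_distrib_right)

lemma ip_mult_left: "ip (a * x) y = ip x (wstar q a * y)"
  by (simp add: ip_def wstar_mult mult.assoc)

lemma ip_expand:
  assumes "finite F" "F \<subseteq> idx"
  shows "ip (\<Sum>i\<in>F. wscale (c i) (tb i)) (\<Sum>i\<in>F. wscale (d i) (tb i)) = (\<Sum>i\<in>F. cnj (c i) * d i * of_real (coeff_norm_sq i))"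
proof -
  have "ip (tb i) (\<Sum>j\<in>F. wscale (d j) (tb j)) = d i * of_real (coeff_norm_sq i)" if "i \<in> F" for i
  proof -
    have "ip (tb i) (\<Sum>j\<in>F. wscale (d j) (tb j)) = (\<Sum>j\<in>F. if j = i then d i * of_real (coeff_norm_sq i) else 0)"
      unfolding ip_sum
    proof (intro sum.cong refl)
      fix j assume "j \<in> F"
      then have "i \<in> idx" "j \<in> idx" using assms that by blast+
      then show "ip (tb i) (wscale (d j) (tb j)) = (if j = i then d i * of_real (coeff_norm_sq i) else 0)"
        using ip_orthogonal[of i j] ip_tb_self[of i] by (cases "j = i") simp_all
    qed
    then show ?thesis using assms that by simp
  qed
  then show ?thesis unfolding ip_sum(1) by (simp add: mult.assoc)
qed

lemma SU_repr2:
  assumes "x \<in> SU" "y \<in> SU"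
  obtains F c d where "finite F" "F \<subseteq> idx" "x = (\<Sum>i\<in>F. wscale (c i) (tb i))" "y = (\<Sum>i\<in>F. wscale (d i) (tb i))"
proof -
  obtain F c where 1: "finite F" "F \<subseteq> idx" "x = (\<Sum>i\<in>F. wscale (c i) (tb i))"
    using SU_repr[of x UNIV] assms by auto
  obtain G d where 2: "finite G" "G \<subseteq> idx" "y = (\<Sum>i\<in>G. wscale (d i) (tb i))"
    using SU_repr[of y UNIV] assms by auto
  have "x = (\<Sum>i\<in>F \<union> G. wscale (if i \<in> F then c i else 0) (tb i))"
    unfolding 1(3) using 1 2 by (intro sum.mono_neutral_cong_left) auto
  moreover have "y = (\<Sum>i\<in>F \<union> G. wscale (if i \<in> G then d i else 0) (tb i))"
    unfolding 2(3) using 1 2 by (intro sum.mono_neutral_cong_left) auto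
  ultimately show ?thesis using 1 2 that[of "F \<union> G"] by simp
qed

lemma ip_commute: "x \<in> SU \<Longrightarrow> y \<in> SU \<Longrightarrow> ip y x = cnj (ip x y)"
  by (erule SU_repr2, assumption) (simp add: ip_expand ac_simps)

definition norm_sq :: "word_dual \<Rightarrow> real" where
  "norm_sq x = Re (ip x x)"

lemma norm_sq_expand:
  assumes "finite F" "F \<subseteq> idx"
  shows "norm_sq (\<Sum>i\<in>F. wscale (c i) (tb i)) = (\<Sum>i\<in>F. (cmod (c i))\<^sup>2 * coeff_norm_sq i)"
proof -
  have "cnj z * z = of_real ((cmod z)\<^sup>2)" for z by (subst complex_norm_square) (simp add: mult.commute)
  then show ?thesis unfolding norm_sq_def ip_expand[OF assms] Re_sum
    by (intro sum.cong refl) (simp del: of_real_power flip: of_real_mult)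
qed

lemma norm_sq_nonneg:
  assumes "x \<in> SU"
  shows "0 \<le> norm_sq x"
proof -
  obtain F c where *: "finite F" "F \<subseteq> idx" "x = (\<Sum>i\<in>F. wscale (c i) (tb i))"
    using SU_repr2[OF assms assms] by metis
  have "0 \<le> (\<Sum>i\<in>F. (cmod (c i))\<^sup>2 * coeff_norm_sq i)"
  proof (rule sum_nonneg)
    fix i assume "i \<in> F"
    then have "coeff_norm_sq i > 0" using *(2) coeff_norm_sq_pos by blast
    then show "0 \<le> (cmod (c i))\<^sup>2 * coeff_norm_sq i" by simp
  qed
  then show ?thesis unfolding *(3) norm_sq_expand[OF *(1,2)] .
qed

lemma norm_sq_pos:
  assumes "x \<in> SU" "x \<noteq> 0"
  shows "0 < norm_sq x"
proof -
  obtain F c where *: "finite F" "F \<subseteq> idx" "x = (\<Sum>i\<in>F. wscale (c i) (tb i))"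
    using SU_repr2[OF assms(1) assms(1)] by metis
  obtain i where i: "i \<in> F" "c i \<noteq> 0"
  proof (rule ccontr)
    assume "\<not> thesis"
    then have "\<forall>i\<in>F. c i = 0" using that by blast
    then have "x = 0" unfolding *(3) by (intro sum.neutral) simp
    with assms(2) show False ..
  qed
  have w: "coeff_norm_sq i > 0" if "i \<in> F" for i using that *(2) coeff_norm_sq_pos by blast
  have "0 < (\<Sum>i\<in>F. (cmod (c i))\<^sup>2 * coeff_norm_sq i)"
  proof (rule sum_pos2[OF *(1) i(1)])
    show "0 < (cmod (c i))\<^sup>2 * coeff_norm_sq i" using i(2) w[OF i(1)] by simp
    show "0 \<le> (cmod (c i))\<^sup>2 * coeff_norm_sq i" if "i \<in> F" for i using w[OF that] by simp
  qed
  then show ?thesis unfolding *(3) norm_sq_expand[OF *(1,2)] .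
qed

lemma norm_sq_multiplier:
  assumes "x \<in> SU" "\<And>i. i \<in> idx \<Longrightarrow> cmod (f i) \<le> B"
  shows "norm_sq (multiplier f x) \<le> B\<^sup>2 * norm_sq x"
proof (rule SU_repr[of x UNIV])
  fix F c assume *: "finite F" "F \<subseteq> idx \<inter> UNIV" "x = (\<Sum>i\<in>F. wscale (c i) (tb i))"
  have "multiplier f x = (\<Sum>i\<in>F. wscale (c i * f i) (tb i))"
    unfolding *(3) multiplier_simps
  proof (intro sum.cong refl)
    fix i assume "i \<in> F"
    then have "i \<in> idx" using *(2) by blast
    then show "wscale (c i) (multiplier f (tb i)) = wscale (c i * f i) (tb i)" by (simp only: multiplier(2) wd.scale_scale)
  qed
  then have "norm_sq (multiplier f x) = (\<Sum>i\<in>F. (cmod (c i * f i))\<^sup>2 * coeff_norm_sq i)" using * by (simp add: norm_sq_expand)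
  also have "\<dots> \<le> (\<Sum>i\<in>F. B\<^sup>2 * ((cmod (c i))\<^sup>2 * coeff_norm_sq i))"
  proof (rule sum_mono)
    fix i assume "i \<in> F"
    then have i: "i \<in> idx" using *(2) by blast
    have "(cmod (f i))\<^sup>2 \<le> B\<^sup>2" using assms(2)[OF i] by (intro power_mono) auto
    then have "(cmod (f i))\<^sup>2 * ((cmod (c i))\<^sup>2 * coeff_norm_sq i) \<le> B\<^sup>2 * ((cmod (c i))\<^sup>2 * coeff_norm_sq i)"
      using coeff_norm_sq_pos[OF i] by (intro mult_right_mono) auto
    then show "(cmod (c i * f i))\<^sup>2 * coeff_norm_sq i \<le> B\<^sup>2 * ((cmod (c i))\<^sup>2 * coeff_norm_sq i)"
      by (simp add: norm_mult power_mult_distrib ac_simps)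
  qed
  also have "\<dots> = B\<^sup>2 * norm_sq x" using * by (simp add: norm_sq_expand sum_distrib_left)
  finally show "norm_sq (multiplier f x) \<le> B\<^sup>2 * norm_sq x" .
qed (use assms in simp)

lemma norm_sq_scale: "norm_sq (wscale c x) = (cmod c)\<^sup>2 * norm_sq x"
proof -
  have "cnj c * c = of_real ((cmod c)\<^sup>2)" by (subst complex_norm_square) (simp add: mult.commute)
  then have "ip (wscale c x) (wscale c x) = of_real ((cmod c)\<^sup>2) * ip x x"
    by (metis ip_linear(3,4) mult.assoc mult.commute)
  then show ?thesis by (simp only: norm_sq_def Re_complex_of_real times_complex.sel Im_complex_of_real) simp?
qed

text \<open>A substitute for the triangle inequality that follows from the parallelogram law alone; it
  suffices because only the existence of bounds is at stake.\<close>

lemma norm_sq_add: "x \<in> SU \<Longrightarrow> y \<in> SU \<Longrightarrow> norm_sq (x + y) \<le> 2 * norm_sq x + 2 * norm_sq y"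
  using norm_sq_nonneg[of "x - y"] by (simp add: norm_sq_def wd.span_diff)


section \<open>Bounded left multiplications and bounded commutators\<close>

text \<open>The constant bounds the square of the operator norm.\<close>

definition bounded_op :: "(word_dual \<Rightarrow> word_dual) \<Rightarrow> bool" where
  "bounded_op f \<longleftrightarrow> (\<exists>C\<ge>0. \<forall>x\<in>SU. f x \<in> SU \<and> norm_sq (f x) \<le> C * norm_sq x)"

lemma bounded_op_add: "bounded_op f \<Longrightarrow> bounded_op g \<Longrightarrow> bounded_op (\<lambda>x. f x + g x)"
  unfolding bounded_op_def
proof (elim exE conjE)
  fix C D assume *: "0 \<le> C" "0 \<le> D" "\<forall>x\<in>SU. f x \<in> SU \<and> norm_sq (f x) \<le> C * norm_sq x" "\<forall>x\<in>SU. g x \<in> SU \<and> norm_sq (g x) \<le> D * norm_sq x"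
  have "norm_sq (f x + g x) \<le> (2 * C + 2 * D) * norm_sq x" if "x \<in> SU" for x
    using norm_sq_add[of "f x" "g x"] * that by (force simp: algebra_simps)
  with * show "\<exists>C\<ge>0. \<forall>x\<in>SU. f x + g x \<in> SU \<and> norm_sq (f x + g x) \<le> C * norm_sq x"
    by (intro exI[of _ "2 * C + 2 * D"]) (auto intro: wd.span_add)
qed

lemma bounded_op_compose: "bounded_op f \<Longrightarrow> bounded_op g \<Longrightarrow> bounded_op (\<lambda>x. f (g x))"
  unfolding bounded_op_def
proof (elim exE conjE)
  fix C D assume *: "0 \<le> C" "0 \<le> D" "\<forall>x\<in>SU. f x \<in> SU \<and> norm_sq (f x) \<le> C * norm_sq x" "\<forall>x\<in>SU. g x \<in> SU \<and> norm_sq (g x) \<le> D * norm_sq x"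
  have "norm_sq (f (g x)) \<le> (C * D) * norm_sq x" if "x \<in> SU" for x
  proof -
    have "norm_sq (f (g x)) \<le> C * norm_sq (g x)" using * that by blast
    also have "\<dots> \<le> C * (D * norm_sq x)" using * that by (intro mult_left_mono) auto
    finally show ?thesis by (simp add: mult.assoc)
  qed
  with * show "\<exists>C\<ge>0. \<forall>x\<in>SU. f (g x) \<in> SU \<and> norm_sq (f (g x)) \<le> C * norm_sq x"
    by (intro exI[of _ "C * D"]) auto
qed

lemma bounded_op_scale: "bounded_op (wscale c)"
  unfolding bounded_op_def by (intro exI[of _ "(cmod c)\<^sup>2"]) (auto simp: norm_sq_scale wd.span_scale)

lemma bounded_op_multiplier: "(\<And>i. i \<in> idx \<Longrightarrow> cmod (f i) \<le> B) \<Longrightarrow> bounded_op (multiplier f)"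
  unfolding bounded_op_def by (intro exI[of _ "B\<^sup>2"]) (simp add: norm_sq_multiplier multiplier_SU)

text \<open>By \<open>T_column_unitary\<close>, the squared norms of \<open>t\<^sub>k\<^sub>n x\<close> over all \<open>k\<close> add up to that of \<open>x\<close>.\<close>

lemma bounded_op_T: "L \<in> half_nats \<Longrightarrow> bounded_op (\<lambda>x. T L m n * x)"
  unfolding bounded_op_def
proof (intro exI[of _ 1] conjI ballI)
  fix x assume L: "L \<in> half_nats" and x: "x \<in> SU"
  show "T L m n * x \<in> SU" using L x by (intro SU_mult T_in_SU)
  show "norm_sq (T L m n * x) \<le> 1 * norm_sq x"
  proof (cases "m \<in> weights L \<and> n \<in> weights L")
    case True
    have "norm_sq (T L m n * x) \<le> (\<Sum>k\<in>weights L. norm_sq (T L k n * x))"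
      using True L x finite_weights by (intro member_le_sum) (auto intro!: norm_sq_nonneg SU_mult T_in_SU)
    also have "\<dots> = Re (ip x ((\<Sum>k\<in>weights L. wstar q (T L k n) * T L k n) * x))"
      by (simp add: norm_sq_def ip_mult_left ip_sum sum_distrib_right mult.assoc)
    also have "\<dots> = 1 * norm_sq x" using True L by (simp add: T_column_unitary norm_sq_def)
    finally show ?thesis .
  qed (use x norm_sq_nonneg in \<open>auto simp: norm_sq_def\<close>)
qed simp

lemma bounded_op_cong: "(\<And>x. x \<in> SU \<Longrightarrow> f x = g x) \<Longrightarrow> bounded_op f \<longleftrightarrow> bounded_op g"
  by (simp add: bounded_op_def)

lemma bounded_op_left_mult:
  assumes "a \<in> SU"
  shows "bounded_op (\<lambda>x. a * x)"
  using assms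
proof (induction rule: SU_algebra_induct)
  case one
  show ?case using bounded_op_scale[of 1] by (simp add: bounded_op_def)
next
  case (gen a b)
  then show ?case by (simp add: bounded_op_T)
next
  case (add x y)
  then show ?case using bounded_op_add by (simp add: distrib_right)
next
  case (scale c x)
  then show ?case using bounded_op_compose[OF bounded_op_scale scale(2)] by simp
next
  case (mult x y)
  then show ?case using bounded_op_compose[OF mult(3,4)] by (simp add: mult.assoc)
qed

text \<open>The operator \<open>N\<close>: it multiplies coefficients of spin \<open>\<lambda>\<close> by \<open>\<lambda> + 1\<close>.\<close>

definition deg :: "word_dual \<Rightarrow> word_dual" where
  "deg = multiplier (\<lambda>i. of_real (fst i + 1))"

definition comm_deg :: "word_dual \<Rightarrow> word_dual \<Rightarrow> word_dual" where
  "comm_deg a x = deg (a * x) - a * deg x"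

lemma deg_linear [simp]: "deg (x + y) = deg x + deg y" "deg (wscale c x) = wscale c (deg x)"
  "deg 0 = 0" "deg (x - y) = deg x - deg y"
  by (simp_all add: deg_def)

text \<open>The symbol of the unitary \<open>U\<close>. Raising the spin by \<open>1/2\<close> multiplies it by \<open>\<i>\<close>, and lowering the spin
  divides it by \<open>\<i>\<close>.\<close>

definition phase :: "real \<times> real \<times> real \<Rightarrow> complex" where
  "phase i = \<i> powi \<lfloor>2 * fst i\<rfloor>"

text \<open>For a component of \<open>a x\<close> whose spin is by \<open>\<epsilon>/2\<close> larger than that of \<open>x\<close>, with \<open>\<epsilon> = \<plusminus>1\<close>, the commutator
  contributes the factor \<open>\<epsilon>/2\<close>, and the conjugation by \<open>U\<close> the factor \<open>\<epsilon>\<i>\<close>.\<close>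

lemma comm_deg_half:
  assumes a: "a \<in> {1 / 2, - 1 / 2}" and b: "b \<in> {1 / 2, - 1 / 2}" and x: "x \<in> SU"
  shows "comm_deg (T (1 / 2) a b) x =
    wscale (1 / (2 * \<i>)) (multiplier phase (T (1 / 2) a b * multiplier (\<lambda>i. inverse (phase i)) x))"
proof (rule SU_linear_eq[OF _ _ _ x])
  show "wlinear (comm_deg (T (1 / 2) a b))"
    by (rule wlinearI) (simp_all add: comm_deg_def distrib_left wd.scale_right_diff_distrib)
  show "wlinear (\<lambda>x. wscale (1 / (2 * \<i>)) (multiplier phase (T (1 / 2) a b * multiplier (\<lambda>i. inverse (phase i)) x)))"
    by (rule wlinearI) (simp_all add: distrib_left wd.scale_right_distrib mult.commute)
  fix i assume i: "i \<in> idx"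
  obtain L m n where i': "i = (L, m, n)" by (cases i)
  have L: "L \<in> half_nats" "L \<in> half_ints" "m \<in> weights L" "n \<in> weights L"
    using i half_nats_iff by (simp_all add: i' idx_iff)
  define P M where "P = T (L + 1 / 2) (a + m) (b + n)" and "M = T (L - 1 / 2) (a + m) (b + n)"
  define c d where "c = complex_of_real (cg_up L a m * cg_up L b n)" and "d = complex_of_real (cg_down L a m * cg_down L b n)"
  have prod: "T (1 / 2) a b * T L m n = wscale c P + wscale d M"
    unfolding P_def M_def c_def d_def by (rule T_half_mult[OF L(1) a b L(3,4)])
  have mP: "multiplier f P = wscale (f (L + 1 / 2, a + m, b + n)) P" for f
    unfolding P_def using L by (intro multiplier_T) simp
  have mM: "multiplier f M = wscale (f (L - 1 / 2, a + m, b + n)) M" for f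
    unfolding M_def using L by (intro multiplier_T) simp
  have "comm_deg (T (1 / 2) a b) (T L m n) = wscale (c * of_real (L + 3 / 2)) P + wscale (d * of_real (L + 1 / 2)) M
      - wscale (of_real (L + 1)) (wscale c P + wscale d M)"
    unfolding comm_deg_def deg_def multiplier_T[OF L(2)] prod wscale_mult_right multiplier_simps mP mM
    by (simp add: algebra_simps)
  also have "\<dots> = wscale (c / 2) P - wscale (d / 2) M"
  proof -
    have "of_real (L + 3 / 2) = of_real (L + 1) + (1 / 2 :: complex)" "of_real (L + 1 / 2) = of_real (L + 1) - (1 / 2 :: complex)"
      by simp_all
    then show ?thesis
      by (simp only: distrib_left right_diff_distrib wd.scale_right_distrib wd.scale_scale wd.scale_left_distrib
          wd.scale_left_diff_distrib) (simp add: mult.commute)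
  qed
  finally have 1: "comm_deg (T (1 / 2) a b) (T L m n) = wscale (c / 2) P - wscale (d / 2) M" .
  define p where "p = \<i> powi \<lfloor>2 * L\<rfloor>"
  have p0: "p \<noteq> 0" by (simp add: p_def)
  have ph: "phase (L, m, n) = p" "phase (L + 1 / 2, a + m, b + n) = p * \<i>" "phase (L - 1 / 2, a + m, b + n) = p / \<i>"
    by (simp_all add: phase_def p_def power_int_add power_int_diff algebra_simps)
  have "wscale (1 / (2 * \<i>)) (multiplier phase (T (1 / 2) a b * multiplier (\<lambda>i. inverse (phase i)) (T L m n))) =
      wscale (1 / (2 * \<i>)) (wscale (inverse p) (wscale c (wscale (p * \<i>) P) + wscale d (wscale (p / \<i>) M)))"
    unfolding multiplier_T[OF L(2)] wscale_mult_right prod multiplier_simps mP mM ph ..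
  also have "\<dots> = wscale (c / 2) P + wscale (- d / 2) M"
    unfolding wd.scale_right_distrib wd.scale_scale using p0
    by (intro arg_cong2[where f = "(+)"] arg_cong2[where f = wscale]) (simp_all add: field_simps)
  finally show "comm_deg (T (1 / 2) a b) (tb i) =
    wscale (1 / (2 * \<i>)) (multiplier phase (T (1 / 2) a b * multiplier (\<lambda>i. inverse (phase i)) (tb i)))"
    by (simp add: i' 1)
qed

text \<open>The commutator with \<open>N\<close> is a derivation, so boundedness passes from generators to products.\<close>

lemma bounded_op_comm_deg:
  assumes "a \<in> SU"
  shows "bounded_op (comm_deg a)"
  using assms
proof (induction rule: SU_algebra_induct)
  case one
  have "comm_deg 1 = (\<lambda>x. 0)" by (simp add: comm_deg_def fun_eq_iff)
  then show ?case using bounded_op_scale[of 0] by (simp add: wd.scale_zero_left[abs_def])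
next
  case (gen a b)
  have "cmod (phase i) \<le> 1" "cmod (inverse (phase i)) \<le> 1" for i
    by (simp_all add: phase_def norm_power_int norm_inverse)
  then have "bounded_op (\<lambda>x. wscale (1 / (2 * \<i>)) (multiplier phase (T (1 / 2) a b * multiplier (\<lambda>i. inverse (phase i)) x)))"
    by (intro bounded_op_compose[OF bounded_op_scale] bounded_op_compose[OF bounded_op_multiplier]
        bounded_op_compose[OF bounded_op_T] bounded_op_multiplier) auto
  then show ?case using bounded_op_cong[OF comm_deg_half[OF gen]] by simp
next
  case (add x y)
  have "comm_deg (x + y) = (\<lambda>z. comm_deg x z + comm_deg y z)"
    by (simp add: comm_deg_def fun_eq_iff algebra_simps)
  then show ?case using bounded_op_add[OF add(3,4)] by simp
next
  case (scale c x)
  have "comm_deg (wscale c x) = (\<lambda>z. wscale c (comm_deg x z))"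
    by (simp add: comm_deg_def fun_eq_iff wd.scale_right_diff_distrib)
  then show ?case using bounded_op_compose[OF bounded_op_scale scale(2)] by simp
next
  case (mult x y)
  have "comm_deg (x * y) = (\<lambda>z. comm_deg x (y * z) + x * comm_deg y z)"
    by (simp add: comm_deg_def fun_eq_iff algebra_simps)
  then show ?case
    using bounded_op_add[OF bounded_op_compose[OF mult(3) bounded_op_left_mult[OF mult(2)]]
      bounded_op_compose[OF bounded_op_left_mult[OF mult(1)] mult(4)]] by simp
qed

end


section \<open>Functionals on the free algebra\<close>

lemma keys_sum_add:
  fixes F :: "'w \<Rightarrow> complex \<Rightarrow> 'b::comm_monoid_add"
  assumes "\<And>w. F w 0 = 0" "\<And>w a b. F w (a + b) = F w a + F w b"
  shows "(\<Sum>w\<in>Poly_Mapping.keys (x + y). F w (Poly_Mapping.lookup (x + y) w)) =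
    (\<Sum>w\<in>Poly_Mapping.keys x. F w (Poly_Mapping.lookup x w)) + (\<Sum>w\<in>Poly_Mapping.keys y. F w (Poly_Mapping.lookup y w))"
proof -
  define S where "S = Poly_Mapping.keys x \<union> Poly_Mapping.keys y"
  have S: "finite S" "Poly_Mapping.keys x \<subseteq> S" "Poly_Mapping.keys y \<subseteq> S" "Poly_Mapping.keys (x + y) \<subseteq> S"
    using Poly_Mapping.keys_add[of x y] by (auto simp: S_def)
  have eq: "(\<Sum>w\<in>Poly_Mapping.keys z. F w (Poly_Mapping.lookup z w)) = (\<Sum>w\<in>S. F w (Poly_Mapping.lookup z w))"
    if "Poly_Mapping.keys z \<subseteq> S" for z
    using that S(1) assms(1) by (intro sum.mono_neutral_left) (auto simp: in_keys_iff)
  show ?thesis unfolding eq[OF S(2)] eq[OF S(3)] eq[OF S(4)]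
    by (simp add: lookup_add assms(2) sum.distrib)
qed

lemma keys_sum_single:
  assumes "F w 0 = 0"
  shows "(\<Sum>v\<in>Poly_Mapping.keys (Poly_Mapping.single w c). F v (Poly_Mapping.lookup (Poly_Mapping.single w c) v)) = F w c"
  using assms by (cases "c = 0") simp_all

text \<open>The isomorphism between functions on words and linear functionals on the free algebra, and its
  inverse.\<close>

definition of_wd :: "word_dual \<Rightarrow> functional" where
  "of_wd \<phi> x = (\<Sum>w\<in>Poly_Mapping.keys x. Poly_Mapping.lookup x w * wval \<phi> (letters w))"

definition to_wd :: "functional \<Rightarrow> word_dual" where
  "to_wd \<phi> = WD (\<lambda>w. \<phi> (Poly_Mapping.single (Word w) 1))"

lemma of_wd_plus: "of_wd \<phi> (x + y) = of_wd \<phi> x + of_wd \<phi> y"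
  unfolding of_wd_def by (rule keys_sum_add) (simp_all add: distrib_right)

lemma of_wd_single: "of_wd \<phi> (Poly_Mapping.single w c) = c * wval \<phi> (letters w)"
  unfolding of_wd_def by (rule keys_sum_single[where F = "\<lambda>w c. c * wval \<phi> (letters w)"]) simp

lemma to_wd_of_wd [simp]: "to_wd (of_wd \<phi>) = \<phi>"
  by (rule word_dual_eqI) (simp add: to_wd_def of_wd_single)

lemma of_wd_inj: "of_wd \<phi> = of_wd \<psi> \<longleftrightarrow> \<phi> = \<psi>"
  by (metis to_wd_of_wd)

lemma of_wd_add: "of_wd (\<phi> + \<psi>) = (\<lambda>x. of_wd \<phi> x + of_wd \<psi> x)"
  by (simp add: fun_eq_iff of_wd_def distrib_left sum.distrib)

lemma of_wd_scale: "of_wd (wscale c \<phi>) = (\<lambda>x. c * of_wd \<phi> x)"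
  by (simp add: fun_eq_iff of_wd_def sum_distrib_left ac_simps)

lemma of_wd_zero: "of_wd 0 = (\<lambda>x. 0)"
  by (simp add: fun_eq_iff of_wd_def)

lemma of_wd_sum: "of_wd (sum f A) = (\<lambda>x. \<Sum>a\<in>A. of_wd (f a) x)"
  by (induction A rule: infinite_finite_induct) (simp_all add: of_wd_zero of_wd_add)

text \<open>The value of the functional \<open>f \<otimes> g\<close> on an element of the tensor square of the free algebra.\<close>

definition pair_eval :: "(generator list \<Rightarrow> complex) \<Rightarrow> (generator list \<Rightarrow> complex) \<Rightarrow> free_alg2 \<Rightarrow> complex" where
  "pair_eval f g y = (\<Sum>p\<in>Poly_Mapping.keys y. Poly_Mapping.lookup y p * (f (letters (fst p)) * g (letters (snd p))))"

lemma pair_eval_add: "pair_eval f g (x + y) = pair_eval f g x + pair_eval f g y"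
  unfolding pair_eval_def by (rule keys_sum_add) (simp_all add: distrib_right)

lemma pair_eval_single: "pair_eval f g (Poly_Mapping.single (v, w) c) = c * (f (letters v) * g (letters w))"
  unfolding pair_eval_def
  by (subst keys_sum_single[where F = "\<lambda>p c. c * (f (letters (fst p)) * g (letters (snd p)))"]) simp_all

lemma pair_eval_single_mult:
  "pair_eval f g (Poly_Mapping.single (Word v, Word w) c * y) =
    c * pair_eval (\<lambda>u. f (v @ u)) (\<lambda>u. g (w @ u)) y"
proof (induction y rule: free_alg_induct)
  case (single p d)
  obtain a b where p: "p = (Word a, Word b)" by (cases p) (metis gen_word.exhaust)
  show ?case by (simp add: p mult_single plus_prod_def plus_gen_word_def pair_eval_single)
next
  case (add x y)
  then show ?case by (simp add: distrib_left pair_eval_add)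
qed

lemma const_pair: "(const c :: free_alg2) = Poly_Mapping.single (Word [], Word []) c"
  by (simp add: zero_prod_def zero_gen_word_def)

lemma pair_eval_coproduct_word: "pair_eval f g (prod_list (map coproduct_gen w)) = word_conv f g w"
proof (induction w arbitrary: f g)
  case Nil
  have "(1 :: free_alg2) = const 1" by simp
  then have one: "(1 :: free_alg2) = Poly_Mapping.single (Word [], Word []) 1" unfolding const_pair .
  show ?case unfolding list.map prod_list.Nil one pair_eval_single by simp
next
  case (Cons a w)
  show ?case
    by (cases a) (simp_all add: distrib_right pair_eval_add pair_eval_single_mult Cons)
qed

lemma coproduct_add: "coproduct (x + y) = coproduct x + coproduct y"
  unfolding coproduct_def by (rule keys_sum_add) (simp_all add: single_add distrib_right)

lemma coproduct_single:
  "coproduct (Poly_Mapping.single w c) = const c * prod_list (map coproduct_gen (letters w))"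
  unfolding coproduct_def
  by (rule keys_sum_single[where F = "\<lambda>w c. const c * prod_list (map coproduct_gen (letters w))"]) simp

lemma conv_of_wd: "conv (of_wd \<phi>) (of_wd \<psi>) = of_wd (\<phi> * \<psi>)"
proof
  have c: "conv (of_wd \<phi>) (of_wd \<psi>) x = pair_eval (wval \<phi>) (wval \<psi>) (coproduct x)" for x
    unfolding conv_def pair_eval_def of_wd_single by (intro sum.cong) (auto simp: case_prod_beta)
  fix x show "conv (of_wd \<phi>) (of_wd \<psi>) x = of_wd (\<phi> * \<psi>) x"
  proof (induction x rule: free_alg_induct)
    case (single w d)
    show ?case unfolding c coproduct_single const_pair
      by (simp add: pair_eval_single_mult pair_eval_coproduct_word of_wd_single)
  next
    case (add x y)
    then show ?case unfolding c by (simp add: coproduct_add pair_eval_add of_wd_plus)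
  qed
qed

lemma antipode_add: "antipode q (x + y) = antipode q x + antipode q y"
  unfolding antipode_def by (rule keys_sum_add) (simp_all add: single_add distrib_right)

lemma Uq_star_add: "Uq_star (x + y) = Uq_star x + Uq_star y"
  unfolding Uq_star_def by (rule keys_sum_add) (simp_all add: single_add distrib_right)

fun antipode_letter :: "generator \<Rightarrow> generator" where
  "antipode_letter GE = GE"
| "antipode_letter GF = GF"
| "antipode_letter GK = GKinv"
| "antipode_letter GKinv = GK"

lemma const_word: "(const c :: free_alg) = Poly_Mapping.single (Word []) c"
  by (simp add: zero_gen_word_def)

lemma prod_list_single:
  "prod_list (map (\<lambda>g. Poly_Mapping.single (Word [h g]) (k g)) w) =
    (Poly_Mapping.single (Word (map h w)) (prod_list (map k w)) :: free_alg)"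
proof (induction w)
  case Nil
  have "(1 :: free_alg) = const 1" by simp
  then show ?case by (simp only: list.map prod_list.Nil const_word)
next
  case (Cons a w)
  then show ?case by (simp add: mult_single plus_gen_word_def)
qed

text \<open>The antipode and the involution both reverse the order of letters.\<close>

lemma star_antipode_single:
  "Uq_star (antipode q (Poly_Mapping.single w c)) =
    Poly_Mapping.single (Word (map star_antipode_letter (letters w)))
      (cnj (c * prod_list (map (star_antipode_factor q) (letters w))))"
proof -
  have g: "antipode_gen q g = Poly_Mapping.single (Word [antipode_letter g]) (star_antipode_factor q g)" for g
    by (cases g) (simp_all add: gen_def const_word mult_single plus_gen_word_def)
  have s: "gen (star_gen g) = Poly_Mapping.single (Word [star_gen g]) ((\<lambda>_. 1) g)" for g
    by (simp add: gen_def)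
  have l: "star_gen (antipode_letter g) = star_antipode_letter g" for g by (cases g) simp_all
  have p: "prod_list (map f (rev v)) = prod_list (map f v)" for f :: "generator \<Rightarrow> complex" and v
    by (induction v) (simp_all add: mult.commute)
  have o: "prod_list (map (\<lambda>_. 1 :: complex) v) = 1" for v :: "generator list" by (induction v) simp_all
  have "antipode q (Poly_Mapping.single w c) =
      const c * prod_list (map (antipode_gen q) (rev (letters w)))"
    unfolding antipode_def
    by (rule keys_sum_single[where F = "\<lambda>w c. const c * prod_list (map (antipode_gen q) (rev (letters w)))"]) simp
  also have "\<dots> = Poly_Mapping.single (Word (map antipode_letter (rev (letters w))))
      (c * prod_list (map (star_antipode_factor q) (letters w)))"
    unfolding g[abs_def] prod_list_single p by (simp add: const_word mult_single plus_gen_word_def)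
  finally have 1: "antipode q (Poly_Mapping.single w c) = \<dots>" .
  have "Uq_star (Poly_Mapping.single v d) = const (cnj d) * prod_list (map (\<lambda>g. gen (star_gen g)) (rev (letters v)))" for v d
    unfolding Uq_star_def
    by (rule keys_sum_single[where F = "\<lambda>w c. const (cnj c) * prod_list (map (\<lambda>g. gen (star_gen g)) (rev (letters w)))"]) simp
  also have "\<dots> v d = Poly_Mapping.single (Word (map star_gen (rev (letters v)))) (cnj d)" for v d
    unfolding s prod_list_single o by (simp add: const_word mult_single plus_gen_word_def)
  finally show ?thesis unfolding 1 by (simp add: rev_map l comp_def)
qed

lemma star_of_wd: "(\<lambda>x. cnj (of_wd \<phi> (Uq_star (antipode q x)))) = of_wd (wstar q \<phi>)"
proof
  fix x show "cnj (of_wd \<phi> (Uq_star (antipode q x))) = of_wd (wstar q \<phi>) x"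
  proof (induction x rule: free_alg_induct)
    case (single w c)
    show ?case by (simp add: star_antipode_single of_wd_single)
  next
    case (add x y)
    then show ?case by (simp add: antipode_add Uq_star_add of_wd_plus)
  qed
qed

lemma SUq_simps:
  "of_wd a \<otimes>\<^bsub>SUq q\<^esub> of_wd b = of_wd (a * b)"
  "of_wd a \<oplus>\<^bsub>SUq q\<^esub> of_wd b = of_wd (a + b)"
  "c \<odot>\<^bsub>SUq q\<^esub> of_wd a = of_wd (wscale c a)"
  "star (SUq q) (of_wd a) = of_wd (wstar q a)"
  "\<zero>\<^bsub>SUq q\<^esub> = of_wd 0"
  by (simp_all add: SUq_def conv_of_wd of_wd_add of_wd_scale of_wd_zero star_of_wd)

lemma cring_complex_ring: "cring complex_ring"
  by (rule cringI, rule abelian_groupI)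
    (auto simp: complex_ring_def algebra_simps intro!: comm_monoidI exI[of _ "- _"] intro: add.left_inverse)

context q_parameter
begin

lemma tmat_of_wd: "m \<in> weights L \<Longrightarrow> n \<in> weights L \<Longrightarrow> tmat q L m n = of_wd (T L m n)"
  by (simp add: fun_eq_iff tmat_def of_wd_def T_def)

lemma SUq_one: "\<one>\<^bsub>SUq q\<^esub> = of_wd 1"
  using tmat_of_wd[of 0 0 0] by (simp add: SUq_def T_0 weights_iff)

lemma SUq_carrier: "carrier (SUq q) = of_wd ` SU"
proof -
  have G: "{tmat q L m n |L m n. L \<in> half_nats \<and> m \<in> weights L \<and> n \<in> weights L} = (\<lambda>i. of_wd (tb i)) ` idx"
  proof (intro equalityI subsetI)
    fix t assume "t \<in> {tmat q L m n |L m n. L \<in> half_nats \<and> m \<in> weights L \<and> n \<in> weights L}"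
    then obtain L m n where "t = tmat q L m n" "L \<in> half_nats" "m \<in> weights L" "n \<in> weights L" by blast
    then have "t = of_wd (tb (L, m, n))" "(L, m, n) \<in> idx" by (simp_all add: idx_iff tmat_of_wd)
    then show "t \<in> (\<lambda>i. of_wd (tb i)) ` idx" by blast
  next
    fix t assume "t \<in> (\<lambda>i. of_wd (tb i)) ` idx"
    then obtain L m n where "(L, m, n) \<in> idx" "t = of_wd (tb (L, m, n))" by (metis image_iff prod_cases3)
    then have "t = tmat q L m n \<and> L \<in> half_nats \<and> m \<in> weights L \<and> n \<in> weights L" by (simp add: idx_iff tmat_of_wd)
    then show "t \<in> {tmat q L m n |L m n. L \<in> half_nats \<and> m \<in> weights L \<and> n \<in> weights L}" by blast
  qed
  have "cspan ((\<lambda>i. of_wd (tb i)) ` idx) = of_wd ` SU"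
  proof (intro equalityI subsetI)
    fix \<phi> assume "\<phi> \<in> cspan ((\<lambda>i. of_wd (tb i)) ` idx)"
    then obtain S c where S: "\<phi> = (\<lambda>x. \<Sum>t\<in>S. c t * t x)" "finite S" "S \<subseteq> (\<lambda>i. of_wd (tb i)) ` idx"
      unfolding cspan_def by blast
    have "t = of_wd (to_wd t) \<and> to_wd t \<in> SU" if "t \<in> S" for t
    proof -
      from \<open>t \<in> S\<close> S(3) obtain i where "i \<in> idx" "t = of_wd (tb i)" by blast
      then show ?thesis using wd.span_base[of "tb i" "tb ` idx"] by simp
    qed
    then have "\<phi> = of_wd (\<Sum>t\<in>S. wscale (c t) (to_wd t))" "(\<Sum>t\<in>S. wscale (c t) (to_wd t)) \<in> SU"
      unfolding S(1) by (simp_all add: of_wd_sum of_wd_scale wd.span_sum wd.span_scale)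
    then show "\<phi> \<in> of_wd ` SU" by blast
  next
    fix \<phi> assume "\<phi> \<in> of_wd ` SU"
    then obtain x where x: "x \<in> SU" "\<phi> = of_wd x" by blast
    obtain F c where F: "finite F" "F \<subseteq> idx" "x = (\<Sum>i\<in>F. wscale (c i) (tb i))"
      using SU_repr2[OF x(1) x(1)] by metis
    define f where "f = (\<lambda>i. of_wd (tb i))"
    have inj: "inj_on f F" using inj_on_subset[OF tb_inj F(2)] by (auto simp: inj_on_def of_wd_inj f_def)
    have "\<phi> = (\<lambda>y. \<Sum>t\<in>f ` F. c (inv_into F f t) * t y)"
      unfolding x(2) F(3) of_wd_sum of_wd_scale sum.reindex[OF inj]
      by (intro ext sum.cong refl) (simp add: inv_into_f_f[OF inj], simp add: f_def)
    moreover have "finite (f ` F)" using F(1) by simp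
    moreover have "f ` F \<subseteq> (\<lambda>i. of_wd (tb i)) ` idx" unfolding f_def by (rule image_mono[OF F(2)])
    ultimately show "\<phi> \<in> cspan ((\<lambda>i. of_wd (tb i)) ` idx)"
      unfolding cspan_def mem_Collect_eq by (intro exI conjI)
  qed
  then show ?thesis unfolding SUq_def by (simp add: G)
qed

text \<open>Only the carrier of \<open>WPq\<close> differs from that of \<open>SUq\<close>, so one argument serves for both.\<close>

lemma unital_star_subalgebra:
  assumes V: "wd.subspace V" "1 \<in> V" "\<And>a b. a \<in> V \<Longrightarrow> b \<in> V \<Longrightarrow> a * b \<in> V" "\<And>a. a \<in> V \<Longrightarrow> wstar q a \<in> V"
    and A: "A = (SUq q)\<lparr>carrier := of_wd ` V\<rparr>"
  shows "unital_star_algebra A"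
proof -
  have c: "carrier A = of_wd ` V" by (simp add: A)
  have s: "of_wd a \<otimes>\<^bsub>A\<^esub> of_wd b = of_wd (a * b)" "of_wd a \<oplus>\<^bsub>A\<^esub> of_wd b = of_wd (a + b)"
    "z \<odot>\<^bsub>A\<^esub> of_wd a = of_wd (wscale z a)" "star A (of_wd a) = of_wd (wstar q a)"
    "\<zero>\<^bsub>A\<^esub> = of_wd 0" "\<one>\<^bsub>A\<^esub> = of_wd 1" for a b z
    using SUq_one by (simp_all add: A SUq_simps)
  note V' = wd.subspace_0[OF V(1)] wd.subspace_add[OF V(1)] wd.subspace_scale[OF V(1)] V(2-4)
  have ag: "abelian_group A"
  proof (rule abelian_groupI)
    fix x assume "x \<in> carrier A"
    then obtain a where a: "x = of_wd a" "a \<in> V" by (auto simp: c)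
    have "of_wd (wscale (- 1) a) \<in> carrier A" unfolding c by (rule imageI[OF V'(3)[OF a(2)]])
    moreover have "of_wd (wscale (- 1) a) \<oplus>\<^bsub>A\<^esub> x = \<zero>\<^bsub>A\<^esub>" by (simp add: a(1) s)
    ultimately show "\<exists>y\<in>carrier A. y \<oplus>\<^bsub>A\<^esub> x = \<zero>\<^bsub>A\<^esub>" by blast
  qed (use V' in \<open>auto simp: c s ac_simps\<close>)
  have mon: "monoid A"
    by (rule monoidI) (use V' in \<open>auto simp: c s mult.assoc\<close>)
  have ring: "ring A"
    by (rule ringI[OF ag mon]) (auto simp: c s algebra_simps)
  have mod: "module complex_ring A"
    by (rule moduleI[OF cring_complex_ring ag])
      (use V' in \<open>auto simp: c s complex_ring_def wd.scale_left_distrib wd.scale_right_distrib\<close>)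
  show ?thesis
    by (intro unital_star_algebra.intro ring mod unital_star_algebra_axioms.intro)
      (use V' q_pos in \<open>auto simp: c s wstar_add wstar_scale wstar_mult wstar_wstar\<close>)
qed

lemma unital_star_algebra_SUq: "unital_star_algebra (SUq q)"
  by (rule unital_star_subalgebra[of SU])
    (auto simp: one_in_SU SU_mult wstar_SU SUq_carrier[symmetric] wd.subspace_span)

lemma finsum_SUq:
  assumes "finite S" "\<And>i. i \<in> S \<Longrightarrow> f i \<in> SU"
  shows "(\<Oplus>\<^bsub>SUq q\<^esub>i\<in>S. of_wd (f i)) = of_wd (\<Sum>i\<in>S. f i)"
proof -
  interpret unital_star_algebra "SUq q" by (rule unital_star_algebra_SUq)
  show ?thesis using assms
  proof (induction S rule: finite_induct)
    case empty
    show ?case by (simp add: SUq_simps)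
  next
    case (insert i S)
    then have "(\<lambda>i. of_wd (f i)) \<in> S \<rightarrow> carrier (SUq q)" "of_wd (f i) \<in> carrier (SUq q)"
      by (auto simp: SUq_carrier)
    with insert show ?case by (simp add: finsum_insert SUq_simps)
  qed
qed


section \<open>The coaction\<close>

text \<open>The component of integral degree \<open>i\<close> in the grading by \<open>x m + y n\<close>.\<close>

definition hcomp :: "real \<Rightarrow> real \<Rightarrow> int \<Rightarrow> word_dual \<Rightarrow> word_dual" where
  "hcomp x y i = multiplier (\<lambda>(L, m, n). if x * m + y * n = of_int i then 1 else 0)"

lemma hcomp_linear [simp]: "hcomp x y i (a + b) = hcomp x y i a + hcomp x y i b"
  "hcomp x y i (wscale c a) = wscale c (hcomp x y i a)" "hcomp x y i 0 = 0"
  "hcomp x y i (sum f A) = (\<Sum>a\<in>A. hcomp x y i (f a))"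
  by (simp_all add: hcomp_def)

lemma hcomp_T: "L \<in> half_nats \<Longrightarrow> hcomp x y i (T L m n) = (if x * m + y * n = of_int i then T L m n else 0)"
  using half_nats_iff[of L] by (simp add: hcomp_def multiplier_T)

lemma hcomp_graded:
  assumes "z \<in> graded x y d"
  shows "hcomp x y i z = (if d = of_int i then z else 0)"
  using assms[unfolded graded_def]
proof (induction rule: wd.span_induct_alt)
  case (step c u v)
  then obtain L m n where "u = T L m n" "L \<in> half_nats" "x * m + y * n = d" by (auto simp: idx_iff)
  then show ?case using step by (simp add: hcomp_T)
qed simp

lemma hcomp_in_graded:
  assumes "z \<in> SU"
  shows "hcomp x y i z \<in> graded x y (of_int i)"
  using assms
proof (induction rule: wd.span_induct_alt)
  case (step c u v)
  then obtain L m n where u: "u = T L m n" "(L, m, n) \<in> idx" by auto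
  then have "hcomp x y i u \<in> graded x y (of_int i)"
    unfolding graded_def by (auto simp: hcomp_T idx_iff wd.span_zero intro!: T_in_span)
  with step show ?case unfolding graded_def by (simp add: wd.span_add wd.span_scale)
qed (simp add: graded_def wd.span_zero)

lemma hcomp_SU: "z \<in> SU \<Longrightarrow> hcomp x y i z \<in> SU"
  using hcomp_in_graded graded_subset by blast

text \<open>Only finitely many components are nonzero and they add up to the element, provided that all degrees
  are integers.\<close>

lemma hcomp_sum:
  assumes int: "\<And>i. i \<in> idx \<Longrightarrow> x * fst (snd i) + y * snd (snd i) \<in> \<int>" and "z \<in> SU"
  shows "finite {i. hcomp x y i z \<noteq> 0}" "z = (\<Sum>i | hcomp x y i z \<noteq> 0. hcomp x y i z)"
proof -
  have "\<exists>S. finite S \<and> z = (\<Sum>i\<in>S. hcomp x y i z) \<and> (\<forall>i. hcomp x y i z \<noteq> 0 \<longrightarrow> i \<in> S)"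
    using assms(2)
  proof (induction rule: wd.span_induct_alt)
    case base
    show ?case by (intro exI[of _ "{}"]) simp
  next
    case (step c u v)
    then obtain L m n where u: "u = T L m n" "(L, m, n) \<in> idx" by auto
    obtain j where j: "x * m + y * n = of_int j" using int[OF u(2)] by (auto elim: Ints_cases)
    have hu: "hcomp x y i u = (if i = j then u else 0)" for i
      using u j by (simp add: hcomp_T idx_iff)
    obtain S where S: "finite S" "v = (\<Sum>i\<in>S. hcomp x y i v)" "\<And>i. hcomp x y i v \<noteq> 0 \<Longrightarrow> i \<in> S"
      using step by blast
    have "(\<Sum>i\<in>insert j S. hcomp x y i v) = v"
    proof -
      have "(\<Sum>i\<in>S. hcomp x y i v) = (\<Sum>i\<in>insert j S. hcomp x y i v)"
        using S by (intro sum.mono_neutral_left) auto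
      then show ?thesis using S(2) by simp
    qed
    moreover have "(\<Sum>i\<in>insert j S. wscale c (hcomp x y i u)) = wscale c u"
      unfolding hu using S(1) by (simp add: if_distrib[of "wscale c"] cong: if_cong)
    ultimately have "wscale c u + v = (\<Sum>i\<in>insert j S. hcomp x y i (wscale c u + v))"
      by (simp only: hcomp_linear sum.distrib)
    moreover have "i \<in> insert j S" if "hcomp x y i (wscale c u + v) \<noteq> 0" for i
      using that S(3) hu by (cases "i = j") auto
    ultimately show ?case using S(1) by (intro exI[of _ "insert j S"]) blast
  qed
  then obtain S where S: "finite S" "z = (\<Sum>i\<in>S. hcomp x y i z)" "\<And>i. hcomp x y i z \<noteq> 0 \<Longrightarrow> i \<in> S"
    by blast
  show "finite {i. hcomp x y i z \<noteq> 0}" using S by (intro finite_subset[OF _ S(1)]) auto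
  have "(\<Sum>i | hcomp x y i z \<noteq> 0. hcomp x y i z) = (\<Sum>i\<in>S. hcomp x y i z)"
    using S by (intro sum.mono_neutral_left) auto
  then show "z = (\<Sum>i | hcomp x y i z \<noteq> 0. hcomp x y i z)" using S(2) by simp
qed

lemma hcomp_mult:
  assumes int: "\<And>i. i \<in> idx \<Longrightarrow> x * fst (snd i) + y * snd (snd i) \<in> \<int>" and "a \<in> SU" "b \<in> SU"
  shows "hcomp x y n (a * b) = (\<Sum>i | hcomp x y i a \<noteq> 0. hcomp x y i a * hcomp x y (n - i) b)"
proof -
  define I J where "I = {i. hcomp x y i a \<noteq> 0}" and "J = {i. hcomp x y i b \<noteq> 0}"
  have fin: "finite I" "finite J" unfolding I_def J_def using hcomp_sum(1)[OF int assms(2)] hcomp_sum(1)[OF int assms(3)] by blast+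
  have a: "a = (\<Sum>i\<in>I. hcomp x y i a)" and b: "b = (\<Sum>i\<in>J. hcomp x y i b)"
    unfolding I_def J_def using hcomp_sum(2)[OF int assms(2)] hcomp_sum(2)[OF int assms(3)] by blast+
  have c: "hcomp x y n (hcomp x y i a * hcomp x y j b) = (if j = n - i then hcomp x y i a * hcomp x y j b else 0)" for i j
  proof -
    have "hcomp x y i a * hcomp x y j b \<in> graded x y (of_int (i + j))"
      using graded_mult[OF hcomp_in_graded[OF assms(2)] hcomp_in_graded[OF assms(3)]] by simp
    from hcomp_graded[OF this, of n] show ?thesis by (auto simp: of_int_eq_iff)
  qed
  have "hcomp x y n (a * b) = hcomp x y n ((\<Sum>i\<in>I. hcomp x y i a) * (\<Sum>j\<in>J. hcomp x y j b))"
    using a b by simp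
  also have "\<dots> = (\<Sum>i\<in>I. \<Sum>j\<in>J. if j = n - i then hcomp x y i a * hcomp x y j b else 0)"
    by (simp add: sum_distrib_left sum_distrib_right c)
       (rule sum.swap)
  also have "\<dots> = (\<Sum>i\<in>I. hcomp x y i a * hcomp x y (n - i) b)"
    using fin by (intro sum.cong refl) (auto simp: J_def)
  finally show ?thesis by (simp add: I_def)
qed

lemma hcomp_wstar:
  assumes "z \<in> SU"
  shows "hcomp x y i (wstar q z) = wstar q (hcomp x y (- i) z)"
  using assms
proof (induction rule: wd.span_induct_alt)
  case (step c u v)
  then obtain L m n where u: "u = T L m n" "L \<in> half_nats" by (auto simp: idx_iff)
  have "x * - m + y * - n = of_int i \<longleftrightarrow> x * m + y * n = of_int (- i)" by auto
  then have "hcomp x y i (wstar q u) = wstar q (hcomp x y (- i) u)"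
    using u by (simp add: hcomp_T wstar_T)
  with step show ?case by (simp add: wstar_add wstar_scale)
qed simp

lemma idx_int:
  assumes "(L, m, n) \<in> idx"
  shows "m - n \<in> \<int>" "m + n \<in> \<int>"
proof -
  have 1: "L + m \<in> \<int>" "L + n \<in> \<int>" using assms Nats_subset_Ints by (auto simp: idx_iff weights_iff)
  obtain j where "L = real j / 2" using assms by (auto simp: idx_iff half_nats_def)
  then have "2 * L = of_nat j" by simp
  then have 2: "2 * L \<in> \<int>" by (metis Ints_of_nat)
  show "m - n \<in> \<int>" using Ints_diff[OF 1] by simp
  show "m + n \<in> \<int>" using Ints_diff[OF Ints_add[OF 1] 2] by simp
qed

text \<open>The coaction sends \<open>\<alpha>\<close> to degree \<open>- k\<close> and \<open>\<beta>\<close> to degree \<open>l\<close>. This determines the degree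
  \<open>(l - k) m - (l + k) n\<close> of \<open>t\<^sup>\<lambda>\<^sub>m\<^sub>n\<close>.\<close>

definition theta :: "nat \<Rightarrow> nat \<Rightarrow> functional \<Rightarrow> int \<Rightarrow> functional" where
  "theta k l = (\<lambda>\<phi>\<in>carrier (SUq q). \<lambda>i. of_wd (hcomp (real l - real k) (- real l - real k) i (to_wd \<phi>)))"

lemma theta_of_wd: "z \<in> SU \<Longrightarrow> theta k l (of_wd z) = (\<lambda>i. of_wd (hcomp (real l - real k) (- real l - real k) i z))"
  by (simp add: theta_def SUq_carrier)

lemma coaction_degree_int:
  assumes "i \<in> idx"
  shows "(real l - real k) * fst (snd i) + (- real l - real k) * snd (snd i) \<in> \<int>"
proof -
  obtain L m n where i: "i = (L, m, n)" by (cases i)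
  have "(real l - real k) * m + (- real l - real k) * n = real l * (m - n) - real k * (m + n)"
    by (simp add: algebra_simps)
  also have "\<dots> \<in> \<int>"
    using Ints_diff[OF Ints_mult[OF Ints_of_nat idx_int(1), of L m n l] Ints_mult[OF Ints_of_nat idx_int(2), of L m n k]]
      assms by (simp add: i)
  finally show ?thesis by (simp add: i)
qed

lemma SUq_alpha: "SUq_alpha q = of_wd (T (1 / 2) (1 / 2) (1 / 2))"
  and SUq_beta: "SUq_beta q = of_wd (T (1 / 2) (1 / 2) (- 1 / 2))"
  by (simp_all add: SUq_alpha_def SUq_beta_def tmat_of_wd weights_half)

text \<open>The grading is multiplicative and compatible with the involution, so the map into components is a
  homomorphism. It is the only one, since \<open>\<alpha>\<close>, \<open>\<beta>\<close> and their adjoints generate the algebra.\<close>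

lemma coaction_eq: "coaction q k l = theta k l"
  unfolding coaction_def
proof (rule the_equality)
  let ?h = "hcomp (real l - real k) (- real l - real k)"
  note int = coaction_degree_int[of _ l k]
  have hom: "theta k l \<in> star_hom (SUq q) (laurent (SUq q))"
    unfolding star_hom_def
  proof (intro CollectI conjI ballI allI)
    show "theta k l \<in> ring_hom (SUq q) (laurent (SUq q))"
    proof (rule ring_hom_memI)
      fix \<phi> assume "\<phi> \<in> carrier (SUq q)"
      then obtain x where x: "\<phi> = of_wd x" "x \<in> SU" by (auto simp: SUq_carrier)
      have "finite {i. of_wd (?h i x) \<noteq> \<zero>\<^bsub>SUq q\<^esub>}"
        using hcomp_sum(1)[OF int x(2)] by (simp add: SUq_simps of_wd_inj)
      then show "theta k l \<phi> \<in> carrier (laurent (SUq q))"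
        using x by (auto simp: laurent_def theta_of_wd SUq_carrier hcomp_SU)
    next
      fix \<phi> \<psi> assume "\<phi> \<in> carrier (SUq q)" "\<psi> \<in> carrier (SUq q)"
      then obtain x y where x: "\<phi> = of_wd x" "x \<in> SU" and y: "\<psi> = of_wd y" "y \<in> SU" by (auto simp: SUq_carrier)
      show "theta k l (\<phi> \<oplus>\<^bsub>SUq q\<^esub> \<psi>) = theta k l \<phi> \<oplus>\<^bsub>laurent (SUq q)\<^esub> theta k l \<psi>"
        using x y by (simp add: laurent_def theta_of_wd SUq_simps wd.span_add)
      have fin: "finite {i. ?h i x \<noteq> 0}" by (rule hcomp_sum(1)[OF int x(2)])
      show "theta k l (\<phi> \<otimes>\<^bsub>SUq q\<^esub> \<psi>) = theta k l \<phi> \<otimes>\<^bsub>laurent (SUq q)\<^esub> theta k l \<psi>"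
      proof
        fix n
        have "(theta k l \<phi> \<otimes>\<^bsub>laurent (SUq q)\<^esub> theta k l \<psi>) n =
          (\<Oplus>\<^bsub>SUq q\<^esub>i\<in>{i. ?h i x \<noteq> 0}. of_wd (?h i x * ?h (n - i) y))"
          using x y by (simp add: laurent_def theta_of_wd SUq_simps of_wd_inj)
        also have "\<dots> = of_wd (\<Sum>i | ?h i x \<noteq> 0. ?h i x * ?h (n - i) y)"
          using x y by (intro finsum_SUq fin SU_mult hcomp_SU)
        also have "\<dots> = theta k l (\<phi> \<otimes>\<^bsub>SUq q\<^esub> \<psi>) n"
          using x y by (simp add: SUq_simps theta_of_wd SU_mult hcomp_mult[OF int])
        finally show "theta k l (\<phi> \<otimes>\<^bsub>SUq q\<^esub> \<psi>) n = (theta k l \<phi> \<otimes>\<^bsub>laurent (SUq q)\<^esub> theta k l \<psi>) n" ..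
      qed
    next
      have "?h i 1 = (if i = 0 then 1 else 0)" for i
        using hcomp_T[of 0 _ _ i 0 0] by (simp add: T_0)
      then show "theta k l \<one>\<^bsub>SUq q\<^esub> = \<one>\<^bsub>laurent (SUq q)\<^esub>"
        by (auto simp: SUq_one theta_of_wd one_in_SU laurent_def SUq_simps)
    qed
  next
    fix \<phi> c assume "\<phi> \<in> carrier (SUq q)"
    then obtain x where x: "\<phi> = of_wd x" "x \<in> SU" by (auto simp: SUq_carrier)
    show "theta k l (c \<odot>\<^bsub>SUq q\<^esub> \<phi>) = c \<odot>\<^bsub>laurent (SUq q)\<^esub> theta k l \<phi>"
      using x by (simp add: SUq_simps theta_of_wd wd.span_scale laurent_def)
    show "theta k l (star (SUq q) \<phi>) = star (laurent (SUq q)) (theta k l \<phi>)"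
      using x by (simp add: SUq_simps theta_of_wd wstar_SU laurent_def hcomp_wstar)
  qed
  have alpha: "theta k l (SUq_alpha q) = laurent_monom (SUq q) (SUq_alpha q) (- int k)"
    and beta: "theta k l (SUq_beta q) = laurent_monom (SUq q) (SUq_beta q) (int l)"
    by (auto simp: SUq_alpha SUq_beta theta_of_wd T_in_SU hcomp_T laurent_monom_def SUq_simps of_wd_inj fun_eq_iff
      field_simps of_int_eq_iff[where 'a = real, symmetric])
  show "theta k l \<in> extensional (carrier (SUq q)) \<and> theta k l \<in> star_hom (SUq q) (laurent (SUq q)) \<and>
    theta k l (SUq_alpha q) = laurent_monom (SUq q) (SUq_alpha q) (- int k) \<and>
    theta k l (SUq_beta q) = laurent_monom (SUq q) (SUq_beta q) (int l)"
    using hom alpha beta by (simp add: theta_def)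
  fix \<theta> assume \<theta>: "\<theta> \<in> extensional (carrier (SUq q)) \<and> \<theta> \<in> star_hom (SUq q) (laurent (SUq q)) \<and>
    \<theta> (SUq_alpha q) = laurent_monom (SUq q) (SUq_alpha q) (- int k) \<and>
    \<theta> (SUq_beta q) = laurent_monom (SUq q) (SUq_beta q) (int l)"
  have rules: "f (of_wd (x * y)) = f (of_wd x) \<otimes>\<^bsub>laurent (SUq q)\<^esub> f (of_wd y)"
    "f (of_wd (x + y)) = f (of_wd x) \<oplus>\<^bsub>laurent (SUq q)\<^esub> f (of_wd y)"
    "f (of_wd (wscale c x)) = c \<odot>\<^bsub>laurent (SUq q)\<^esub> f (of_wd x)"
    "f (of_wd (wstar q x)) = star (laurent (SUq q)) (f (of_wd x))"
    "f (of_wd 1) = \<one>\<^bsub>laurent (SUq q)\<^esub>"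
    if "f \<in> star_hom (SUq q) (laurent (SUq q))" "x \<in> SU" "y \<in> SU" for f x y c
  proof -
    have h: "f \<in> ring_hom (SUq q) (laurent (SUq q))"
      "\<forall>x\<in>carrier (SUq q). (\<forall>c. f (c \<odot>\<^bsub>SUq q\<^esub> x) = c \<odot>\<^bsub>laurent (SUq q)\<^esub> f x) \<and> f (star (SUq q) x) = star (laurent (SUq q)) (f x)"
      using that(1) by (simp_all add: star_hom_def)
    have c: "of_wd x \<in> carrier (SUq q)" "of_wd y \<in> carrier (SUq q)" using that by (simp_all add: SUq_carrier)
    show "f (of_wd (x * y)) = f (of_wd x) \<otimes>\<^bsub>laurent (SUq q)\<^esub> f (of_wd y)"
      using ring_hom_mult[OF h(1) c] by (simp add: SUq_simps)
    show "f (of_wd (x + y)) = f (of_wd x) \<oplus>\<^bsub>laurent (SUq q)\<^esub> f (of_wd y)"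
      using ring_hom_add[OF h(1) c] by (simp add: SUq_simps)
    show "f (of_wd 1) = \<one>\<^bsub>laurent (SUq q)\<^esub>"
      using ring_hom_one[OF h(1)] by (simp add: SUq_one)
    show "f (of_wd (wscale c x)) = c \<odot>\<^bsub>laurent (SUq q)\<^esub> f (of_wd x)"
      "f (of_wd (wstar q x)) = star (laurent (SUq q)) (f (of_wd x))"
      using bspec[OF h(2) c(1)] by (simp_all add: SUq_simps)
  qed
  have t: "\<theta> \<in> star_hom (SUq q) (laurent (SUq q))" using \<theta> by blast
  have a: "\<theta> (of_wd (T (1 / 2) (1 / 2) (1 / 2))) = theta k l (of_wd (T (1 / 2) (1 / 2) (1 / 2)))"
    and b: "\<theta> (of_wd (T (1 / 2) (1 / 2) (- 1 / 2))) = theta k l (of_wd (T (1 / 2) (1 / 2) (- 1 / 2)))"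
    using \<theta> alpha beta by (simp_all only: SUq_alpha SUq_beta)
  have eq: "\<theta> (of_wd x) = theta k l (of_wd x)" if "x \<in> SU" for x
    using that
  proof (induction rule: SU_algebra_induct)
    case one
    show ?case using rules(5)[OF t one_in_SU one_in_SU] rules(5)[OF hom one_in_SU one_in_SU] by simp
  next
    case (gen i j)
    have h: "(1 / 2 :: real) \<in> half_nats" by simp
    have 1: "T (1 / 2) (- 1 / 2) (- 1 / 2) = wstar q (T (1 / 2) (1 / 2) (1 / 2))"
      by (simp add: wstar_T)
    have "star_sign (- 1) \<noteq> 0" using q_pos by (simp add: star_sign_def)
    then have 2: "T (1 / 2) (- 1 / 2) (1 / 2) = wscale (1 / star_sign (- 1)) (wstar q (T (1 / 2) (1 / 2) (- 1 / 2)))"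
      by (simp add: wstar_T)
    note S = T_in_SU[OF h]
    have "\<theta> (of_wd (T (1 / 2) (- 1 / 2) (- 1 / 2))) = theta k l (of_wd (T (1 / 2) (- 1 / 2) (- 1 / 2)))"
      unfolding 1 rules(4)[OF t S S] rules(4)[OF hom S S] a ..
    moreover have "\<theta> (of_wd (T (1 / 2) (- 1 / 2) (1 / 2))) = theta k l (of_wd (T (1 / 2) (- 1 / 2) (1 / 2)))"
      unfolding 2 rules(3)[OF t wstar_SU[OF S] S] rules(3)[OF hom wstar_SU[OF S] S] rules(4)[OF t S S] rules(4)[OF hom S S] b ..
    ultimately show ?case using gen a b by (elim insertE emptyE) (simp_all only:)
  next
    case (add x y)
    then show ?case by (simp only: rules(2)[OF t] rules(2)[OF hom])
  next
    case (scale c x)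
    then show ?case using rules(3)[OF t scale(1) scale(1)] rules(3)[OF hom scale(1) scale(1)] by simp
  next
    case (mult x y)
    then show ?case by (simp only: rules(1)[OF t] rules(1)[OF hom])
  qed
  show "\<theta> = theta k l"
  proof (rule extensionalityI[of _ "carrier (SUq q)"])
    show "\<theta> \<in> extensional (carrier (SUq q))" "theta k l \<in> extensional (carrier (SUq q))"
      using \<theta> by (simp_all add: theta_def)
  qed (use eq in \<open>auto simp: SUq_carrier\<close>)
qed

definition WP :: "nat \<Rightarrow> nat \<Rightarrow> word_dual set" where
  "WP k l = graded (real l - real k) (- real l - real k) 0"

lemma WPq_eq: "WPq q k l = (SUq q)\<lparr>carrier := of_wd ` WP k l\<rparr>"
proof -
  let ?h = "hcomp (real l - real k) (- real l - real k)"
  have "{t \<in> carrier (SUq q). coaction q k l t = laurent_monom (SUq q) t 0} = of_wd ` WP k l"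
  proof (intro equalityI subsetI)
    fix t assume "t \<in> {t \<in> carrier (SUq q). coaction q k l t = laurent_monom (SUq q) t 0}"
    then obtain x where x: "t = of_wd x" "x \<in> SU" "theta k l (of_wd x) = laurent_monom (SUq q) (of_wd x) 0"
      by (auto simp: SUq_carrier coaction_eq)
    from fun_cong[OF x(3), of 0] have "?h 0 x = x"
      unfolding theta_of_wd[OF x(2)] by (simp add: laurent_monom_def of_wd_inj)
    then have "x \<in> WP k l" using hcomp_in_graded[OF x(2), of _ _ 0] by (metis WP_def of_int_0)
    then show "t \<in> of_wd ` WP k l" using x by blast
  next
    fix t assume "t \<in> of_wd ` WP k l"
    then obtain x where x: "t = of_wd x" "x \<in> WP k l" by blast
    then have SU: "x \<in> SU" using graded_subset by (auto simp: WP_def)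
    have h: "?h i x = (if i = 0 then x else 0)" for i
      using hcomp_graded[OF x(2)[unfolded WP_def]] by simp
    have "theta k l (of_wd x) = laurent_monom (SUq q) (of_wd x) 0"
      unfolding theta_of_wd[OF SU] laurent_monom_def h SUq_simps by (rule ext) simp
    with SU show "t \<in> {t \<in> carrier (SUq q). coaction q k l t = laurent_monom (SUq q) t 0}"
      by (simp add: x(1) SUq_carrier coaction_eq)
  qed
  then show ?thesis by (simp add: WPq_def)
qed

lemma WP_SU: "x \<in> WP k l \<Longrightarrow> x \<in> SU"
  using graded_subset by (auto simp: WP_def)

lemma WP_subspace: "wd.subspace (WP k l)"
  by (simp add: WP_def graded_def wd.subspace_span)

lemma WP_mult: "x \<in> WP k l \<Longrightarrow> y \<in> WP k l \<Longrightarrow> x * y \<in> WP k l"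
  using graded_mult[of x _ _ 0 y 0] by (simp add: WP_def)

lemma WP_one: "1 \<in> WP k l"
  using T_in_span[of 0 0 0 "{(L, m, n). (real l - real k) * m + (- real l - real k) * n = 0}"]
  by (simp add: WP_def graded_def T_0)

lemma WP_wstar:
  assumes "x \<in> WP k l"
  shows "wstar q x \<in> WP k l"
proof -
  have "hcomp (real l - real k) (- real l - real k) 0 (wstar q x) = wstar q x"
    using hcomp_graded[OF assms[unfolded WP_def], of 0] WP_SU[OF assms] by (simp add: hcomp_wstar)
  then show ?thesis
    using hcomp_in_graded[OF wstar_SU[OF WP_SU[OF assms]], of _ _ 0] by (metis WP_def of_int_0)
qed

lemma WP_multiplier: "x \<in> WP k l \<Longrightarrow> multiplier f x \<in> WP k l"
  unfolding WP_def graded_def by (rule multiplier_in_span)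

lemma unital_star_algebra_WPq: "unital_star_algebra (WPq q k l)"
  by (rule unital_star_subalgebra[OF WP_subspace WP_one WP_mult WP_wstar WPq_eq])

lemma WPq_simps:
  "carrier (WPq q k l) = of_wd ` WP k l"
  "of_wd a \<otimes>\<^bsub>WPq q k l\<^esub> of_wd b = of_wd (a * b)"
  "of_wd a \<oplus>\<^bsub>WPq q k l\<^esub> of_wd b = of_wd (a + b)"
  "c \<odot>\<^bsub>WPq q k l\<^esub> of_wd a = of_wd (wscale c a)"
  "star (WPq q k l) (of_wd a) = of_wd (wstar q a)"
  "\<zero>\<^bsub>WPq q k l\<^esub> = of_wd 0" "\<one>\<^bsub>WPq q k l\<^esub> = of_wd 1"
  using SUq_one by (simp_all add: WPq_eq SUq_simps)

text \<open>The conditions on the Haar state prescribe its values on the spanning set of coefficients.\<close>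

lemma haar_of_wd:
  assumes "x \<in> SU"
  shows "haar q (of_wd x) = haar_val x"
proof -
  have "haar q = (\<lambda>\<phi>\<in>carrier (SUq q). haar_val (to_wd \<phi>))"
    unfolding haar_def
  proof (rule the_equality)
    show "(\<lambda>\<phi>\<in>carrier (SUq q). haar_val (to_wd \<phi>)) \<in> extensional (carrier (SUq q)) \<and>
     (\<forall>x\<in>carrier (SUq q). \<forall>y\<in>carrier (SUq q). (\<lambda>\<phi>\<in>carrier (SUq q). haar_val (to_wd \<phi>)) (x \<oplus>\<^bsub>SUq q\<^esub> y) =
        (\<lambda>\<phi>\<in>carrier (SUq q). haar_val (to_wd \<phi>)) x + (\<lambda>\<phi>\<in>carrier (SUq q). haar_val (to_wd \<phi>)) y) \<and>
     (\<forall>c. \<forall>x\<in>carrier (SUq q). (\<lambda>\<phi>\<in>carrier (SUq q). haar_val (to_wd \<phi>)) (c \<odot>\<^bsub>SUq q\<^esub> x) = c * (\<lambda>\<phi>\<in>carrier (SUq q). haar_val (to_wd \<phi>)) x) \<and>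
     (\<lambda>\<phi>\<in>carrier (SUq q). haar_val (to_wd \<phi>)) \<one>\<^bsub>SUq q\<^esub> = 1 \<and>
     (\<forall>L\<in>half_nats. \<forall>m\<in>weights L. \<forall>n\<in>weights L. L > 0 \<longrightarrow> (\<lambda>\<phi>\<in>carrier (SUq q). haar_val (to_wd \<phi>)) (tmat q L m n) = 0)"
      using half_nats_iff
      by (auto simp: SUq_carrier SUq_simps SUq_one wd.span_add wd.span_scale one_in_SU tmat_of_wd T_in_SU haar_val_T)
  next
    fix h assume h: "h \<in> extensional (carrier (SUq q)) \<and>
     (\<forall>x\<in>carrier (SUq q). \<forall>y\<in>carrier (SUq q). h (x \<oplus>\<^bsub>SUq q\<^esub> y) = h x + h y) \<and>
     (\<forall>c. \<forall>x\<in>carrier (SUq q). h (c \<odot>\<^bsub>SUq q\<^esub> x) = c * h x) \<and>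
     h \<one>\<^bsub>SUq q\<^esub> = 1 \<and>
     (\<forall>L\<in>half_nats. \<forall>m\<in>weights L. \<forall>n\<in>weights L. L > 0 \<longrightarrow> h (tmat q L m n) = 0)"
    have add: "h (of_wd (x + y)) = h (of_wd x) + h (of_wd y)" if "x \<in> SU" "y \<in> SU" for x y
      using h that by (auto simp: SUq_carrier SUq_simps)
    have scale: "h (of_wd (wscale c x)) = c * h (of_wd x)" if "x \<in> SU" for x c
      using h that by (auto simp: SUq_carrier SUq_simps)
    have T: "h (of_wd (T L m n)) = haar_val (T L m n)" if L: "(L, m, n) \<in> idx" for L m n
    proof (cases "L = 0")
      case True
      then have "m = 0" "n = 0" using L by (auto simp: idx_iff weights_iff elim!: Nats_cases)
      then show ?thesis using h True by (simp add: T_0 SUq_one)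
    next
      case False
      then have "L > 0" using L half_nats_iff by (force simp: idx_iff)
      then have "h (tmat q L m n) = 0" using h L by (simp add: idx_iff)
      then show ?thesis using L False half_nats_iff by (simp add: idx_iff tmat_of_wd haar_val_T)
    qed
    have "x \<in> SU \<and> h (of_wd x) = haar_val x" if "x \<in> SU" for x
      using that
    proof (induction rule: wd.span_induct_alt)
      case base
      show ?case using scale[OF wd.span_zero, of 0] by (simp add: wd.span_zero)
    next
      case (step c x y)
      then obtain L m n where x: "x = T L m n" "(L, m, n) \<in> idx" by auto
      then have xs: "x \<in> SU" by (simp add: idx_iff T_in_SU)
      show ?case using step T[OF x(2)] xs
        by (simp add: x(1)[symmetric] add scale wd.span_add wd.span_scale)
    qed
    then show "h = (\<lambda>\<phi>\<in>carrier (SUq q). haar_val (to_wd \<phi>))"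
      using h by (intro extensionalityI[of _ "carrier (SUq q)"]) (auto simp: SUq_carrier)
  qed
  then show ?thesis using assms by (simp add: SUq_carrier)
qed

lemma haar_ip_of_wd: "a \<in> SU \<Longrightarrow> b \<in> SU \<Longrightarrow> haar_ip q (of_wd a) (of_wd b) = ip a b"
  by (simp add: haar_ip_def SUq_simps haar_of_wd SU_mult wstar_SU ip_def)

lemma inner_product_on_WPq: "inner_product_on (WPq q k l) (haar_ip q)"
  unfolding inner_product_on_def
proof (intro conjI ballI allI impI; clarsimp simp: WPq_simps of_wd_inj)
  fix a b assume "a \<in> WP k l" "b \<in> WP k l"
  then show "haar_ip q (of_wd b) (of_wd a) = cnj (haar_ip q (of_wd a) (of_wd b))"
    by (simp add: haar_ip_of_wd WP_SU ip_commute[of a b])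
next
  fix a assume "a \<in> WP k l" "a \<noteq> 0"
  then show "0 < Re (haar_ip q (of_wd a) (of_wd a))"
    using norm_sq_pos[of a] by (simp add: haar_ip_of_wd WP_SU norm_sq_def)
qed (simp_all add: haar_ip_of_wd WP_SU wd.span_add wd.span_scale WPq_simps)

definition WPidx :: "nat \<Rightarrow> nat \<Rightarrow> real \<times> real \<Rightarrow> real \<times> real \<times> real" where
  "WPidx k l = (\<lambda>(L, p). (L, p * (real l + real k), p * (real l - real k)))"

text \<open>The pairs \<open>(m, n)\<close> of degree zero are the multiples \<open>p (l + k, l - k)\<close>. Here \<open>2 p k = m - n\<close> and
  \<open>2 p l = m + n\<close> are integers, so \<open>2 p\<close> is an integer because \<open>k\<close> and \<open>l\<close> are coprime.\<close>

lemma WPidx_image: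
  assumes "k > 0" "l > 0" "coprime k l"
  shows "WPidx k l ` WPq_index k l = idx \<inter> {(L, m, n). (real l - real k) * m + (- real l - real k) * n = 0}"
proof (intro equalityI subsetI)
  fix i assume "i \<in> WPidx k l ` WPq_index k l"
  then show "i \<in> idx \<inter> {(L, m, n). (real l - real k) * m + (- real l - real k) * n = 0}"
    by (auto simp: WPidx_def WPq_index_def idx_iff algebra_simps)
next
  fix i assume "i \<in> idx \<inter> {(L, m, n). (real l - real k) * m + (- real l - real k) * n = 0}"
  then obtain L m n where i: "i = (L, m, n)" "(L, m, n) \<in> idx" "(real l - real k) * m + (- real l - real k) * n = 0"
    by blast
  have lm: "(real l - real k) * m = (real l + real k) * n" using i(3) by (simp add: algebra_simps)
  define p where "p = m / (real l + real k)"
  have s: "real l + real k > 0" using assms by simp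
  have m: "m = p * (real l + real k)" using s by (simp add: p_def)
  have "(real l + real k) * n = (real l + real k) * (p * (real l - real k))"
    unfolding lm[symmetric] by (subst m) (simp add: ac_simps)
  moreover have "real l + real k \<noteq> 0" using s by simp
  ultimately have n: "n = p * (real l - real k)" using mult_left_cancel by blast
  have "2 * p * real k \<in> \<int>" "2 * p * real l \<in> \<int>"
    using idx_int[OF i(2)] unfolding m n by (simp_all add: algebra_simps)
  then obtain a b where ab: "2 * p * real k = of_int a" "2 * p * real l = of_int b" by (auto elim!: Ints_cases)
  have "coprime (int k) (int l)" using assms(3) by simp
  then obtain u v where uv: "u * int k + v * int l = 1" using bezout_int[of "int k" "int l"] by auto
  have "2 * p = 2 * p * of_int (u * int k + v * int l)" using uv by simp
  also have "\<dots> = of_int u * (2 * p * real k) + of_int v * (2 * p * real l)" by (simp add: algebra_simps)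
  also have "\<dots> = of_int (u * a + v * b)" using ab by simp
  finally have "p = of_int (u * a + v * b) / 2" by simp
  then have "p \<in> half_ints" unfolding half_ints_def by blast
  then have "(L, p) \<in> WPq_index k l" using i(2) m n by (simp add: WPq_index_def idx_iff)
  moreover have "i = WPidx k l (L, p)" using i(1) m n by (simp add: WPidx_def)
  ultimately show "i \<in> WPidx k l ` WPq_index k l" by blast
qed

lemma WPidx_inj: "k > 0 \<Longrightarrow> inj_on (WPidx k l) S"
  by (rule inj_onI) (auto simp: WPidx_def)

lemma WPq_basis_of_wd: "(L, p) \<in> WPq_index k l \<Longrightarrow> WPq_basis q k l L p = of_wd (tb (WPidx k l (L, p)))"
  by (simp add: WPq_basis_def WPidx_def WPq_index_def tmat_of_wd)

end


section \<open>Complex inner product spaces\<close>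

lemma cinner_simps [simp]:
  "cinner x (y + z) = cinner x y + cinner x z" "cinner x (c *\<^sub>C y) = c * cinner x y"
  "cinner (x + y) z = cinner x z + cinner y z" "cinner (c *\<^sub>C x) y = cnj c * cinner x y"
  "cinner x 0 = 0" "cinner 0 y = 0" "cinner x (y - z) = cinner x y - cinner x z"
  "cinner (x - y) z = cinner x z - cinner y z"
proof -
  show 1: "cinner x (y + z) = cinner x y + cinner x z" for x y z :: 'a by (rule cinner_add_right)
  show 2: "cinner x (c *\<^sub>C y) = c * cinner x y" by (rule cinner_scaleC_right)
  show 3: "cinner (x + y) z = cinner x z + cinner y z" for x y z :: 'a
    using cinner_commute[of "x + y" z] cinner_commute[of x z] cinner_commute[of y z] by (simp add: 1)
  show "cinner (c *\<^sub>C x) y = cnj c * cinner x y"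
    using cinner_commute[of "c *\<^sub>C x" y] cinner_commute[of x y] by (simp add: cinner_scaleC_right)
  show "cinner x 0 = 0" using 1[of x 0 0] by simp
  show "cinner 0 y = 0" using 3[of 0 0 y] by simp
  show "cinner x (y - z) = cinner x y - cinner x z" using 1[of x "y - z" z] by simp
  show "cinner (x - y) z = cinner x z - cinner y z" using 3[of "x - y" y z] by simp
qed

lemma cinner_scaleR [simp]:
  fixes x y :: "'a::complex_inner"
  shows "cinner x (r *\<^sub>R y) = of_real r * cinner x y" "cinner (r *\<^sub>R x) y = of_real r * cinner x y"
  by (simp_all flip: scaleC_of_real)

lemma cinner_sum:
  "cinner x (sum f A) = (\<Sum>a\<in>A. cinner x (f a))" "cinner (sum f A) x = (\<Sum>a\<in>A. cinner (f a) x)"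
  by (induction A rule: infinite_finite_induct) simp_all

lemma cinner_self: "cinner x x = of_real ((norm x)\<^sup>2)"
proof (rule complex_eqI)
  show "Re (cinner x x) = Re (complex_of_real ((norm x)\<^sup>2))" by (simp only: Re_cinner Re_complex_of_real power2_norm_eq_inner)
  show "Im (cinner x x) = Im (complex_of_real ((norm x)\<^sup>2))"
    using arg_cong[OF cinner_commute[of x x], of Im] by simp
qed

lemma norm_scaleC: "norm (c *\<^sub>C x) = cmod c * norm (x :: 'a::complex_inner)"
proof -
  have "complex_of_real ((norm (c *\<^sub>C x))\<^sup>2) = cnj c * c * of_real ((norm x)\<^sup>2)"
    unfolding cinner_self[symmetric] by simp
  also have "cnj c * c = of_real ((cmod c)\<^sup>2)" by (subst complex_norm_square) (simp add: mult.commute)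
  finally have "(norm (c *\<^sub>C x))\<^sup>2 = (cmod c * norm x)\<^sup>2"
    unfolding of_real_mult[symmetric] of_real_eq_iff by (simp add: power_mult_distrib)
  then show ?thesis by (simp add: power2_eq_iff_nonneg)
qed

text \<open>The complex inequality follows from the real one after multiplication by a phase.\<close>

lemma cmod_cinner_le: "cmod (cinner x y) \<le> norm x * norm y"
proof (cases "cinner x y = 0")
  case False
  define c where "c = cnj (cinner x y) / of_real (cmod (cinner x y))"
  have c: "cmod c = 1" using False by (simp add: c_def norm_divide)
  have "cinner x (c *\<^sub>C y) = of_real (cmod (cinner x y))"
    using False complex_norm_square[of "cinner x y"] by (simp add: c_def power2_eq_square field_simps)
  then have "cmod (cinner x y) = inner x (c *\<^sub>C y)"
    using Re_cinner[of x "c *\<^sub>C y"] by simp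
  also have "\<dots> \<le> norm x * norm (c *\<^sub>C y)" by (rule norm_cauchy_schwarz)
  finally show ?thesis by (simp add: norm_scaleC c)
qed simp

lemma bounded_linear_scaleC: "bounded_linear (\<lambda>x :: 'a::complex_inner. c *\<^sub>C x)"
proof (rule bounded_linear_intro[where K = "cmod c"])
  show "c *\<^sub>C (r *\<^sub>R x) = r *\<^sub>R (c *\<^sub>C x)" for r and x :: 'a
    by (simp add: scaleC_scaleC mult.commute flip: scaleC_of_real)
qed (simp_all add: scaleC_add_right norm_scaleC mult.commute)

lemma bounded_linear_cinner_right: "bounded_linear (\<lambda>y :: 'a::complex_inner. cinner x y)"
  by (rule bounded_linear_intro[where K = "norm x"])
    (simp_all add: scaleR_conv_of_real cmod_cinner_le mult.commute[of "norm _" "norm x"])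

lemma bounded_linear_cinner_left: "bounded_linear (\<lambda>x :: 'a::complex_inner. cinner x y)"
  by (rule bounded_linear_intro[where K = "norm y"])
    (simp_all add: scaleR_conv_of_real cmod_cinner_le)

lemma bounded_linear_scaleC_left: "bounded_linear (\<lambda>c. c *\<^sub>C (x :: 'a::complex_inner))"
proof (rule bounded_linear_intro[where K = "norm x"])
  show "(r *\<^sub>R c) *\<^sub>C x = r *\<^sub>R (c *\<^sub>C x)" for r c
    by (simp add: scaleC_scaleC scaleR_conv_of_real flip: scaleC_of_real)
qed (simp_all add: scaleC_add_left norm_scaleC)

lemma continuous_cinner [continuous_intros]:
  assumes "continuous_on S f"
  shows "continuous_on S (\<lambda>x. cinner y (f x))" "continuous_on S (\<lambda>x. cinner (f x) y)"
  using bounded_linear.continuous_on[OF bounded_linear_cinner_right assms]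
    bounded_linear.continuous_on[OF bounded_linear_cinner_left assms] by auto

lemma bounded_clinearD:
  assumes "bounded_clinear T"
  shows "bounded_linear T" "T (x + y) = T x + T y" "T (c *\<^sub>C x) = c *\<^sub>C T x" "T (r *\<^sub>R x) = r *\<^sub>R T x"
    "T 0 = 0" "T (x - y) = T x - T y" "T (- x) = - T x" "continuous_on S T" "continuous_on S f \<Longrightarrow> continuous_on S (\<lambda>x. T (f x))"
proof -
  show b: "bounded_linear T" and "T (c *\<^sub>C x) = c *\<^sub>C T x" using assms by (auto simp: bounded_clinear_def)
  interpret bounded_linear T by (rule b)
  show "T (x + y) = T x + T y" "T (r *\<^sub>R x) = r *\<^sub>R T x" "T 0 = 0" "T (x - y) = T x - T y" "T (- x) = - T x"
    by (rule add scale zero diff neg)+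
  show "continuous_on S T" "continuous_on S f \<Longrightarrow> continuous_on S (\<lambda>x. T (f x))"
    by (auto intro: linear_continuous_on[OF b] continuous_on)
qed

lemma bounded_clinear_compose:
  "bounded_clinear S \<Longrightarrow> bounded_clinear T \<Longrightarrow> bounded_clinear (\<lambda>x. S (T x))"
  unfolding bounded_clinear_def by (auto intro: bounded_linear_compose)

lemma bounded_clinear_add:
  "bounded_clinear S \<Longrightarrow> bounded_clinear T \<Longrightarrow> bounded_clinear (\<lambda>x. S x + T x)"
  unfolding bounded_clinear_def by (auto intro: bounded_linear_add simp: scaleC_add_right)

lemma bounded_clinear_scaleC: "bounded_clinear (\<lambda>x. c *\<^sub>C x)"
  unfolding bounded_clinear_def by (auto intro: bounded_linear_scaleC simp: scaleC_scaleC mult.commute)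

lemma bounded_clinear_id: "bounded_clinear (\<lambda>x. x)"
  unfolding bounded_clinear_def by (auto intro: bounded_linear_ident)

lemma dense_eq:
  fixes f g :: "'a::topological_space \<Rightarrow> 'b::t2_space"
  assumes "closure V = UNIV" "continuous_on UNIV f" "continuous_on UNIV g" "\<And>x. x \<in> V \<Longrightarrow> f x = g x"
  shows "f x = g x"
proof -
  have "closure V \<subseteq> {x. f x = g x}"
    using assms(4) by (intro closure_minimal closed_Collect_eq assms) auto
  then show ?thesis using assms(1) by auto
qed

text \<open>A bounded operator on a dense subspace is uniformly continuous and extends to the closure; the
  algebraic identities extend by continuity.\<close>

lemma bounded_clinear_extension:
  fixes g :: "'a::complex_inner \<Rightarrow> 'b::complex_hilbert"
  assumes V: "complex_vector.subspace V" and dense: "closure V = UNIV"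
    and add: "\<And>x y. x \<in> V \<Longrightarrow> y \<in> V \<Longrightarrow> g (x + y) = g x + g y"
    and scale: "\<And>c x. x \<in> V \<Longrightarrow> g (c *\<^sub>C x) = c *\<^sub>C g x"
    and bound: "\<And>x. x \<in> V \<Longrightarrow> norm (g x) \<le> C * norm x"
  obtains T where "bounded_clinear T" "\<And>x. x \<in> V \<Longrightarrow> T x = g x"
proof -
  have diff: "g (x - y) = g x - g y" if "x \<in> V" "y \<in> V" for x y
    using add[of "x - y" y] that complex_vector.subspace_diff[OF V] by simp
  have "uniformly_continuous_on V g"
    unfolding uniformly_continuous_on_def
  proof (intro allI impI)
    fix \<epsilon> :: real assume \<epsilon>: "\<epsilon> > 0"
    define K where "K = max C 1"
    have K: "K > 0" "C \<le> K" by (simp_all add: K_def)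
    show "\<exists>d>0. \<forall>x\<in>V. \<forall>x'\<in>V. dist x' x < d \<longrightarrow> dist (g x') (g x) < \<epsilon>"
    proof (intro exI[of _ "\<epsilon> / K"] conjI ballI impI)
      fix x x' assume x: "x \<in> V" "x' \<in> V" "dist x' x < \<epsilon> / K"
      have "dist (g x') (g x) = norm (g (x' - x))" using x by (simp add: dist_norm diff)
      also have "\<dots> \<le> C * norm (x' - x)" using x complex_vector.subspace_diff[OF V] by (intro bound) auto
      also have "\<dots> \<le> K * norm (x' - x)" using K by (intro mult_right_mono) auto
      also have "\<dots> < \<epsilon>" using x(3) K by (simp add: dist_norm field_simps)
      finally show "dist (g x') (g x) < \<epsilon>" .
    qed (use \<epsilon> K in simp)
  qed
  then obtain T where T: "uniformly_continuous_on (closure V) T" "\<And>x. x \<in> V \<Longrightarrow> g x = T x"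
    by (rule uniformly_continuous_on_extension_on_closure) blast
  have cont: "continuous_on UNIV T" using T(1) dense uniformly_continuous_imp_continuous by auto
  note ct = continuous_on_compose2[OF cont]
  have add1: "T (x + v) = T x + T v" if "v \<in> V" for x v
    by (rule dense_eq[OF dense, where f = "\<lambda>x. T (x + v)"])
      (use that T(2) add complex_vector.subspace_add[OF V] in \<open>auto intro!: continuous_intros ct simp flip: T(2)\<close>)
  have add2: "T (x + y) = T x + T y" for x y
    by (rule dense_eq[OF dense, where f = "\<lambda>y. T (x + y)"]) (auto intro!: continuous_intros ct add1)
  have scale2: "T (c *\<^sub>C x) = c *\<^sub>C T x" for c x
    by (rule dense_eq[OF dense, where f = "\<lambda>x. T (c *\<^sub>C x)"])
      (use T(2) scale complex_vector.subspace_scale[OF V] in \<open>auto intro!: bounded_linear.continuous_on[OF bounded_linear_scaleC] ct cont continuous_on_id simp flip: T(2)\<close>)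
  have "closure V \<subseteq> {x. norm (T x) \<le> C * norm x}"
    using bound T(2) by (intro closure_minimal closed_Collect_le continuous_intros ct) auto
  then have bound2: "norm (T x) \<le> norm x * C" for x using dense by (auto simp: mult.commute)
  have "bounded_linear T"
    by (rule bounded_linear_intro[OF add2 _ bound2]) (simp add: scale2 flip: scaleC_of_real)
  then have "bounded_clinear T" by (simp add: bounded_clinear_def scale2)
  with T(2) that show ?thesis by simp
qed

lemma orthogonal_independent:
  fixes B :: "'a::complex_inner set"
  assumes "\<And>x y. x \<in> B \<Longrightarrow> y \<in> B \<Longrightarrow> x \<noteq> y \<Longrightarrow> cinner x y = 0" "0 \<notin> B"
  shows "complex_vector.independent B"
  unfolding complex_vector.independent_explicit_module
proof (intro allI impI)
  fix t u v assume *: "finite t" "t \<subseteq> B" "(\<Sum>x\<in>t. u x *\<^sub>C x) = 0" "v \<in> t"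
  have "0 = cinner v (\<Sum>x\<in>t. u x *\<^sub>C x)" using * by simp
  also have "\<dots> = (\<Sum>x\<in>t. if x = v then u v * cinner v v else 0)"
    unfolding cinner_sum using * assms(1)[of v] by (intro sum.cong) auto
  also have "\<dots> = u v * cinner v v" using * by simp
  finally have "u v * cinner v v = 0" by simp
  moreover have "v \<noteq> 0" using assms(2) * by auto
  ultimately show "u v = 0" by (simp add: cinner_self)
qed

lemma cinner_dense_zero:
  assumes "closure V = UNIV" "\<And>v. v \<in> V \<Longrightarrow> cinner v x = 0"
  shows "x = 0"
proof -
  have "cinner y x = 0" for y
    by (rule dense_eq[where f = "\<lambda>y. cinner y x" and g = "\<lambda>_. 0", OF assms(1) _ _ assms(2)])
      (auto intro!: continuous_intros)
  then have "cinner x x = 0" .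
  then show ?thesis by (simp add: cinner_self)
qed


lemma compact_closure_subset:
  fixes K :: "'a::t2_space set"
  assumes "compact K" "S \<subseteq> K"
  shows "compact (closure S)"
proof -
  have "closure S \<subseteq> K" using assms by (intro closure_minimal compact_imp_closed)
  then have "K \<inter> closure S = closure S" by blast
  then show ?thesis using compact_Int_closed[OF assms(1) closed_closure, of S] by simp
qed


section \<open>Inverses of compact symmetric operators\<close>

text \<open>The inverse of a bounded symmetric operator \<open>R\<close> with dense range, given by its graph. All properties of
  the unbounded operator are read off from \<open>R\<close>.\<close>

locale symmetric_inverse =
  fixes R :: "'h::complex_hilbert \<Rightarrow> 'h"
  assumes R: "bounded_clinear R"
    and symmetric: "cinner (R x) y = cinner x (R y)"
    and dense_range: "closure (range R) = UNIV"
begin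

definition inverse_graph :: "('h \<times> 'h) set" where
  "inverse_graph = {(R z, z) |z. True}"

lemma inverse_graph_iff: "(x, z) \<in> inverse_graph \<longleftrightarrow> x = R z"
  by (auto simp: inverse_graph_def)

lemma R_injective:
  assumes "R z = 0"
  shows "z = 0"
proof (rule cinner_dense_zero[OF dense_range])
  fix v assume "v \<in> range R"
  then obtain w where "v = R w" by blast
  then show "cinner v z = 0" using assms by (simp add: symmetric)
qed

lemma self_adjoint_inverse_graph: "self_adjoint inverse_graph"
proof -
  note Rs = bounded_clinearD[OF R]
  have "complex_vector.subspace inverse_graph"
    by (rule complex_vector.subspaceI)
      (auto simp: inverse_graph_iff scaleC_prod_def Rs zero_prod_def plus_prod_def)
  moreover have "single_valued inverse_graph"
  proof (rule single_valuedI)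
    fix x y z assume "(x, y) \<in> inverse_graph" "(x, z) \<in> inverse_graph"
    then have "R (y - z) = 0" by (simp add: inverse_graph_iff Rs)
    then show "y = z" using R_injective by fastforce
  qed
  moreover have "Domain inverse_graph = range R" by (auto simp: inverse_graph_def)
  moreover have "(y, z) \<in> adjoint_op inverse_graph \<longleftrightarrow> (y, z) \<in> inverse_graph" for y z
  proof
    assume "(y, z) \<in> adjoint_op inverse_graph"
    then have "cinner y w = cinner z (R w)" for w
      by (fastforce simp: adjoint_op_def inverse_graph_def)
    then have "cinner (y - R z) w = 0" for w by (simp add: symmetric)
    then have "y - R z = 0" using cinner_self[of "y - R z"] by simp
    then show "(y, z) \<in> inverse_graph" by (simp add: inverse_graph_iff)
  qed (auto simp: adjoint_op_def inverse_graph_iff symmetric)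
  ultimately show ?thesis
    using dense_range by (auto simp: self_adjoint_def linear_operator_def densely_defined_def)
qed

text \<open>A self-adjoint operator has a closed graph, since it is an adjoint. If it contains the pairs \<open>(R v, v)\<close> for
  \<open>v\<close> in a dense set, it contains the graph of the inverse of \<open>R\<close>, and taking adjoints reverses
  the inclusion.\<close>

lemma self_adjoint_unique:
  assumes D: "self_adjoint D" and V: "closure V = UNIV" "\<And>v. v \<in> V \<Longrightarrow> (R v, v) \<in> D"
  shows "D = inverse_graph"
proof -
  have adj: "adjoint_op D = D" using D by (simp add: self_adjoint_def)
  have "(R z, z) \<in> D" for z
  proof -
    have "cinner (R z) w = cinner z x" if xw: "(x, w) \<in> D" for x w
    proof (rule dense_eq[OF V(1), where f = "\<lambda>z. cinner (R z) w"])
      fix v assume "v \<in> V"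
      then have "(R v, v) \<in> adjoint_op D" using V(2) adj by simp
      then show "cinner (R v) w = cinner v x" using xw by (auto simp: adjoint_op_def)
    qed (auto intro!: continuous_intros bounded_clinearD(8)[OF R])
    then have "(R z, z) \<in> adjoint_op D" by (auto simp: adjoint_op_def)
    then show ?thesis using adj by simp
  qed
  then have sub: "inverse_graph \<subseteq> D" by (auto simp: inverse_graph_def)
  then have "adjoint_op D \<subseteq> adjoint_op inverse_graph" by (auto simp: adjoint_op_def)
  then show ?thesis using sub adj self_adjoint_inverse_graph by (auto simp: self_adjoint_def)
qed

lemma is_resolvent_inverse_graph: "is_resolvent inverse_graph 0 R"
  using R by (auto simp: is_resolvent_def inverse_graph_iff)

text \<open>A resolvent \<open>S\<close> at \<open>z\<close> satisfies \<open>S = R (1 + z S)\<close>: the operator \<open>R\<close> after a bounded one.\<close>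

lemma compact_resolvent_inverse_graph:
  assumes "compact_operator R"
  shows "compact_resolvent inverse_graph"
  unfolding compact_resolvent_def
proof (intro conjI allI impI)
  show "\<exists>z R. is_resolvent inverse_graph z R" using is_resolvent_inverse_graph by blast
  fix z S assume S: "is_resolvent inverse_graph z S"
  then have Sb: "bounded_clinear S" and eq: "S y = R (y + z *\<^sub>C S y)" for y
    by (auto simp: is_resolvent_def inverse_graph_iff)
  define T where "T = (\<lambda>y. y + z *\<^sub>C S y)"
  have T: "bounded_clinear T" unfolding T_def
    by (intro bounded_clinear_add bounded_clinear_id bounded_clinear_compose[OF bounded_clinear_scaleC Sb])
  obtain K where K: "K > 0" "\<And>y. norm (T y) \<le> norm y * K"
    using bounded_linear.pos_bounded[OF bounded_clinearD(1)[OF T]] by blast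
  have "S ` cball 0 1 \<subseteq> (\<lambda>x. K *\<^sub>R x) ` closure (R ` cball 0 1)"
  proof
    fix s assume "s \<in> S ` cball 0 1"
    then obtain y where y: "s = S y" "norm y \<le> 1" by auto
    have "norm y * K \<le> 1 * K" using K(1) y(2) by (intro mult_right_mono) auto
    then have "norm (T y) \<le> K" using K(2)[of y] by simp
    then have "(1 / K) *\<^sub>R T y \<in> cball 0 1" using K(1) by simp
    moreover have "s = K *\<^sub>R R ((1 / K) *\<^sub>R T y)"
      using K(1) eq[of y] by (simp add: y(1) bounded_clinearD(4)[OF R] T_def)
    ultimately show "s \<in> (\<lambda>x. K *\<^sub>R x) ` closure (R ` cball 0 1)" using closure_subset by blast
  qed
  moreover have "compact ((\<lambda>x. K *\<^sub>R x) ` closure (R ` cball 0 1))"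
    using assms by (intro compact_scaling) (simp add: compact_operator_def)
  ultimately have "compact (closure (S ` cball 0 1))" by (rule compact_closure_subset[rotated])
  then show "compact_operator S" using Sb by (simp add: compact_operator_def)
qed

end

lemma compact_closureI:
  fixes S :: "'a::complete_space set"
  assumes "\<And>\<epsilon>. \<epsilon> > 0 \<Longrightarrow> \<exists>K. compact K \<and> (\<forall>x\<in>S. \<exists>y\<in>K. dist x y \<le> \<epsilon>)"
  shows "compact (closure S)"
  unfolding compact_eq_totally_bounded
proof (intro conjI allI impI)
  show "complete (closure S)" by (simp add: complete_eq_closed)
  fix \<epsilon> :: real assume \<epsilon>: "\<epsilon> > 0"
  obtain K where K: "compact K" "\<And>x. x \<in> S \<Longrightarrow> \<exists>y\<in>K. dist x y \<le> \<epsilon> / 3"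
    using assms[of "\<epsilon> / 3"] \<epsilon> by auto
  obtain k where k: "finite k" "K \<subseteq> (\<Union>x\<in>k. ball x (\<epsilon> / 3))"
    using K(1) \<epsilon> unfolding compact_eq_totally_bounded by (meson divide_pos_pos zero_less_numeral)
  have "S \<subseteq> (\<Union>x\<in>k. cball x (2 * \<epsilon> / 3))"
  proof
    fix x assume "x \<in> S"
    then obtain y where y: "y \<in> K" "dist x y \<le> \<epsilon> / 3" using K by blast
    then obtain z where z: "z \<in> k" "dist z y < \<epsilon> / 3" using k by auto
    have "dist z x \<le> 2 * \<epsilon> / 3" using dist_triangle[of z x y] y z by (simp add: dist_commute)
    with z show "x \<in> (\<Union>x\<in>k. cball x (2 * \<epsilon> / 3))" by auto
  qed
  then have "closure S \<subseteq> (\<Union>x\<in>k. cball x (2 * \<epsilon> / 3))"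
    using k(1) by (intro closure_minimal closed_UN) auto
  also have "\<dots> \<subseteq> (\<Union>x\<in>k. ball x \<epsilon>)" using \<epsilon> by (intro UN_mono) auto
  finally show "\<exists>k. finite k \<and> closure S \<subseteq> (\<Union>x\<in>k. ball x \<epsilon>)" using k(1) by blast
qed

lemma finite_combinations_in_compact:
  fixes e :: "'i \<Rightarrow> 'a::complex_inner"
  assumes "finite I"
  shows "\<exists>K. compact K \<and> (\<forall>a. (\<forall>i\<in>I. cmod (a i) \<le> B) \<longrightarrow> (\<Sum>i\<in>I. a i *\<^sub>C e i) \<in> K)"
  using assms
proof (induction I rule: finite_induct)
  case empty
  show ?case by (intro exI[of _ "{0}"]) simp
next
  case (insert i I)
  then obtain K where K: "compact K" "\<And>a. (\<forall>i\<in>I. cmod (a i) \<le> B) \<Longrightarrow> (\<Sum>i\<in>I. a i *\<^sub>C e i) \<in> K" by blast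
  define K' where "K' = {x + y |x y. x \<in> (\<lambda>c. c *\<^sub>C e i) ` cball 0 B \<and> y \<in> K}"
  have "compact K'" unfolding K'_def
    by (intro compact_sums compact_continuous_image K(1) linear_continuous_on[OF bounded_linear_scaleC_left]) simp
  moreover have "(\<Sum>j\<in>insert i I. a j *\<^sub>C e j) \<in> K'" if "\<forall>j\<in>insert i I. cmod (a j) \<le> B" for a
    unfolding K'_def using insert(1,2) K(2)[of a] that by fastforce
  ultimately show ?case by blast
qed


section \<open>Diagonal operators in an orthogonal basis\<close>

text \<open>An orthogonal basis \<open>e\<close> with eigenvalues \<open>d\<close> of finite multiplicity that tend to infinity.\<close>

locale diagonal_system =
  fixes e :: "'i \<Rightarrow> 'h::complex_hilbert" and J :: "'i set" and d :: "'i \<Rightarrow> real"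
  assumes orthogonal: "i \<in> J \<Longrightarrow> j \<in> J \<Longrightarrow> i \<noteq> j \<Longrightarrow> cinner (e i) (e j) = 0"
    and nonzero: "i \<in> J \<Longrightarrow> e i \<noteq> 0"
    and total: "closure (complex_vector.span (e ` J)) = UNIV"
    and d_pos: "i \<in> J \<Longrightarrow> 0 < d i"
    and finite_levels: "finite {i \<in> J. d i \<le> r}"
begin

definition coeff :: "'i \<Rightarrow> 'h \<Rightarrow> complex" where
  "coeff i x = cinner (e i) x / of_real ((norm (e i))\<^sup>2)"

definition level :: "nat \<Rightarrow> 'i set" where
  "level n = {i \<in> J. d i \<le> real n}"

text \<open>Finite rank approximations to the operator that divides \<open>e i\<close> by \<open>d i\<close>. They converge uniformly on bounded
  sets, which yields both the existence of the limit and its compactness.\<close>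

definition finite_part :: "nat \<Rightarrow> 'h \<Rightarrow> 'h" where
  "finite_part n x = (\<Sum>i\<in>level n. (coeff i x / of_real (d i)) *\<^sub>C e i)"

lemma level: "finite (level n)" "level n \<subseteq> J" "n \<le> m \<Longrightarrow> level n \<subseteq> level m"
  using finite_levels by (auto simp: level_def)

lemma norm_combination:
  assumes "finite S" "S \<subseteq> J"
  shows "(norm (\<Sum>i\<in>S. a i *\<^sub>C e i))\<^sup>2 = (\<Sum>i\<in>S. (cmod (a i) * norm (e i))\<^sup>2)"
proof -
  have "cinner (e i) (\<Sum>j\<in>S. a j *\<^sub>C e j) = a i * of_real ((norm (e i))\<^sup>2)" if "i \<in> S" for i
  proof -
    have "cinner (e i) (\<Sum>j\<in>S. a j *\<^sub>C e j) = (\<Sum>j\<in>S. if j = i then a i * of_real ((norm (e i))\<^sup>2) else 0)"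
      unfolding cinner_sum using that assms(2) orthogonal by (intro sum.cong) (auto simp: cinner_self subset_iff)
    then show ?thesis using that assms(1) by simp
  qed
  then have "cinner (\<Sum>i\<in>S. a i *\<^sub>C e i) (\<Sum>j\<in>S. a j *\<^sub>C e j) = (\<Sum>i\<in>S. cnj (a i) * (a i * of_real ((norm (e i))\<^sup>2)))"
    by (simp add: cinner_sum(2))
  also have "\<dots> = (\<Sum>i\<in>S. of_real ((cmod (a i) * norm (e i))\<^sup>2))"
  proof (intro sum.cong refl)
    fix i
    have "cnj (a i) * a i = of_real ((cmod (a i))\<^sup>2)" by (subst complex_norm_square) (simp add: mult.commute)
    then show "cnj (a i) * (a i * of_real ((norm (e i))\<^sup>2)) = of_real ((cmod (a i) * norm (e i))\<^sup>2)"
      by (simp add: power_mult_distrib mult.assoc[symmetric])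
  qed
  finally show ?thesis unfolding cinner_self of_real_sum[symmetric] of_real_eq_iff .
qed

lemma cinner_combination:
  assumes "finite S" "S \<subseteq> J" "i \<in> J"
  shows "cinner (e i) (\<Sum>j\<in>S. coeff j x *\<^sub>C e j) = (if i \<in> S then cinner (e i) x else 0)"
proof -
  have "cinner (e i) (\<Sum>j\<in>S. coeff j x *\<^sub>C e j) = (\<Sum>j\<in>S. if j = i then cinner (e i) x else 0)"
    unfolding cinner_sum
  proof (intro sum.cong refl)
    fix j assume "j \<in> S"
    then have "j \<in> J" using assms(2) by blast
    then show "cinner (e i) (coeff j x *\<^sub>C e j) = (if j = i then cinner (e i) x else 0)"
      using orthogonal[OF assms(3), of j] nonzero[of i] by (auto simp: cinner_self coeff_def)
  qed
  then show ?thesis using assms(1) by (simp add: sum.delta)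
qed

lemma bessel:
  assumes "finite S" "S \<subseteq> J"
  shows "(\<Sum>i\<in>S. (cmod (coeff i x) * norm (e i))\<^sup>2) \<le> (norm x)\<^sup>2"
proof -
  define p where "p = (\<Sum>i\<in>S. coeff i x *\<^sub>C e i)"
  have "cinner (e i) (x - p) = 0" if "i \<in> S" for i
    using cinner_combination[OF assms, of i x] that assms(2) by (auto simp: p_def)
  then have "cinner p (x - p) = 0"
    by (subst (1) p_def) (simp add: cinner_sum(2) del: cinner_simps(7))
  then have "inner p (x - p) = 0" using Re_cinner[of p "x - p"] by simp
  then have "(norm (p + (x - p)))\<^sup>2 = (norm p)\<^sup>2 + (norm (x - p))\<^sup>2"
    using norm_add_Pythagorean orthogonal_def by blast
  then have "(norm p)\<^sup>2 \<le> (norm x)\<^sup>2" by simp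
  then show ?thesis using norm_combination[OF assms, of "\<lambda>i. coeff i x"] by (simp add: p_def)
qed

text \<open>The difference involves only eigenvalues larger than \<open>n\<close>; now Bessel's inequality applies.\<close>

lemma finite_part_diff:
  assumes "n \<le> m" "0 < n"
  shows "norm (finite_part m x - finite_part n x) \<le> norm x / real n"
proof -
  define S where "S = level m - level n"
  have S: "finite S" "S \<subseteq> J" using level by (auto simp: S_def)
  have "finite_part m x - finite_part n x = (\<Sum>i\<in>S. (coeff i x / of_real (d i)) *\<^sub>C e i)"
    unfolding finite_part_def S_def using level assms(1) by (subst sum_diff) auto
  then have "(norm (finite_part m x - finite_part n x))\<^sup>2 = (\<Sum>i\<in>S. (cmod (coeff i x / of_real (d i)) * norm (e i))\<^sup>2)"
    using norm_combination[OF S] by simp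
  also have "\<dots> \<le> (\<Sum>i\<in>S. (1 / real n)\<^sup>2 * (cmod (coeff i x) * norm (e i))\<^sup>2)"
  proof (rule sum_mono)
    fix i assume "i \<in> S"
    then have "real n < d i" by (auto simp: S_def level_def)
    then have "1 / d i \<le> 1 / real n" "0 < d i" using assms(2) by (auto simp: field_simps)
    then have "(1 / d i)\<^sup>2 * (cmod (coeff i x) * norm (e i))\<^sup>2 \<le> (1 / real n)\<^sup>2 * (cmod (coeff i x) * norm (e i))\<^sup>2"
      by (intro mult_right_mono power_mono) auto
    then show "(cmod (coeff i x / of_real (d i)) * norm (e i))\<^sup>2 \<le> (1 / real n)\<^sup>2 * (cmod (coeff i x) * norm (e i))\<^sup>2"
      by (simp add: norm_divide power_mult_distrib power_divide)
  qed
  also have "\<dots> \<le> (1 / real n)\<^sup>2 * (norm x)\<^sup>2"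
    unfolding sum_distrib_left[symmetric] by (intro mult_left_mono bessel S) auto
  also have "\<dots> = (norm x / real n)\<^sup>2" by (simp add: power_divide)
  finally show ?thesis by (rule power2_le_imp_le) simp
qed

lemma coeff_linear: "coeff i (x + y) = coeff i x + coeff i y" "coeff i (c *\<^sub>C x) = c * coeff i x"
  by (simp_all add: coeff_def add_divide_distrib)

lemma finite_part_linear:
  "finite_part n (x + y) = finite_part n x + finite_part n y" "finite_part n (c *\<^sub>C x) = c *\<^sub>C finite_part n x"
  by (simp_all add: finite_part_def coeff_linear add_divide_distrib scaleC_add_left sum.distrib
      complex_vector.scale_sum_right scaleC_scaleC)

definition inv_op :: "'h \<Rightarrow> 'h" where
  "inv_op x = lim (\<lambda>n. finite_part n x)"

lemma finite_part_tendsto: "(\<lambda>n. finite_part n x) \<longlonglongrightarrow> inv_op x"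
proof -
  have "Cauchy (\<lambda>n. finite_part n x)"
  proof (rule metric_CauchyI)
    fix \<epsilon> :: real assume \<epsilon>: "\<epsilon> > 0"
    obtain N where N: "norm x / \<epsilon> < real N" using reals_Archimedean2 by blast
    have "norm x / \<epsilon> \<ge> 0" using \<epsilon> by simp
    then have N0: "0 < N" using N by (cases N) auto
    have d: "dist (finite_part m x) (finite_part n x) < \<epsilon>" if "N \<le> n" "n \<le> m" for m n
    proof -
      have "norm (finite_part m x - finite_part n x) \<le> norm x / real n" using that N0 by (intro finite_part_diff) auto
      also have "\<dots> \<le> norm x / real N" using that N0 by (intro divide_left_mono) auto
      also have "\<dots> < \<epsilon>" using N N0 \<epsilon> by (simp add: field_simps)
      finally show ?thesis by (simp add: dist_norm)
    qed
    then show "\<exists>M. \<forall>m\<ge>M. \<forall>n\<ge>M. dist (finite_part m x) (finite_part n x) < \<epsilon>"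
      by (intro exI[of _ N]) (metis dist_commute linear)
  qed
  then have "convergent (\<lambda>n. finite_part n x)" by (rule Cauchy_convergent)
  then show ?thesis unfolding inv_op_def by (simp add: convergent_LIMSEQ_iff)
qed

lemma inv_op_approx: "0 < n \<Longrightarrow> norm (inv_op x - finite_part n x) \<le> norm x / real n"
proof (rule tendsto_upperbound)
  show "(\<lambda>m. norm (finite_part m x - finite_part n x)) \<longlonglongrightarrow> norm (inv_op x - finite_part n x)"
    by (intro tendsto_intros finite_part_tendsto)
  assume "0 < n"
  then show "\<forall>\<^sub>F m in sequentially. norm (finite_part m x - finite_part n x) \<le> norm x / real n"
    using finite_part_diff by (intro eventually_mono[OF eventually_ge_at_top[of n]])
qed simp

lemma inv_op_linear: "inv_op (x + y) = inv_op x + inv_op y" "inv_op (c *\<^sub>C x) = c *\<^sub>C inv_op x"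
proof -
  show "inv_op (x + y) = inv_op x + inv_op y"
    using tendsto_add[OF finite_part_tendsto[of x] finite_part_tendsto[of y]] finite_part_tendsto[of "x + y"]
    by (simp add: finite_part_linear LIMSEQ_unique)
  show "inv_op (c *\<^sub>C x) = c *\<^sub>C inv_op x"
    using bounded_linear.tendsto[OF bounded_linear_scaleC finite_part_tendsto[of x], of c] finite_part_tendsto[of "c *\<^sub>C x"]
    by (simp add: finite_part_linear LIMSEQ_unique)
qed

lemma coeff_bound:
  assumes "i \<in> J"
  shows "cmod (coeff i x) * norm (e i) \<le> norm x"
proof -
  have "cmod (coeff i x) = cmod (cinner (e i) x) / (norm (e i))\<^sup>2"
    by (simp add: coeff_def norm_divide norm_power)
  then have "cmod (coeff i x) * norm (e i) = cmod (cinner (e i) x) / norm (e i)"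
    by (simp add: power2_eq_square)
  also have "\<dots> \<le> norm x"
    using cmod_cinner_le[of "e i" x] nonzero[OF assms] by (simp add: pos_divide_le_eq mult.commute)
  finally show ?thesis .
qed

lemma finite_part_bound: "\<exists>C. \<forall>x. norm (finite_part n x) \<le> norm x * C"
proof (intro exI allI)
  fix x
  have "norm (finite_part n x) \<le> (\<Sum>i\<in>level n. norm ((coeff i x / of_real (d i)) *\<^sub>C e i))"
    unfolding finite_part_def by (rule norm_sum)
  also have "\<dots> \<le> (\<Sum>i\<in>level n. norm x * (1 / d i))"
  proof (rule sum_mono)
    fix i assume "i \<in> level n"
    then have i: "i \<in> J" using level by blast
    have "cmod (coeff i x) * norm (e i) \<le> norm x" by (rule coeff_bound[OF i])
    then have "cmod (coeff i x) * norm (e i) / d i \<le> norm x / d i" using d_pos[OF i] by (intro divide_right_mono) auto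
    then show "norm ((coeff i x / of_real (d i)) *\<^sub>C e i) \<le> norm x * (1 / d i)"
      using d_pos[OF i] by (simp add: norm_scaleC norm_divide)
  qed
  finally show "norm (finite_part n x) \<le> norm x * (\<Sum>i\<in>level n. 1 / d i)" by (simp add: sum_distrib_left)
qed

lemma inv_op_bounded: "bounded_clinear inv_op"
proof -
  obtain C where C: "\<And>x. norm (finite_part 1 x) \<le> norm x * C" using finite_part_bound by blast
  have "bounded_linear inv_op"
  proof (rule bounded_linear_intro[where K = "C + 1"])
    fix x
    have "norm (inv_op x) \<le> norm (finite_part 1 x) + norm (inv_op x - finite_part 1 x)"
      by (metis add_diff_cancel_left' norm_triangle_sub diff_add_cancel)
    then show "norm (inv_op x) \<le> norm x * (C + 1)"
      using C[of x] inv_op_approx[of 1 x] by (simp add: distrib_left)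
  qed (use inv_op_linear in \<open>auto simp flip: scaleC_of_real\<close>)
  then show ?thesis by (simp add: bounded_clinear_def inv_op_linear)
qed

lemma inv_op_e:
  assumes i: "i \<in> J"
  shows "inv_op (e i) = (1 / d i) *\<^sub>R e i"
proof -
  obtain N where N: "d i \<le> real N" using real_arch_simple by blast
  have "finite_part n (e i) = (1 / d i) *\<^sub>R e i" if "N \<le> n" for n
  proof -
    have "(coeff j (e i) / of_real (d j)) *\<^sub>C e j = (if j = i then (1 / d i) *\<^sub>R e i else 0)" if "j \<in> level n" for j
    proof -
      have "j \<in> J" using that level by blast
      then show ?thesis using orthogonal[of j i] nonzero[OF i] i
        by (auto simp: coeff_def cinner_self simp flip: scaleC_of_real)
    qed
    moreover have "i \<in> level n" using N that i by (auto simp: level_def)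
    ultimately show ?thesis unfolding finite_part_def using level(1) by (simp add: sum.delta)
  qed
  then have "(\<lambda>n. finite_part n (e i)) \<longlonglongrightarrow> (1 / d i) *\<^sub>R e i"
    by (intro tendsto_eventually) (auto intro: eventually_sequentiallyI[of N])
  then show ?thesis using finite_part_tendsto LIMSEQ_unique by blast
qed

lemma inv_op_symmetric: "cinner (inv_op x) y = cinner x (inv_op y)"
proof -
  have "cinner (finite_part n x) y = cinner x (finite_part n y)" for n
    unfolding finite_part_def cinner_sum
  proof (intro sum.cong refl)
    fix i
    show "cinner ((coeff i x / of_real (d i)) *\<^sub>C e i) y = cinner x ((coeff i y / of_real (d i)) *\<^sub>C e i)"
      using cinner_commute[of x "e i"] by (simp add: coeff_def)
  qed
  moreover have "(\<lambda>n. cinner (finite_part n x) y) \<longlonglongrightarrow> cinner (inv_op x) y"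
    by (intro bounded_linear.tendsto[OF bounded_linear_cinner_left] finite_part_tendsto)
  moreover have "(\<lambda>n. cinner x (finite_part n y)) \<longlonglongrightarrow> cinner x (inv_op y)"
    by (intro bounded_linear.tendsto[OF bounded_linear_cinner_right] finite_part_tendsto)
  ultimately show ?thesis using LIMSEQ_unique by simp
qed

lemma span_in_range: "complex_vector.span (e ` J) \<subseteq> range inv_op"
proof (rule complex_vector.span_minimal)
  show "e ` J \<subseteq> range inv_op"
  proof
    fix v assume "v \<in> e ` J"
    then obtain i where i: "i \<in> J" "v = e i" by blast
    have "v = inv_op (d i *\<^sub>R e i)"
      using i d_pos[of i] by (simp add: bounded_clinearD(4)[OF inv_op_bounded] inv_op_e)
    then show "v \<in> range inv_op" by blast
  qed
  show "complex_vector.subspace (range inv_op)"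
  proof (rule complex_vector.subspaceI)
    show "0 \<in> range inv_op" using bounded_clinearD(5)[OF inv_op_bounded] by (metis rangeI)
    show "x + y \<in> range inv_op" if "x \<in> range inv_op" "y \<in> range inv_op" for x y
      using that by (elim rangeE) (simp only: inv_op_linear(1)[symmetric] rangeI)
    show "c *\<^sub>C x \<in> range inv_op" if "x \<in> range inv_op" for c x
      using that by (elim rangeE) (simp only: inv_op_linear(2)[symmetric] rangeI)
  qed
qed

text \<open>The inverse of the operator that interchanges two copies of the space and multiplies \<open>e i\<close> by \<open>d i\<close>.\<close>

definition swap_inv :: "'h \<times> 'h \<Rightarrow> 'h \<times> 'h" where
  "swap_inv z = (inv_op (snd z), inv_op (fst z))"

lemma swap_inv_bounded: "bounded_clinear swap_inv"
proof -
  note b = bounded_clinearD(1)[OF inv_op_bounded]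
  have "bounded_linear swap_inv"
    unfolding swap_inv_def[abs_def]
    by (rule bounded_linear_Pair[OF bounded_linear_compose[OF b bounded_linear_snd]
          bounded_linear_compose[OF b bounded_linear_fst]])
  then show ?thesis by (simp add: bounded_clinear_def swap_inv_def scaleC_prod_def inv_op_linear)
qed

lemma dense_pairs: "closure (complex_vector.span (e ` J) \<times> complex_vector.span (e ` J)) = UNIV"
  by (simp add: closure_Times total)

sublocale swap: symmetric_inverse swap_inv
proof
  show "bounded_clinear swap_inv" by (rule swap_inv_bounded)
  show "cinner (swap_inv x) y = cinner x (swap_inv y)" for x y
    by (simp add: cinner_prod_def swap_inv_def inv_op_symmetric)
  have "complex_vector.span (e ` J) \<times> complex_vector.span (e ` J) \<subseteq> range swap_inv"
  proof
    fix z assume "z \<in> complex_vector.span (e ` J) \<times> complex_vector.span (e ` J)"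
    then obtain a b where "z = (inv_op a, inv_op b)" using span_in_range by blast
    then have "z = swap_inv (b, a)" by (simp add: swap_inv_def)
    then show "z \<in> range swap_inv" by blast
  qed
  from closure_mono[OF this] show "closure (range swap_inv) = UNIV" using dense_pairs by auto
qed

lemma inv_op_compact: "compact (closure (inv_op ` cball 0 1))"
proof (rule compact_closureI)
  fix \<epsilon> :: real assume \<epsilon>: "\<epsilon> > 0"
  obtain n where n: "1 / \<epsilon> < real n" using reals_Archimedean2 by blast
  then have n0: "0 < n" using \<epsilon> by (cases n) (auto simp: less_le_trans)
  define B where "B = (\<Sum>i\<in>level n. 1 / (norm (e i) * d i))"
  obtain K where K: "compact K" "\<And>a. (\<forall>i\<in>level n. cmod (a i) \<le> B) \<Longrightarrow> (\<Sum>i\<in>level n. a i *\<^sub>C e i) \<in> K"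
    using finite_combinations_in_compact[OF level(1)] by metis
  have "\<exists>y\<in>K. dist x y \<le> \<epsilon>" if "x \<in> inv_op ` cball 0 1" for x
  proof -
    obtain z where z: "x = inv_op z" "norm z \<le> 1" using \<open>x \<in> _\<close> by auto
    have "finite_part n z \<in> K"
      unfolding finite_part_def
    proof (rule K(2), rule ballI)
      fix i assume i: "i \<in> level n"
      then have iJ: "i \<in> J" using level by blast
      have "cmod (coeff i z) * norm (e i) \<le> 1" using coeff_bound[OF iJ, of z] z(2) by linarith
      then have "cmod (coeff i z / of_real (d i)) \<le> 1 / (norm (e i) * d i)"
        using nonzero[OF iJ] d_pos[OF iJ] by (simp add: norm_divide field_simps)
      also have "\<dots> \<le> B" unfolding B_def
      proof (rule member_le_sum[OF i _ level(1)])
        fix j assume "j \<in> level n - {i}"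
        then have "0 \<le> d j" using d_pos[of j] level(2) by force
        then show "0 \<le> 1 / (norm (e j) * d j)" by simp
      qed
      finally show "cmod (coeff i z / of_real (d i)) \<le> B" .
    qed
    moreover have "dist x (finite_part n z) \<le> \<epsilon>"
    proof -
      have "dist x (finite_part n z) \<le> norm z / real n" using inv_op_approx[OF n0, of z] by (simp add: z(1) dist_norm)
      also have "\<dots> \<le> 1 / real n" using z(2) by (intro divide_right_mono) auto
      also have "\<dots> \<le> \<epsilon>" using n n0 \<epsilon> by (simp add: field_simps)
      finally show ?thesis .
    qed
    ultimately show ?thesis by blast
  qed
  with K(1) show "\<exists>K. compact K \<and> (\<forall>x\<in>inv_op ` cball 0 1. \<exists>y\<in>K. dist x y \<le> \<epsilon>)" by blast
qed

lemma swap_inv_compact: "compact_operator swap_inv"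
proof -
  have "swap_inv ` cball 0 1 \<subseteq> closure (inv_op ` cball 0 1) \<times> closure (inv_op ` cball 0 1)"
  proof
    fix y assume "y \<in> swap_inv ` cball 0 1"
    then obtain z where z: "y = swap_inv z" "norm z \<le> 1" by auto
    have "norm (fst z) \<le> 1" "norm (snd z) \<le> 1"
      using z(2) norm_fst_le[of "fst z" "snd z"] norm_snd_le[of "snd z" "fst z"] by simp_all
    then show "y \<in> closure (inv_op ` cball 0 1) \<times> closure (inv_op ` cball 0 1)"
      using closure_subset[of "inv_op ` cball 0 1"] by (auto simp: z(1) swap_inv_def)
  qed
  moreover have "compact (closure (inv_op ` cball 0 1) \<times> closure (inv_op ` cball 0 1))"
    by (intro compact_Times inv_op_compact)
  ultimately have "compact (closure (swap_inv ` cball 0 1))" by (rule compact_closure_subset[rotated])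
  then show ?thesis using swap_inv_bounded by (simp add: compact_operator_def)
qed

abbreviation dirac :: "(('h \<times> 'h) \<times> ('h \<times> 'h)) set" where
  "dirac \<equiv> swap.inverse_graph"

text \<open>On an eigenvector \<open>(x, y)\<close>, the equations \<open>x = \<mu> R y\<close> and \<open>y = \<mu> R x\<close> force the coefficients at \<open>e i\<close> to vanish
  unless \<open>d i = \<bar>\<mu>\<bar>\<close>, and those of \<open>x\<close> and \<open>y\<close> to agree up to the sign of \<open>\<mu>\<close> otherwise.\<close>

lemma dirac_eigenspace:
  assumes \<mu>: "\<mu> \<noteq> 0"
  shows "eigenspace dirac \<mu> = complex_vector.span ((\<lambda>i. (e i, sgn \<mu> *\<^sub>R e i)) ` {i \<in> J. d i = \<bar>\<mu>\<bar>})"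
    (is "_ = complex_vector.span (?f ` ?E)")
proof -
  note Rl = bounded_clinearD[OF inv_op_bounded]
  have eig: "(x, y) \<in> eigenspace dirac \<mu> \<longleftrightarrow> x = \<mu> *\<^sub>R inv_op y \<and> y = \<mu> *\<^sub>R inv_op x" for x y
    by (simp add: eigenspace_def swap.inverse_graph_iff swap_inv_def scaleC_of_real Rl)
  have sub: "complex_vector.subspace (eigenspace dirac \<mu>)"
  proof (rule complex_vector.subspaceI)
    have iff: "x \<in> eigenspace dirac \<mu> \<longleftrightarrow> x = swap_inv (of_real \<mu> *\<^sub>C x)" for x
      by (simp add: eigenspace_def swap.inverse_graph_iff)
    note S = bounded_clinearD[OF swap_inv_bounded]
    show "0 \<in> eigenspace dirac \<mu>" by (simp add: iff S)
    show "x + y \<in> eigenspace dirac \<mu>" if "x \<in> eigenspace dirac \<mu>" "y \<in> eigenspace dirac \<mu>" for x y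
      using that unfolding iff by (simp only: scaleC_add_right S(2))
    show "c *\<^sub>C x \<in> eigenspace dirac \<mu>" if "x \<in> eigenspace dirac \<mu>" for c x
    proof -
      have "swap_inv (of_real \<mu> *\<^sub>C (c *\<^sub>C x)) = c *\<^sub>C swap_inv (of_real \<mu> *\<^sub>C x)"
        by (simp add: S(3)[symmetric] scaleC_scaleC mult.commute)
      then show ?thesis using that unfolding iff by simp
    qed
  qed
  have "?f ` ?E \<subseteq> eigenspace dirac \<mu>"
  proof
    fix z assume "z \<in> ?f ` ?E"
    then obtain i where i: "i \<in> J" "d i = \<bar>\<mu>\<bar>" "z = (e i, sgn \<mu> *\<^sub>R e i)" by blast
    have c: "\<mu> * (sgn \<mu> * (1 / \<bar>\<mu>\<bar>)) = 1" "\<mu> * (1 / \<bar>\<mu>\<bar>) = sgn \<mu>" using \<mu> by (simp_all add: sgn_if abs_if)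
    have "\<mu> *\<^sub>R inv_op (sgn \<mu> *\<^sub>R e i) = e i" "\<mu> *\<^sub>R inv_op (e i) = sgn \<mu> *\<^sub>R e i"
      unfolding Rl(4) inv_op_e[OF i(1)] i(2) scaleR_scaleR c by simp_all
    then show "z \<in> eigenspace dirac \<mu>" unfolding i(3) eig by simp
  qed
  then have 1: "complex_vector.span (?f ` ?E) \<subseteq> eigenspace dirac \<mu>"
    using sub by (rule complex_vector.span_minimal)
  have "z \<in> complex_vector.span (?f ` ?E)" if z: "z \<in> eigenspace dirac \<mu>" for z
  proof -
    obtain x y where xy: "z = (x, y)" by (cases z)
    have x: "x = \<mu> *\<^sub>R inv_op y" and y: "y = \<mu> *\<^sub>R inv_op x" using z unfolding xy eig by blast+
    have ci: "cinner (e i) (inv_op v) = of_real (1 / d i) * cinner (e i) v" if "i \<in> J" for i v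
      unfolding inv_op_symmetric[symmetric] using that by (simp add: inv_op_e)
    have cx: "cinner (e i) x = of_real (\<mu> / d i) * cinner (e i) y" if "i \<in> J" for i
      by (subst x) (simp add: ci that)
    have cy: "cinner (e i) y = of_real (\<mu> / d i) * cinner (e i) x" if "i \<in> J" for i
      by (subst y) (simp add: ci that)
    have E: "finite ?E" "?E \<subseteq> J"
      using finite_levels[of "\<bar>\<mu>\<bar>"] by (auto elim: finite_subset[rotated])
    \<comment> \<open>Eliminating one vector from the two equations multiplies the coefficient by \<open>(\<mu> / d i)\<^sup>2\<close>, which is not \<open>1\<close>.\<close>
    have zero: "cinner (e i) x = 0" "cinner (e i) y = 0" if "i \<in> J" "d i \<noteq> \<bar>\<mu>\<bar>" for i
    proof -
      have "cinner (e i) x = of_real (\<mu> / d i) * (of_real (\<mu> / d i) * cinner (e i) x)"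
        unfolding cy[OF that(1), symmetric] by (rule cx[OF that(1)])
      also have "\<dots> = of_real ((\<mu> / d i)\<^sup>2) * cinner (e i) x"
        by (simp add: power2_eq_square mult.assoc)
      finally have "cinner (e i) x = of_real ((\<mu> / d i)\<^sup>2) * cinner (e i) x" .
      moreover have "(\<mu> / d i)\<^sup>2 \<noteq> 1"
      proof
        assume "(\<mu> / d i)\<^sup>2 = 1"
        then have "\<mu> / d i = 1 \<or> \<mu> / d i = - 1" by (simp only: power2_eq_1_iff)
        then have "\<mu> = d i \<or> \<mu> = - d i" using d_pos[OF that(1)] by (auto simp: divide_eq_eq)
        then show False using that d_pos[OF that(1)] by auto
      qed
      then have "complex_of_real ((\<mu> / d i)\<^sup>2) \<noteq> 1" by (simp only: of_real_eq_1_iff not_False_eq_True)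
      ultimately show "cinner (e i) x = 0" by (metis mult_cancel_right1)
      then show "cinner (e i) y = 0" using cy[OF that(1)] by simp
    qed
    have expand: "v = (\<Sum>i\<in>?E. coeff i v *\<^sub>C e i)" if v: "\<And>i. i \<in> J \<Longrightarrow> d i \<noteq> \<bar>\<mu>\<bar> \<Longrightarrow> cinner (e i) v = 0" for v
    proof -
      define w where "w = v - (\<Sum>i\<in>?E. coeff i v *\<^sub>C e i)"
      have w: "cinner (e i) w = 0" if "i \<in> J" for i
        using cinner_combination[OF E that, of v] v[OF that] that by (auto simp: w_def)
      have "w = 0"
      proof (rule cinner_dense_zero[OF total])
        fix u assume "u \<in> complex_vector.span (e ` J)"
        then show "cinner u w = 0"
          by (induction rule: complex_vector.span_induct_alt) (auto simp: w)
      qed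
      then show ?thesis by (simp add: w_def)
    qed
    have "y = (\<Sum>i\<in>?E. coeff i x *\<^sub>C (sgn \<mu> *\<^sub>R e i))"
    proof -
      have "coeff i y = of_real (sgn \<mu>) * coeff i x" if "i \<in> ?E" for i
      proof -
        have "\<mu> / d i = sgn \<mu>" using that \<mu> by (auto simp: sgn_if abs_if)
        then show ?thesis using cy[of i] that by (simp add: coeff_def)
      qed
      then have "(\<Sum>i\<in>?E. coeff i y *\<^sub>C e i) = (\<Sum>i\<in>?E. coeff i x *\<^sub>C (sgn \<mu> *\<^sub>R e i))"
        by (intro sum.cong refl) (simp add: scaleC_scaleC mult.commute flip: scaleC_of_real)
      then show ?thesis using expand[of y] zero(2) by simp
    qed
    moreover have "x = (\<Sum>i\<in>?E. coeff i x *\<^sub>C e i)" using expand[of x] zero(1) by blast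
    moreover have "(\<Sum>i\<in>?E. coeff i x *\<^sub>C ?f i) = (\<Sum>i\<in>?E. coeff i x *\<^sub>C e i, \<Sum>i\<in>?E. coeff i x *\<^sub>C (sgn \<mu> *\<^sub>R e i))"
      by (simp add: scaleC_prod_def sum_prod)
    ultimately have "z = (\<Sum>i\<in>?E. coeff i x *\<^sub>C ?f i)" using xy by simp
    also have "\<dots> \<in> complex_vector.span (?f ` ?E)"
      by (intro complex_vector.span_sum complex_vector.span_scale complex_vector.span_base) blast
    finally show ?thesis .
  qed
  with 1 show ?thesis by blast
qed

lemma dirac_eigenspace_0: "eigenspace dirac 0 = {0}"
  using bounded_clinearD(5)[OF swap_inv_bounded]
  by (auto simp: eigenspace_def swap.inverse_graph_iff scaleC_prod_def simp flip: zero_prod_def)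

lemma dim_dirac_eigenspace:
  "complex_vector.dim (eigenspace dirac \<mu>) = card {i \<in> J. d i = \<bar>\<mu>\<bar>}"
proof (cases "\<mu> = 0")
  case True
  then have E: "{i \<in> J. d i = \<bar>\<mu>\<bar>} = {}" using d_pos by force
  have "complex_vector.dim {0 :: 'h \<times> 'h} = 0"
    using complex_vector.dim_span_eq_card_independent[OF complex_vector.independent_empty] by simp
  then show ?thesis unfolding E unfolding True dirac_eigenspace_0 by simp
next
  case False
  let ?f = "\<lambda>i. (e i, sgn \<mu> *\<^sub>R e i)" and ?E = "{i \<in> J. d i = \<bar>\<mu>\<bar>}"
  have inj: "inj_on ?f ?E"
  proof (rule inj_onI)
    fix i j assume ij: "i \<in> ?E" "j \<in> ?E" "?f i = ?f j"
    show "i = j"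
    proof (rule ccontr)
      assume "i \<noteq> j"
      then have "cinner (e i) (e j) = 0" using ij orthogonal by blast
      then show False using ij nonzero[of i] by (auto simp: cinner_self)
    qed
  qed
  have "complex_vector.independent (?f ` ?E)"
  proof (rule orthogonal_independent)
    fix x y assume "x \<in> ?f ` ?E" "y \<in> ?f ` ?E" "x \<noteq> y"
    then obtain i j where "i \<in> J" "j \<in> J" "x = ?f i" "y = ?f j" "i \<noteq> j" by blast
    then show "cinner x y = 0" using orthogonal[of i j] by (simp add: cinner_prod_def)
  qed (use nonzero in \<open>auto simp: zero_prod_def\<close>)
  then have "complex_vector.dim (complex_vector.span (?f ` ?E)) = card (?f ` ?E)"
    by (rule complex_vector.dim_span_eq_card_independent)
  then show ?thesis using dirac_eigenspace[OF False] card_image[OF inj] by simp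
qed

lemma dirac_eigenvalue_iff: "eigenspace dirac \<mu> \<noteq> {0} \<longleftrightarrow> {i \<in> J. d i = \<bar>\<mu>\<bar>} \<noteq> {}"
proof (cases "\<mu> = 0")
  case True
  then show ?thesis using d_pos dirac_eigenspace_0 by force
next
  case False
  have "i \<in> J \<Longrightarrow> d i = \<bar>\<mu>\<bar> \<Longrightarrow> (e i, sgn \<mu> *\<^sub>R e i) \<in> eigenspace dirac \<mu>" for i
    unfolding dirac_eigenspace[OF False] by (intro complex_vector.span_base) blast
  moreover have "eigenspace dirac \<mu> = {0}" if "{i \<in> J. d i = \<bar>\<mu>\<bar>} = {}"
    unfolding dirac_eigenspace[OF False] that by simp
  ultimately show ?thesis using nonzero by (fastforce simp: zero_prod_def)
qed

text \<open>Each \<open>i\<close> contributes to the two eigenvalues \<open>d i\<close> and \<open>- d i\<close>.\<close>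

lemma truncated_trace_dirac:
  "truncated_trace dirac r = 2 * (\<Sum>i | i \<in> J \<and> d i \<le> r. 1 / (d i)\<^sup>2)"
proof -
  define I where "I = {i \<in> J. d i \<le> r}"
  have I: "finite I" by (simp add: I_def finite_levels)
  define g where "g \<mu> = real (card {i \<in> J. d i = \<bar>\<mu>\<bar>}) / \<mu>\<^sup>2" for \<mu>
  have M: "{\<mu>. \<bar>\<mu>\<bar> \<le> r \<and> eigenspace dirac \<mu> \<noteq> {0}} = d ` I \<union> uminus ` d ` I"
  proof (intro equalityI subsetI)
    fix \<mu> assume "\<mu> \<in> {\<mu>. \<bar>\<mu>\<bar> \<le> r \<and> eigenspace dirac \<mu> \<noteq> {0}}"
    then obtain i where "i \<in> J" "d i = \<bar>\<mu>\<bar>" "\<bar>\<mu>\<bar> \<le> r" by (auto simp: dirac_eigenvalue_iff)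
    then have "i \<in> I" "\<mu> = d i \<or> \<mu> = - d i" by (auto simp: I_def)
    then show "\<mu> \<in> d ` I \<union> uminus ` d ` I" by blast
  next
    fix \<mu> assume "\<mu> \<in> d ` I \<union> uminus ` d ` I"
    then obtain i where "i \<in> J" "d i \<le> r" "\<mu> = d i \<or> \<mu> = - d i" by (auto simp: I_def)
    then have "d i = \<bar>\<mu>\<bar>" "i \<in> J" "d i \<le> r" using d_pos[of i] by auto
    then show "\<mu> \<in> {\<mu>. \<bar>\<mu>\<bar> \<le> r \<and> eigenspace dirac \<mu> \<noteq> {0}}" by (auto simp: dirac_eigenvalue_iff)
  qed
  have "truncated_trace dirac r = (\<Sum>\<mu>\<in>d ` I \<union> uminus ` d ` I. g \<mu>)"
    unfolding truncated_trace_def M dim_dirac_eigenspace g_def ..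
  also have "\<dots> = (\<Sum>\<mu>\<in>d ` I. g \<mu>) + (\<Sum>\<mu>\<in>uminus ` d ` I. g \<mu>)"
  proof (rule sum.union_disjoint)
    show "d ` I \<inter> uminus ` d ` I = {}"
    proof (rule equals0I)
      fix x assume "x \<in> d ` I \<inter> uminus ` d ` I"
      then obtain i j where "i \<in> I" "j \<in> I" "x = d i" "x = - d j" by auto
      then show False using d_pos[of i] d_pos[of j] by (auto simp: I_def)
    qed
  qed (use I in auto)
  also have "(\<Sum>\<mu>\<in>uminus ` d ` I. g \<mu>) = (\<Sum>\<mu>\<in>d ` I. g \<mu>)"
    by (subst sum.reindex) (auto simp: g_def)
  also have "(\<Sum>\<mu>\<in>d ` I. g \<mu>) = (\<Sum>i\<in>I. 1 / (d i)\<^sup>2)"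
  proof -
    have "(\<Sum>i\<in>I. 1 / (d i)\<^sup>2) = (\<Sum>y\<in>d ` I. \<Sum>i | i \<in> I \<and> d i = y. 1 / (d i)\<^sup>2)"
      by (rule sum.image_gen[OF I])
    also have "\<dots> = (\<Sum>y\<in>d ` I. g y)"
    proof (intro sum.cong refl)
      fix y assume y: "y \<in> d ` I"
      then obtain j where "j \<in> J" "y = d j" "d j \<le> r" by (auto simp: I_def)
      then have "\<bar>y\<bar> = y" "y \<le> r" using d_pos[of j] by auto
      then have "{i \<in> I. d i = y} = {i \<in> J. d i = \<bar>y\<bar>}" by (auto simp: I_def)
      then show "(\<Sum>i | i \<in> I \<and> d i = y. 1 / (d i)\<^sup>2) = g y" by (auto simp: g_def)
    qed
    finally show ?thesis ..
  qed
  finally show ?thesis by (simp add: I_def)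
qed

end


section \<open>Counting the eigenvalues\<close>

lemma WPq_index_bound:
  assumes "k > 0" "(L, p) \<in> WPq_index k l"
  obtains n j where "L = real n / 2" "p = of_int j / 2" "\<bar>j\<bar> \<le> int n"
proof -
  obtain n where n: "L = real n / 2" using assms by (auto simp: WPq_index_def half_nats_def)
  obtain j where j: "p = of_int j / 2" using assms by (auto simp: WPq_index_def half_ints_def)
  have "p * (real l + real k) \<in> weights L" using assms by (simp add: WPq_index_def)
  from weights_bounds[OF this] have b: "\<bar>p * (real l + real k)\<bar> \<le> L" by linarith
  have "\<bar>p\<bar> * 1 \<le> \<bar>p\<bar> * (real l + real k)" using assms(1) by (intro mult_left_mono) auto
  then have "\<bar>p\<bar> \<le> L" using b by (simp add: abs_mult)
  then have "\<bar>real_of_int j\<bar> \<le> real n" using n j by simp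
  then have "\<bar>j\<bar> \<le> int n" by linarith
  with n j that show ?thesis by blast
qed

lemma WPq_index_levels:
  assumes "k > 0"
  shows "{i \<in> WPq_index k l. fst i + 1 \<le> r} \<subseteq>
    (\<lambda>(n, j). (real n / 2, real_of_int j / 2)) ` (SIGMA n:{..nat \<lfloor>2 * r\<rfloor>}. {- int n..int n})"
proof
  fix i assume i: "i \<in> {i \<in> WPq_index k l. fst i + 1 \<le> r}"
  obtain L p where Lp: "i = (L, p)" by (cases i)
  then have "(L, p) \<in> WPq_index k l" "L + 1 \<le> r" using i by auto
  then obtain n j where nj: "L = real n / 2" "p = of_int j / 2" "\<bar>j\<bar> \<le> int n"
    using WPq_index_bound[OF assms] by metis
  have "real n \<le> 2 * r" using nj \<open>L + 1 \<le> r\<close> by simp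
  then have "n \<le> nat \<lfloor>2 * r\<rfloor>" by linarith
  with nj Lp show "i \<in> (\<lambda>(n, j). (real n / 2, real_of_int j / 2)) ` (SIGMA n:{..nat \<lfloor>2 * r\<rfloor>}. {- int n..int n})"
    by (intro image_eqI[of _ _ "(n, j)"]) auto
qed

lemma finite_WPq_index_levels: "k > 0 \<Longrightarrow> finite {i \<in> WPq_index k l. fst i + 1 \<le> r}"
  by (rule finite_subset[OF WPq_index_levels]) auto

text \<open>There are at most \<open>2 n + 1\<close> indices with \<open>L = n / 2\<close>, so the sum is at most eight times a harmonic one.
  The bound holds from \<open>3\<close> on because \<open>1 \<le> ln 3\<close> absorbs the additive constant.\<close>

lemma trace_upper_bound:
  assumes "k > 0" "3 \<le> r"
  shows "(\<Sum>i | i \<in> WPq_index k l \<and> fst i + 1 \<le> r. 1 / (fst i + 1)\<^sup>2) \<le> 24 * ln r"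
proof -
  define N where "N = nat \<lfloor>2 * r\<rfloor>"
  let ?f = "\<lambda>(n, j). (real n / 2, real_of_int j / 2)" and ?S = "SIGMA n:{..N}. {- int n..int n}"
  have inj: "inj_on ?f ?S" by (rule inj_onI) auto
  have "(\<Sum>i | i \<in> WPq_index k l \<and> fst i + 1 \<le> r. 1 / (fst i + 1)\<^sup>2) \<le> (\<Sum>i\<in>?f ` ?S. 1 / (fst i + 1)\<^sup>2)"
    using WPq_index_levels[OF assms(1), of l r] by (intro sum_mono2) (auto simp: N_def)
  also have "\<dots> = (\<Sum>n\<le>N. \<Sum>j\<in>{- int n..int n}. 1 / (real n / 2 + 1)\<^sup>2)"
    by (subst sum.reindex[OF inj], subst sum.Sigma) (simp_all add: case_prod_beta)
  also have "\<dots> \<le> (\<Sum>n\<le>N. 8 * (1 / real (Suc n)))"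
  proof (rule sum_mono)
    fix n
    have c: "real (card {- int n..int n}) = 2 * real n + 1" by simp
    have "(2 * real n + 1) * real (Suc n) \<le> 8 * (real n / 2 + 1)\<^sup>2"
      by (simp add: power2_eq_square algebra_simps)
    then have "2 * real n + 1 \<le> 8 * (real n / 2 + 1)\<^sup>2 / real (Suc n)"
      by (simp only: pos_le_divide_eq of_nat_0_less_iff zero_less_Suc)
    moreover have "0 < (real n / 2 + 1)\<^sup>2" by (intro zero_less_power) simp
    ultimately have "(2 * real n + 1) / (real n / 2 + 1)\<^sup>2 \<le> 8 / real (Suc n)"
      by (simp only: pos_divide_le_eq times_divide_eq_left)
    then show "(\<Sum>j\<in>{- int n..int n}. 1 / (real n / 2 + 1)\<^sup>2) \<le> 8 * (1 / real (Suc n))"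
      by (simp only: sum_constant c) simp
  qed
  also have "\<dots> = 8 * harm (Suc N)"
    unfolding sum_distrib_left[symmetric] harm_altdef
    by (simp add: inverse_eq_divide lessThan_Suc_atMost)
  also have "\<dots> \<le> 8 * (ln (real (Suc N)) + 1)" using decseqD[OF decseq_harm_diff_ln, of 0 N] by (simp add: harm_expand)
  also have "\<dots> \<le> 8 * (2 * ln r + ln r)"
  proof -
    have "real (Suc N) \<le> 2 * r + 1" using assms(2) unfolding N_def by simp
    also have "\<dots> \<le> 3 * r" using assms(2) by simp
    also have "\<dots> \<le> r * r" using assms(2) by (intro mult_right_mono) auto
    finally have "ln (real (Suc N)) \<le> ln (r * r)" using assms(2) by (subst ln_le_cancel_iff) auto
    also have "\<dots> = 2 * ln r" using assms(2) by (simp add: ln_mult)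
    finally have 1: "ln (real (Suc N)) \<le> 2 * ln r" .
    have "exp 1 \<le> r" using exp_le assms(2) by linarith
    then have "1 \<le> ln r" using assms(2) by (subst ln_ge_iff) auto
    with 1 show ?thesis by simp
  qed
  finally show ?thesis by simp
qed

text \<open>For integral \<open>L = n\<close> all integers \<open>p\<close> between \<open>0\<close> and \<open>n / (l + k)\<close> occur, more than \<open>n / (l + k)\<close> in number.\<close>

lemma trace_lower_bound:
  assumes "k > 0" "1 \<le> r"
  shows "ln r / (real l + real k) \<le> (\<Sum>i | i \<in> WPq_index k l \<and> fst i + 1 \<le> r. 1 / (fst i + 1)\<^sup>2)"
proof -
  define s where "s = l + k"
  have s: "s > 0" using assms by (simp add: s_def)
  define M where "M = nat \<lfloor>r\<rfloor>"
  have M: "M > 0" "real M \<le> r" "r \<le> real M + 1" using assms(2) by (auto simp: M_def)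
  let ?f = "\<lambda>(n, j). (real n, real j)" and ?S = "SIGMA n:{..<M}. {..n div s}"
  have inj: "inj_on ?f ?S" by (rule inj_onI) auto
  have "ln r / real s \<le> harm M / real s"
  proof (rule divide_right_mono)
    have "ln r \<le> ln (real M + 1)" using M assms(2) by (subst ln_le_cancel_iff) auto
    also have "\<dots> \<le> harm M" using ln_le_harm[of M] by (simp add: add.commute)
    finally show "ln r \<le> harm M" .
  qed simp
  also have "harm M / real s = (\<Sum>n<M. 1 / real (Suc n) / real s)"
    unfolding harm_altdef sum_divide_distrib inverse_eq_divide ..
  also have "\<dots> \<le> (\<Sum>n<M. \<Sum>j\<le>n div s. 1 / (real n + 1)\<^sup>2)"
  proof (rule sum_mono)
    fix n
    have "n < s * (n div s + 1)" using s dividend_less_times_div[of s n] by simp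
    then have "Suc n \<le> s * (n div s + 1)" by simp
    then have "real (Suc n) \<le> real (s * (n div s + 1))" by (simp only: of_nat_le_iff)
    then have b: "real n + 1 \<le> real s * (real (n div s) + 1)"
      by (simp only: of_nat_mult of_nat_add of_nat_1 of_nat_Suc add.commute)
    define x where "x = real n + 1"
    have x: "x > 0" by (simp add: x_def)
    have "1 / x / real s = x / (real s * x\<^sup>2)" using x by (simp add: power2_eq_square)
    also have "\<dots> \<le> real s * (real (n div s) + 1) / (real s * x\<^sup>2)"
      using b x s by (intro divide_right_mono) (auto simp: x_def)
    also have "\<dots> = (real (n div s) + 1) / x\<^sup>2" using s by simp
    finally have "1 / real (Suc n) / real s \<le> (real (n div s) + 1) / (real n + 1)\<^sup>2"
      by (simp add: x_def add.commute)
    then show "1 / real (Suc n) / real s \<le> (\<Sum>j\<le>n div s. 1 / (real n + 1)\<^sup>2)" by (simp add: add.commute)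
  qed
  also have "\<dots> = (\<Sum>i\<in>?f ` ?S. 1 / (fst i + 1)\<^sup>2)"
    by (subst sum.reindex[OF inj], subst sum.Sigma) (simp_all add: case_prod_beta)
  also have "\<dots> \<le> (\<Sum>i | i \<in> WPq_index k l \<and> fst i + 1 \<le> r. 1 / (fst i + 1)\<^sup>2)"
  proof (rule sum_mono2)
    show "finite {i. i \<in> WPq_index k l \<and> fst i + 1 \<le> r}" using finite_WPq_index_levels[OF assms(1)] .
    show "?f ` ?S \<subseteq> {i. i \<in> WPq_index k l \<and> fst i + 1 \<le> r}"
    proof
      fix i assume "i \<in> ?f ` ?S"
      then obtain n j where nj: "n < M" "j \<le> n div s" "i = (real n, real j)" by auto
      have "j * s \<le> n" using nj(2) s by (simp add: less_eq_div_iff_mult_less_eq)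
      then have js: "real j * (real l + real k) \<le> real n" unfolding s_def by (metis of_nat_le_iff of_nat_mult of_nat_add)
      have L: "real n \<in> half_nats" unfolding half_nats_def by (auto intro!: exI[of _ "2 * n"])
      have p: "real j \<in> half_ints" unfolding half_ints_def by (auto intro!: exI[of _ "2 * int j"])
      have w: "x \<in> weights (real n)" if "x = of_int z" "\<bar>x\<bar> \<le> real n" for x z
      proof -
        have "real n + x = real (nat (int n + z))" using that by simp
        then have "x = - real n + real (nat (int n + z))" by simp
        then show ?thesis using that(2) unfolding weights_def by auto
      qed
      have "real j * \<bar>real l - real k\<bar> \<le> real j * (real l + real k)" by (intro mult_left_mono) auto
      then have js': "\<bar>real j * (real l - real k)\<bar> \<le> real n" using js by (simp add: abs_mult)
      have "real j * (real l + real k) \<in> weights (real n)"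
        using js by (intro w[of _ "int j * (int l + int k)"]) auto
      moreover have "real j * (real l - real k) \<in> weights (real n)"
        using js' by (intro w[of _ "int j * (int l - int k)"]) auto
      ultimately have "(real n, real j) \<in> WPq_index k l" using L p by (simp add: WPq_index_def)
      moreover have "real n + 1 \<le> r" using nj(1) M by linarith
      ultimately show "i \<in> {i. i \<in> WPq_index k l \<and> fst i + 1 \<le> r}" by (simp add: nj(3))
    qed
  qed auto
  finally show ?thesis by (simp add: s_def)
qed

lemma trace_theta:
  assumes "k > 0"
  shows "(\<lambda>r. 2 * (\<Sum>i | i \<in> WPq_index k l \<and> fst i + 1 \<le> r. 1 / (fst i + 1)\<^sup>2)) \<in> \<Theta>[at_top](\<lambda>r. ln r)"
    (is "?t \<in> _")
proof (rule bigthetaI)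
  have nn: "0 \<le> ?t r" for r by (auto intro!: sum_nonneg)
  show "?t \<in> O[at_top](\<lambda>r. ln r)"
  proof (rule bigoI[where c = 48])
    show "\<forall>\<^sub>F r in at_top. norm (?t r) \<le> 48 * norm (ln r)"
      using eventually_ge_at_top[of 3]
    proof eventually_elim
      case (elim r)
      then show ?case using trace_upper_bound[OF assms elim, of l] nn[of r] by simp
    qed
  qed
  have "(\<lambda>r. ln r) \<in> O[at_top](?t)"
  proof (rule bigoI[where c = "real l + real k"])
    show "\<forall>\<^sub>F r in at_top. norm (ln r) \<le> (real l + real k) * norm (?t r)"
      using eventually_ge_at_top[of 1]
    proof eventually_elim
      case (elim r)
      have "ln r \<le> (\<Sum>i | i \<in> WPq_index k l \<and> fst i + 1 \<le> r. 1 / (fst i + 1)\<^sup>2) * (real l + real k)"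
        using trace_lower_bound[OF assms elim, of l] assms by (simp add: pos_divide_le_eq)
      also have "\<dots> \<le> ?t r * (real l + real k)" using nn[of r] by (intro mult_right_mono) auto
      finally show ?case using elim nn[of r] by (simp add: mult.commute)
    qed
  qed
  then show "?t \<in> \<Omega>[at_top](\<lambda>r. ln r)" by (simp add: bigomega_iff_bigo)
qed


section \<open>The spectral triple\<close>

text \<open>The isometry \<open>\<iota>\<close> embeds the algebra in its completion.\<close>

locale wp_completion = q_parameter +
  fixes k l :: nat and \<iota> :: "functional \<Rightarrow> 'h::complex_hilbert"
  assumes k_pos: "k > 0" and l_pos: "l > 0" and coprime: "coprime k l"
    and completion: "is_completion (WPq q k l) (haar_ip q) \<iota>"
begin

definition emb :: "word_dual \<Rightarrow> 'h" where
  "emb x = \<iota> (of_wd x)"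

lemma emb:
  assumes "x \<in> WP k l" "y \<in> WP k l"
  shows "emb (x + y) = emb x + emb y" "emb (wscale c x) = c *\<^sub>C emb x" "cinner (emb x) (emb y) = ip x y"
  using completion assms haar_ip_of_wd[OF WP_SU WP_SU]
  by (auto simp: is_completion_def WPq_simps emb_def)

lemma emb_dense: "closure (emb ` WP k l) = UNIV"
  using completion by (simp add: is_completion_def WPq_simps emb_def image_image)

lemma norm_emb: "x \<in> WP k l \<Longrightarrow> (norm (emb x))\<^sup>2 = norm_sq x"
  using arg_cong[OF emb(3)[of x x], of Re] by (simp add: cinner_self norm_sq_def)

lemma emb_zero: "emb 0 = 0"
  using emb(2)[OF WP_one WP_one, of 0] by simp

lemma emb_eq_iff:
  assumes "x \<in> WP k l" "y \<in> WP k l"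
  shows "emb x = emb y \<longleftrightarrow> x = y"
proof
  assume e: "emb x = emb y"
  have d: "x - y \<in> WP k l" "wscale (- 1) y \<in> WP k l"
    by (rule wd.subspace_diff[OF WP_subspace assms], rule wd.subspace_scale[OF WP_subspace assms(2)])
  have "emb (x - y) = 0" using emb(1)[OF assms(1) d(2)] emb(2)[OF assms(2) assms(2), of "- 1"] e by simp
  then have "norm_sq (x - y) = 0" using norm_emb[OF d(1)] by simp
  then show "x = y" using norm_sq_pos[OF WP_SU[OF d(1)]] by fastforce
qed simp

lemma emb_subspace: "complex_vector.subspace (emb ` WP k l)"
proof (rule complex_vector.subspaceI)
  show "0 \<in> emb ` WP k l" using emb_zero wd.subspace_0[OF WP_subspace] by (metis imageI)
  show "a + b \<in> emb ` WP k l" if "a \<in> emb ` WP k l" "b \<in> emb ` WP k l" for a b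
    using that by (elim imageE) (simp add: emb(1)[symmetric] wd.subspace_add[OF WP_subspace])
  show "c *\<^sub>C a \<in> emb ` WP k l" if "a \<in> emb ` WP k l" for c a
    using that by (elim imageE) (simp add: emb(2)[symmetric] wd.subspace_scale[OF WP_subspace])
qed

text \<open>Identities between continuous functions are checked on the algebra.\<close>

lemma continuous_eq:
  fixes f g :: "'h \<Rightarrow> 'b::t2_space"
  assumes "continuous_on UNIV f" "continuous_on UNIV g" "\<And>x. x \<in> WP k l \<Longrightarrow> f (emb x) = g (emb x)"
  shows "f v = g v"
  by (rule dense_eq[OF emb_dense assms(1,2)]) (use assms(3) in auto)

lemma lift_bounded_op:
  assumes f: "bounded_op f" "\<And>x. x \<in> WP k l \<Longrightarrow> f x \<in> WP k l"
    and lin: "\<And>x y. f (x + y) = f x + f y" "\<And>c x. f (wscale c x) = wscale c (f x)"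
  obtains S where "bounded_clinear S" "\<And>x. x \<in> WP k l \<Longrightarrow> S (emb x) = emb (f x)"
proof -
  obtain C where C: "0 \<le> C" "\<And>x. x \<in> SU \<Longrightarrow> norm_sq (f x) \<le> C * norm_sq x"
    using f(1) unfolding bounded_op_def by blast
  define g where "g v = emb (f (inv_into (WP k l) emb v))" for v
  have inj: "inj_on emb (WP k l)" by (rule inj_onI) (simp add: emb_eq_iff)
  have g: "g (emb x) = emb (f x)" if "x \<in> WP k l" for x
    by (simp add: g_def inv_into_f_f[OF inj that])
  note sp = wd.subspace_add[OF WP_subspace] wd.subspace_scale[OF WP_subspace]
  obtain S where "bounded_clinear S" "\<And>v. v \<in> emb ` WP k l \<Longrightarrow> S v = g v"
  proof (rule bounded_clinear_extension[OF emb_subspace emb_dense, of g "sqrt C"])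
    show "g (a + b) = g a + g b" if ab: "a \<in> emb ` WP k l" "b \<in> emb ` WP k l" for a b
    proof -
      obtain x y where x: "x \<in> WP k l" "a = emb x" and y: "y \<in> WP k l" "b = emb y" using ab by blast
      show ?thesis
        unfolding x(2) y(2) emb(1)[OF x(1) y(1), symmetric] g[OF x(1)] g[OF y(1)] g[OF sp(1)[OF x(1) y(1)]] lin
        by (rule emb(1)[OF f(2)[OF x(1)] f(2)[OF y(1)]])
    qed
    show "g (c *\<^sub>C a) = c *\<^sub>C g a" if a: "a \<in> emb ` WP k l" for c a
    proof -
      obtain x where x: "x \<in> WP k l" "a = emb x" using a by blast
      show ?thesis
        unfolding x(2) emb(2)[OF x(1) x(1), symmetric] g[OF x(1)] g[OF sp(2)[OF x(1)]] lin
        by (rule emb(2)[OF f(2)[OF x(1)] f(2)[OF x(1)]])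
    qed
    show "norm (g a) \<le> sqrt C * norm a" if a: "a \<in> emb ` WP k l" for a
    proof -
      obtain x where x: "x \<in> WP k l" "a = emb x" using a by blast
      have "(norm (emb (f x)))\<^sup>2 \<le> C * (norm (emb x))\<^sup>2"
        using C(2)[OF WP_SU[OF x(1)]] by (simp add: norm_emb x f(2))
      also have "\<dots> = (sqrt C * norm (emb x))\<^sup>2" using C(1) by (simp add: power_mult_distrib)
      finally have "norm (emb (f x)) \<le> sqrt C * norm (emb x)"
        by (rule power2_le_imp_le) (use C(1) in simp)
      then show ?thesis by (simp add: x g)
    qed
  qed blast
  then show ?thesis using g that by simp
qed

text \<open>The orthogonal basis of the completion and the eigenvalues \<open>\<lambda> + 1\<close>.\<close>

definition J :: "(real \<times> real) set" where
  "J = WPq_index k l"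

definition ev :: "real \<times> real \<Rightarrow> 'h" where
  "ev = (\<lambda>(L, p). \<iota> (WPq_basis q k l L p))"

definition dv :: "real \<times> real \<Rightarrow> real" where
  "dv i = fst i + 1"

lemma ev_emb: "i \<in> J \<Longrightarrow> ev i = emb (tb (WPidx k l i))"
  by (cases i) (simp only: J_def ev_def emb_def WPq_basis_of_wd prod.case)

lemma WP_span: "WP k l = wd.span (tb ` WPidx k l ` J)"
  unfolding WP_def graded_def J_def WPidx_image[OF k_pos l_pos coprime] ..

lemma tb_WPidx: "i \<in> J \<Longrightarrow> tb (WPidx k l i) \<in> WP k l"
  unfolding WP_span by (intro wd.span_base imageI)

lemma WPidx_idx: "i \<in> J \<Longrightarrow> WPidx k l i \<in> idx"
  using WPidx_image[OF k_pos l_pos coprime] unfolding J_def by blast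

lemma fst_WPidx: "fst (WPidx k l i) = fst i"
  by (cases i) (simp add: WPidx_def)

lemma WP_induct [consumes 1, case_names zero step]:
  assumes "x \<in> WP k l" "P 0"
    "\<And>c i y. i \<in> J \<Longrightarrow> y \<in> WP k l \<Longrightarrow> P y \<Longrightarrow> P (wscale c (tb (WPidx k l i)) + y)"
  shows "P x"
proof -
  have "x \<in> WP k l \<and> P x" using assms(1)[unfolded WP_span]
  proof (induction rule: wd.span_induct_alt)
    case base
    show ?case using assms(2) wd.subspace_0[OF WP_subspace] by simp
  next
    case (step c u y)
    then obtain i where i: "i \<in> J" "u = tb (WPidx k l i)" by blast
    show ?case unfolding i(2)
      using step i assms(3) tb_WPidx[OF i(1)] wd.subspace_add[OF WP_subspace] wd.subspace_scale[OF WP_subspace] by blast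
  qed
  then show ?thesis ..
qed

lemma emb_in_span: "x \<in> WP k l \<Longrightarrow> emb x \<in> complex_vector.span (ev ` J)"
proof (induction rule: WP_induct)
  case zero
  show ?case by (simp add: emb_zero complex_vector.span_zero)
next
  case (step c i y)
  have "emb (wscale c (tb (WPidx k l i)) + y) = c *\<^sub>C ev i + emb y"
    using step tb_WPidx[OF step(1)] wd.subspace_scale[OF WP_subspace]
    by (simp add: emb(1) emb(2)[OF _ step(2)] ev_emb del: tb_simp)
  then show ?case
    using step by (simp add: complex_vector.span_add complex_vector.span_scale complex_vector.span_base)
qed

sublocale ds: diagonal_system ev J dv
proof
  show "cinner (ev i) (ev j) = 0" if "i \<in> J" "j \<in> J" "i \<noteq> j" for i j
  proof -
    have "WPidx k l i \<noteq> WPidx k l j" using that WPidx_inj[OF k_pos, of l J] by (auto dest: inj_onD)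
    then show ?thesis using that
      by (simp add: ev_emb emb(3) tb_WPidx ip_orthogonal WPidx_idx del: tb_simp)
  qed
  show "ev i \<noteq> 0" if "i \<in> J" for i
  proof -
    have "cinner (ev i) (ev i) = of_real (coeff_norm_sq (WPidx k l i))"
      using that by (simp add: ev_emb emb(3) tb_WPidx ip_tb_self WPidx_idx del: tb_simp)
    then show ?thesis using coeff_norm_sq_pos[OF WPidx_idx[OF that]] by auto
  qed
  have "emb ` WP k l \<subseteq> complex_vector.span (ev ` J)" using emb_in_span by blast
  from closure_mono[OF this] show "closure (complex_vector.span (ev ` J)) = UNIV" using emb_dense by auto
  show "0 < dv i" if "i \<in> J" for i
    using that half_nats_iff[of "fst i"] by (auto simp: J_def dv_def WPq_index_def)
  show "finite {i \<in> J. dv i \<le> r}" for r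
    unfolding J_def dv_def by (rule finite_WPq_index_levels[OF k_pos])
qed

lemma WP_deg: "x \<in> WP k l \<Longrightarrow> deg x \<in> WP k l"
  unfolding deg_def by (rule WP_multiplier)

text \<open>The bounded operator on the completion inverts \<open>N\<close> on the algebra.\<close>

lemma inv_op_deg:
  assumes "x \<in> WP k l"
  shows "ds.inv_op (emb (deg x)) = emb x"
  using assms
proof (induction rule: WP_induct)
  case zero
  show ?case by (simp add: emb_zero bounded_clinearD(5)[OF ds.inv_op_bounded])
next
  case (step c i y)
  let ?t = "tb (WPidx k l i)"
  have d: "deg ?t = wscale (of_real (dv i)) ?t"
    unfolding deg_def multiplier(2)[OF WPidx_idx[OF step(1)]] by (simp add: fst_WPidx dv_def)
  note sp = wd.subspace_add[OF WP_subspace] wd.subspace_scale[OF WP_subspace] tb_WPidx[OF step(1)]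
  have t: "ds.inv_op (emb (deg ?t)) = emb ?t"
    unfolding d emb(2)[OF sp(3) sp(3)] ev_emb[OF step(1), symmetric] ds.inv_op_linear ds.inv_op_e[OF step(1)]
    using ds.d_pos[OF step(1)] by (simp add: scaleC_of_real)
  have "ds.inv_op (emb (deg (wscale c ?t + y))) = c *\<^sub>C ds.inv_op (emb (deg ?t)) + ds.inv_op (emb (deg y))"
    using sp step(2) WP_deg
    by (simp add: emb(1) emb(2)[OF _ step(2)] ds.inv_op_linear del: tb_simp)
  also have "\<dots> = emb (wscale c ?t + y)"
    unfolding t step(3) using sp step(2) by (simp add: emb(1) emb(2)[OF _ step(2)] del: tb_simp)
  finally show ?case .
qed

lemma deg_surj:
  assumes "x \<in> WP k l"
  obtains y where "y \<in> WP k l" "x = deg y"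
proof
  define y where "y = multiplier (\<lambda>i. 1 / of_real (fst i + 1)) x"
  show "y \<in> WP k l" unfolding y_def by (rule WP_multiplier[OF assms])
  have "deg y = multiplier (\<lambda>i. 1) x"
    unfolding deg_def y_def multiplier_multiplier[OF WP_SU[OF assms]]
  proof (rule multiplier_cong[OF WP_SU[OF assms]])
    fix i :: "real \<times> real \<times> real" assume "i \<in> idx"
    then have "0 \<le> fst i" using half_nats_iff by (cases i) (simp add: idx_iff)
    then have "complex_of_real (fst i + 1) \<noteq> 0" by (simp only: of_real_eq_0_iff)
    then show "1 / complex_of_real (fst i + 1) * of_real (fst i + 1) = 1" by (simp only: divide_self_if times_divide_eq_left mult_1 if_False)
  qed
  then show "x = deg y" using multiplier_const[OF WP_SU[OF assms], of 1] by simp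
qed

abbreviation lrep :: "functional \<Rightarrow> 'h \<Rightarrow> 'h" where
  "lrep \<equiv> left_mult_rep (WPq q k l) \<iota>"

lemma left_mult_rep_of_wd:
  assumes a: "a \<in> WP k l"
  shows "bounded_clinear (lrep (of_wd a))" "x \<in> WP k l \<Longrightarrow> lrep (of_wd a) (emb x) = emb (a * x)"
proof -
  let ?P = "\<lambda>S. bounded_clinear S \<and> (\<forall>b\<in>carrier (WPq q k l). S (\<iota> b) = \<iota> (of_wd a \<otimes>\<^bsub>WPq q k l\<^esub> b))"
  have P: "?P S \<longleftrightarrow> bounded_clinear S \<and> (\<forall>x\<in>WP k l. S (emb x) = emb (a * x))" for S
    by (simp add: WPq_simps emb_def)
  obtain S where S: "bounded_clinear S" "\<And>x. x \<in> WP k l \<Longrightarrow> S (emb x) = emb (a * x)"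
    by (rule lift_bounded_op[of "\<lambda>x. a * x"])
      (use a in \<open>auto simp: bounded_op_left_mult WP_SU WP_mult distrib_left\<close>)
  have "?P (THE S. ?P S)"
  proof (rule theI[of ?P S])
    show "?P S" unfolding P using S by blast
    fix S' assume "?P S'"
    then have S': "bounded_clinear S'" "\<And>x. x \<in> WP k l \<Longrightarrow> S' (emb x) = emb (a * x)" unfolding P by blast+
    show "S' = S"
    proof
      fix v show "S' v = S v"
        by (rule continuous_eq) (simp_all add: bounded_clinearD(8) S S')
    qed
  qed
  then have "?P (lrep (of_wd a))" unfolding left_mult_rep_def .
  then show "bounded_clinear (lrep (of_wd a))" "x \<in> WP k l \<Longrightarrow> lrep (of_wd a) (emb x) = emb (a * x)"
    unfolding P by blast+
qed

lemma lrep_eqI: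
  assumes "continuous_on UNIV f" "a \<in> WP k l" "\<And>x. x \<in> WP k l \<Longrightarrow> emb (a * x) = f (emb x)"
  shows "lrep (of_wd a) v = f v"
  by (rule continuous_eq) (simp_all add: assms left_mult_rep_of_wd bounded_clinearD(8)[OF left_mult_rep_of_wd(1)])

lemma lrep_simps:
  assumes a: "a \<in> WP k l" and b: "b \<in> WP k l"
  shows "lrep (of_wd (a + b)) v = lrep (of_wd a) v + lrep (of_wd b) v"
    "lrep (of_wd (wscale c a)) v = c *\<^sub>C lrep (of_wd a) v"
    "lrep (of_wd (a * b)) v = lrep (of_wd a) (lrep (of_wd b) v)"
    "lrep (of_wd 1) v = v"
    "cinner (lrep (of_wd (wstar q a)) v) w = cinner v (lrep (of_wd a) w)"
proof -
  note sp = wd.subspace_add[OF WP_subspace] wd.subspace_scale[OF WP_subspace] WP_mult WP_one WP_wstar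
  note A = left_mult_rep_of_wd[OF a] and B = left_mult_rep_of_wd[OF b] and S = left_mult_rep_of_wd[OF WP_wstar[OF a]]
  note ca = bounded_clinearD(8)[OF A(1)] and cb = bounded_clinearD(8)[OF B(1)] and cs = bounded_clinearD(8)[OF S(1)]
  show "lrep (of_wd (a + b)) v = lrep (of_wd a) v + lrep (of_wd b) v"
    by (rule lrep_eqI) (auto intro!: continuous_intros ca cb simp: a b sp A B distrib_right emb)
  show "lrep (of_wd (wscale c a)) v = c *\<^sub>C lrep (of_wd a) v"
    by (rule lrep_eqI) (auto intro!: bounded_linear.continuous_on[OF bounded_linear_scaleC] ca simp: a sp A emb(2)[OF sp(3)[OF a] a])
  show "lrep (of_wd (a * b)) v = lrep (of_wd a) (lrep (of_wd b) v)"
    by (rule lrep_eqI) (auto intro!: bounded_clinearD(9)[OF A(1)] cb simp: a b sp A B mult.assoc)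
  show "lrep (of_wd 1) v = v"
    by (rule lrep_eqI) (auto simp: sp)
  have 1: "cinner (lrep (of_wd (wstar q a)) (emb x)) (emb y) = cinner (emb x) (lrep (of_wd a) (emb y))"
    if "x \<in> WP k l" "y \<in> WP k l" for x y
    using that a by (simp add: A S sp emb(3) ip_mult_left wstar_wstar less_imp_neq[OF q_pos, symmetric])
  have 2: "cinner (lrep (of_wd (wstar q a)) (emb x)) w = cinner (emb x) (lrep (of_wd a) w)" if "x \<in> WP k l" for x w
    by (rule continuous_eq) (auto intro!: continuous_intros ca 1 that)
  show "cinner (lrep (of_wd (wstar q a)) v) w = cinner v (lrep (of_wd a) w)"
    by (rule continuous_eq[where f = "\<lambda>v. cinner (lrep (of_wd (wstar q a)) v) w"])
      (auto intro!: continuous_intros cs 2)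
qed

abbreviation \<pi> :: "functional \<Rightarrow> 'h \<times> 'h \<Rightarrow> 'h \<times> 'h" where
  "\<pi> \<equiv> rep_sum lrep"

lemma bounded_clinear_pair:
  assumes "bounded_clinear S" "bounded_clinear U"
  shows "bounded_clinear (\<lambda>z :: 'h \<times> 'h. (S (fst z), U (snd z)))" "bounded_clinear (\<lambda>z :: 'h \<times> 'h. (S (snd z), U (fst z)))"
proof -
  note S = bounded_clinearD[OF assms(1)] and U = bounded_clinearD[OF assms(2)]
  show "bounded_clinear (\<lambda>z :: 'h \<times> 'h. (S (fst z), U (snd z)))"
    using bounded_linear_Pair[OF bounded_linear_compose[OF S(1) bounded_linear_fst] bounded_linear_compose[OF U(1) bounded_linear_snd]]
    by (simp add: bounded_clinear_def scaleC_prod_def S(3) U(3))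
  show "bounded_clinear (\<lambda>z :: 'h \<times> 'h. (S (snd z), U (fst z)))"
    using bounded_linear_Pair[OF bounded_linear_compose[OF S(1) bounded_linear_snd] bounded_linear_compose[OF U(1) bounded_linear_fst]]
    by (simp add: bounded_clinear_def scaleC_prod_def S(3) U(3))
qed

lemma faithful: "faithful_star_rep (WPq q k l) \<pi>"
proof -
  have inj: "inj_on \<pi> (carrier (WPq q k l))"
  proof (rule inj_onI)
    fix s t assume "s \<in> carrier (WPq q k l)" "t \<in> carrier (WPq q k l)" and eq: "\<pi> s = \<pi> t"
    then obtain a b where ab: "s = of_wd a" "a \<in> WP k l" "t = of_wd b" "b \<in> WP k l" by (auto simp: WPq_simps)
    have "lrep (of_wd a) (emb 1) = lrep (of_wd b) (emb 1)"
      using fun_cong[OF eq, of "(emb 1, 0)"] by (simp add: rep_sum_def ab)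
    then have "emb (a * 1) = emb (b * 1)" using ab WP_one by (simp only: left_mult_rep_of_wd(2))
    then show "s = t" using ab by (simp add: emb_eq_iff)
  qed
  have bd: "bounded_clinear (\<pi> (of_wd a))" if "a \<in> WP k l" for a
    unfolding rep_sum_def[abs_def] by (intro bounded_clinear_pair left_mult_rep_of_wd that)
  have one: "\<pi> (of_wd 1) = id"
    by (simp add: fun_eq_iff rep_sum_def lrep_simps(4)[OF WP_one WP_one])
  show ?thesis
    unfolding faithful_star_rep_def
    by (simp add: WPq_simps inj[unfolded WPq_simps] one bd)
      (auto simp: rep_sum_def fun_eq_iff scaleC_prod_def cinner_prod_def plus_prod_def lrep_simps)
qed

text \<open>The prescribed pairs span a set of the form \<open>(R v, v)\<close> with \<open>v\<close> in a dense subspace, so \<open>self_adjoint_unique\<close>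
  applies.\<close>

lemma WPq_dirac_eq: "WPq_dirac q k l \<iota> = ds.dirac"
  unfolding WPq_dirac_def
proof (rule the_equality)
  note Rl = bounded_clinearD[OF ds.inv_op_bounded]
  have "((ev i, 0), (0, dv i *\<^sub>R ev i)) \<in> ds.dirac \<and> ((0, ev i), (dv i *\<^sub>R ev i, 0)) \<in> ds.dirac" if "i \<in> J" for i
    using ds.d_pos[OF that] by (simp add: ds.swap.inverse_graph_iff ds.swap_inv_def Rl ds.inv_op_e[OF that])
  then show "self_adjoint ds.dirac \<and> (\<forall>(L, p)\<in>WPq_index k l.
     ((\<iota> (WPq_basis q k l L p), 0), (0, (L + 1) *\<^sub>R \<iota> (WPq_basis q k l L p))) \<in> ds.dirac \<and>
     ((0, \<iota> (WPq_basis q k l L p)), ((L + 1) *\<^sub>R \<iota> (WPq_basis q k l L p), 0)) \<in> ds.dirac)"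
    using ds.swap.self_adjoint_inverse_graph by (fastforce simp: J_def ev_def dv_def)
  fix D assume D: "self_adjoint D \<and> (\<forall>(L, p)\<in>WPq_index k l.
     ((\<iota> (WPq_basis q k l L p), 0), (0, (L + 1) *\<^sub>R \<iota> (WPq_basis q k l L p))) \<in> D \<and>
     ((0, \<iota> (WPq_basis q k l L p)), ((L + 1) *\<^sub>R \<iota> (WPq_basis q k l L p), 0)) \<in> D)"
  have sub: "complex_vector.subspace D" using D by (simp add: self_adjoint_def linear_operator_def)
  have De: "((ev i, 0), (0, dv i *\<^sub>R ev i)) \<in> D" "((0, ev i), (dv i *\<^sub>R ev i, 0)) \<in> D" if "i \<in> J" for i
    using D that by (auto simp: J_def ev_def dv_def)
  have gen: "(ds.swap_inv (ev i, 0), (ev i, 0)) \<in> D" "(ds.swap_inv (0, ev i), (0, ev i)) \<in> D" if i: "i \<in> J" for i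
    using complex_vector.subspace_scale[OF sub De(1)[OF i], of "of_real (1 / dv i)"]
      complex_vector.subspace_scale[OF sub De(2)[OF i], of "of_real (1 / dv i)"] ds.d_pos[OF i]
    by (simp_all add: ds.swap_inv_def Rl ds.inv_op_e[OF i] scaleC_prod_def scaleC_of_real del: of_real_divide)
  have add: "(ds.swap_inv (v + w), v + w) \<in> D" if "(ds.swap_inv v, v) \<in> D" "(ds.swap_inv w, w) \<in> D" for v w
    using complex_vector.subspace_add[OF sub that] by (simp add: bounded_clinearD(2)[OF ds.swap_inv_bounded])
  have scale: "(ds.swap_inv (c *\<^sub>C v), c *\<^sub>C v) \<in> D" if "(ds.swap_inv v, v) \<in> D" for c v
    using complex_vector.subspace_scale[OF sub that, of c] by (simp add: bounded_clinearD(3)[OF ds.swap_inv_bounded] scaleC_prod_def[of c "(ds.swap_inv v, v)"])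
  have zero: "(ds.swap_inv (0, 0), (0, 0)) \<in> D"
    using complex_vector.subspace_0[OF sub] by (simp add: ds.swap_inv_def Rl zero_prod_def)
  have left: "(ds.swap_inv (a, 0), (a, 0)) \<in> D" if "a \<in> complex_vector.span (ev ` J)" for a
    using that
  proof (induction rule: complex_vector.span_induct_alt)
    case (step c x y)
    then obtain i where "i \<in> J" "x = ev i" by blast
    then have "(ds.swap_inv (c *\<^sub>C (x, 0) + (y, 0)), c *\<^sub>C (x, 0) + (y, 0)) \<in> D"
      using add scale gen(1) step by blast
    then show ?case by (simp add: scaleC_prod_def)
  qed (rule zero)
  have right: "(ds.swap_inv (0, a), (0, a)) \<in> D" if "a \<in> complex_vector.span (ev ` J)" for a
    using that
  proof (induction rule: complex_vector.span_induct_alt)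
    case (step c x y)
    then obtain i where "i \<in> J" "x = ev i" by blast
    then have "(ds.swap_inv (c *\<^sub>C (0, x) + (0, y)), c *\<^sub>C (0, x) + (0, y)) \<in> D"
      using add scale gen(2) step by blast
    then show ?case by (simp add: scaleC_prod_def)
  qed (rule zero)
  show "D = ds.dirac"
  proof (rule ds.swap.self_adjoint_unique[OF _ ds.dense_pairs])
    show "self_adjoint D" using D by blast
    fix v assume "v \<in> complex_vector.span (ev ` J) \<times> complex_vector.span (ev ` J)"
    then obtain a b where "v = (a, b)" "a \<in> complex_vector.span (ev ` J)" "b \<in> complex_vector.span (ev ` J)" by blast
    then show "(ds.swap_inv v, v) \<in> D" using add[OF left[of a] right[of b]] by simp
  qed
qed

text \<open>With \<open>R = N\<^sup>-\<^sup>1\<close> and \<open>S\<close> the extension of \<open>[N, a]\<close>, the claim becomes the identity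
  \<open>a R = R (a + S R)\<close> of bounded operators. On vectors \<open>N y\<close> of the algebra it is the definition
  of the commutator.\<close>

lemma commutator_bounded:
  assumes a: "a \<in> WP k l"
  shows "bounded_commutator ds.dirac (\<pi> (of_wd a))"
proof -
  note A = left_mult_rep_of_wd[OF a]
  obtain S where S: "bounded_clinear S" "\<And>x. x \<in> WP k l \<Longrightarrow> S (emb x) = emb (comm_deg a x)"
  proof (rule lift_bounded_op[of "comm_deg a"])
    show "bounded_op (comm_deg a)" by (rule bounded_op_comm_deg[OF WP_SU[OF a]])
    show "comm_deg a x \<in> WP k l" if "x \<in> WP k l" for x
      unfolding comm_deg_def using a that
      by (intro wd.subspace_diff[OF WP_subspace] WP_mult WP_deg)
  qed (auto simp: comm_deg_def distrib_left wd.scale_right_diff_distrib)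
  have key: "lrep (of_wd a) (ds.inv_op v) = ds.inv_op (lrep (of_wd a) v + S (ds.inv_op v))" for v
  proof (rule continuous_eq[where f = "\<lambda>v. lrep (of_wd a) (ds.inv_op v)"])
    note c = bounded_clinearD(8)[OF ds.inv_op_bounded]
    show "continuous_on UNIV (\<lambda>v. lrep (of_wd a) (ds.inv_op v))"
      by (intro bounded_clinearD(9)[OF A(1)] c)
    show "continuous_on UNIV (\<lambda>v. ds.inv_op (lrep (of_wd a) v + S (ds.inv_op v)))"
      by (intro bounded_clinearD(9)[OF ds.inv_op_bounded] continuous_on_add bounded_clinearD(8)[OF A(1)]
          bounded_clinearD(9)[OF S(1)] c)
    fix x assume "x \<in> WP k l"
    then obtain y where y: "y \<in> WP k l" "x = deg y" by (rule deg_surj)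
    have cd: "comm_deg a y \<in> WP k l"
      unfolding comm_deg_def using a y by (intro wd.subspace_diff[OF WP_subspace] WP_mult WP_deg)
    have "lrep (of_wd a) (emb x) + S (ds.inv_op (emb x)) = emb (deg (a * y))"
      using a y cd by (simp add: inv_op_deg A S WP_deg WP_mult emb(1)[symmetric]) (simp add: comm_deg_def)
    then show "lrep (of_wd a) (ds.inv_op (emb x)) = ds.inv_op (lrep (of_wd a) (emb x) + S (ds.inv_op (emb x)))"
      using a y by (simp add: inv_op_deg WP_mult A)
  qed
  show ?thesis
    unfolding bounded_commutator_def
  proof (intro exI conjI)
    show "bounded_clinear (\<lambda>z :: 'h \<times> 'h. (S (snd z), S (fst z)))" by (rule bounded_clinear_pair(2)[OF S(1) S(1)])
    show "\<forall>(x, y)\<in>ds.dirac. (\<pi> (of_wd a) x, \<pi> (of_wd a) y + (S (snd x), S (fst x))) \<in> ds.dirac"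
      by (auto simp: ds.swap.inverse_graph_iff ds.swap_inv_def rep_sum_def key)
  qed
qed

lemma spectral_triple_WPq:
  "even_spectral_triple (WPq q k l) \<pi> (WPq_dirac q k l \<iota>) chirality"
  unfolding even_spectral_triple_def spectral_triple_def WPq_dirac_eq
proof (intro conjI)
  show "unital_star_algebra (WPq q k l)" by (rule unital_star_algebra_WPq)
  show "faithful_star_rep (WPq q k l) \<pi>" by (rule faithful)
  show "self_adjoint ds.dirac" by (rule ds.swap.self_adjoint_inverse_graph)
  show "compact_resolvent ds.dirac" by (rule ds.swap.compact_resolvent_inverse_graph[OF ds.swap_inv_compact])
  show "\<forall>a\<in>carrier (WPq q k l). bounded_commutator ds.dirac (\<pi> a)"
    by (auto simp: WPq_simps commutator_bounded)
  have "bounded_clinear (\<lambda>x :: 'h. - x)" using bounded_clinear_scaleC[of "- 1"] by simp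
  from bounded_clinear_pair(1)[OF bounded_clinear_id this]
  show "bounded_clinear (chirality :: 'h \<times> 'h \<Rightarrow> _)" by (simp add: chirality_def[abs_def])
  have m: "cinner (- x) y = - cinner x y" "cinner x (- y) = - cinner x y" for x y :: 'h
    using cinner_simps(8)[of 0 x y] cinner_simps(7)[of x 0 y] by simp_all
  show "\<forall>x y :: 'h \<times> 'h. cinner (chirality x) y = cinner x (chirality y)"
    by (simp add: chirality_def cinner_prod_def m)
  show "chirality \<circ> chirality = (id :: 'h \<times> 'h \<Rightarrow> _)" by (simp add: fun_eq_iff chirality_def)
  show "\<forall>(x, y)\<in>ds.dirac. (chirality x, - chirality y) \<in> ds.dirac"
    using bounded_clinearD(7)[OF ds.inv_op_bounded]
    by (auto simp: ds.swap.inverse_graph_iff ds.swap_inv_def chirality_def)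
  show "\<forall>a\<in>carrier (WPq q k l). chirality \<circ> \<pi> a = \<pi> a \<circ> chirality"
    by (auto simp: WPq_simps fun_eq_iff chirality_def rep_sum_def bounded_clinearD(7)[OF left_mult_rep_of_wd(1)])
qed

lemma two_summable_WPq: "two_summable (WPq_dirac q k l \<iota>)"
  unfolding two_summable_def WPq_dirac_eq
proof
  show "\<exists>R. is_resolvent ds.dirac 0 R" using ds.swap.is_resolvent_inverse_graph by blast
  have "truncated_trace ds.dirac = (\<lambda>r. 2 * (\<Sum>i | i \<in> WPq_index k l \<and> fst i + 1 \<le> r. 1 / (fst i + 1)\<^sup>2))"
    unfolding ds.truncated_trace_dirac[abs_def] by (simp add: J_def dv_def)
  then show "truncated_trace ds.dirac \<in> \<Theta>[at_top](\<lambda>\<Lambda>. ln \<Lambda>)" using trace_theta[OF k_pos] by simp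
qed

end

theorem theorem3:
  fixes q :: real and k l :: nat
  assumes "0 < q" and "q < 1" and "k > 0" and "l > 0" and "coprime k l"
  shows "inner_product_on (WPq q k l) (haar_ip q) \<and>
    (\<forall>\<iota> :: functional \<Rightarrow> 'h::complex_hilbert.
       is_completion (WPq q k l) (haar_ip q) \<iota> \<longrightarrow>
         even_spectral_triple (WPq q k l) (rep_sum (left_mult_rep (WPq q k l) \<iota>))
           (WPq_dirac q k l \<iota>) chirality \<and>
         two_summable (WPq_dirac q k l \<iota>))"
proof -
  interpret q_parameter q using assms by unfold_locales
  have "even_spectral_triple (WPq q k l) (rep_sum (left_mult_rep (WPq q k l) \<iota>)) (WPq_dirac q k l \<iota>) chirality \<and>
      two_summable (WPq_dirac q k l \<iota>)"
    if "is_completion (WPq q k l) (haar_ip q) \<iota>" for \<iota> :: "functional \<Rightarrow> 'h"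
  proof -
    interpret wp_completion q k l \<iota> using assms that by unfold_locales
    show ?thesis using spectral_triple_WPq two_summable_WPq ..
  qed
  then show ?thesis using inner_product_on_WPq by blast
qed


end
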